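(* A cyclic descent statistic $\operatorname{cst}$ is cyclic shuffle-compatible if and only if there exists a $\mathbb{Q}$-algebra homomorphism $\phi_{\operatorname{cst}}\colon\mathrm{cQSym}^{-}\rightarrow A$, where $A$ is a $\mathbb{Q}$-algebra with basis $\{v_{\alpha}\}$ indexed by $\operatorname{cst}$-equivalence classes $\alpha$ of non-Escher cyclic compositions, such that $\phi_{\operatorname{cst}}(F_{[L]}^{\mathrm{cyc}})=v_{\alpha}$ whenever $[L]\in\alpha$. In this case, the linear map on $\mathcal{A}_{\operatorname{cst}}^{\mathrm{cyc}}$ defined by $$[\pi]_{\operatorname{cst}}\mapsto v_{\alpha},\qquad\text{where } \operatorname{cComp}[\pi]\in\alpha,$$ is a $\mathbb{Q}$-algebra isomorphism from $\mathcal{A}_{\operatorname{cst}}^{\mathrm{cyc}}$ to $A$.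
   Context: A (linear) permutation of length $n\ge 0$ is a sequence $\pi=\pi_1\cdots\pi_n$ of $n$ distinct positive integers; $|\pi|=n$; $\mathfrak{P}_n$ is the set of permutations of length $n$. Two permutations are disjoint if they have no letter in common, and have the same relative order if they have the same standardization (replace the $i$th smallest letter by $i$). For disjoint $\pi\in\mathfrak{P}_m$, $\sigma\in\mathfrak{P}_n$, $\operatorname{Sh}(\pi,\sigma)$ is the set of $\tau\in\mathfrak{P}_{m+n}$ having both $\pi$ and $\sigma$ as subsequences. The cyclic permutation $[\pi]$ is the set of all rotations of $\pi$; its length is $|\pi|$. A cyclic permutation statistic is a function $\operatorname{cst}$ on cyclic permutations with $\operatorname{cst}[\pi]=\operatorname{cst}[\sigma]$ whenever $\pi,\sigma$ have the same relative order. For disjoint $\pi,\sigma$, $\operatorname{cSh}([\pi],[\sigma])$ is the set of all $[\tau]$ with $\tau\in\operatorname{Sh}(\bar\pi,\bar\sigma)$ for some $\bar\pi\in[\pi]$, $\bar\sigma\in[\sigma]$. The statistic $\operatorname{cst}$ is cyclic shuffle-compatible if for disjoint $\pi,\sigma$ the multiset $\{\{\operatorname{cst}[\tau]:[\tau]\in\operatorname{cSh}([\pi],[\sigma])\}\}$ depends only on $\operatorname{cst}[\pi],\operatorname{cst}[\sigma],|\pi|,|\sigma|$. $[\pi]_{\operatorname{cst}}$ denotes the equivalence class of $[\pi]$ under: $[\pi]\sim[\sigma]$ iff $\operatorname{cst}[\pi]=\operatorname{cst}[\sigma]$ and $|\pi|=|\sigma|$. $\mathcal{A}^{\mathrm{cyc}}_{\operatorname{cst}}$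 is the $\mathbb{Q}$-vector space with basis these classes; when $\operatorname{cst}$ is cyclic shuffle-compatible it is a $\mathbb{Q}$-algebra with multiplication $[\pi]_{\operatorname{cst}}[\sigma]_{\operatorname{cst}}=\sum_{[\tau]\in\operatorname{cSh}([\pi],[\sigma])}[\tau]_{\operatorname{cst}}$ for $\pi,\sigma$ disjoint. Cyclic descents: for $\pi\in\mathfrak{P}_n$, $\operatorname{cDes}\pi=\{i\in[n]:\pi_i>\pi_{i+1}\}$ with indices modulo $n$. A subset $S\subseteq[n]$ is non-Escher if it is $\operatorname{cDes}\pi$ for some $\pi\in\mathfrak{P}_n$ (for $n\le 1$ only $\emptyset$; for $n\ge2$ all subsets except $\emptyset$ and $[n]$). For $i\in\mathbb{Z}$, the cyclic shift is $S+i=\{s+i:s\in S\}$ modulo $n$; $[S]$ is the class of $S$ under cyclic shift. For non-Escher $S=\{s_1<\dots<s_j\}\subseteq[n]$, $\operatorname{cComp}S=(s_2-s_1,\dots,s_j-s_{j-1},n-s_j+s_1)$ if $n\ge2$, $(1)$ if $n=1$, and $\emptyset$ if $n=0$. A cyclic composition $[L]$ is the equivalence class of a composition $L$ under cyclic shift of its parts (the empty one is allowed). $\operatorname{cComp}[S]:=[\operatorname{cComp}S]$; a cyclic composition is non-Escher if it has the form $\operatorname{cComp}[S]$ with $S$ non-Escher. This gives a bijection between classes $[S]$ of non-Escher subsets of $[n]$ and non-Escher cyclic compositions of $n$. For $\pi$ with $\operatorname{cDes}\pi=S$, $\operatorname{cComp}[\pi]:=\operatorname{cComp}[S]$. A cyclic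 descent statistic is a cyclic permutation statistic such that $\operatorname{cComp}[\pi]=\operatorname{cComp}[\sigma]$ implies $\operatorname{cst}[\pi]=\operatorname{cst}[\sigma]$; $\operatorname{cst}[L]$ then denotes its value on any $[\pi]$ with $\operatorname{cComp}[\pi]=[L]$. Two cyclic compositions of the same size (sum of parts) are $\operatorname{cst}$-equivalent if $\operatorname{cst}$ takes the same value on them. Quasisymmetric functions: for $T\subseteq[n-1]$, $F_{n,T}=\sum x_{i_1}\cdots x_{i_n}$ over $i_1\le\cdots\le i_n$ with $i_j<i_{j+1}$ if $j\in T$, in $\mathbb{Q}[[x_1,x_2,\dots]]$. For $n\ge1$ and $S\subseteq[n]$, $F^{\mathrm{cyc}}_{n,S}=\sum_{i\in[n]}F_{n,(S+i)\cap[n-1]}$, and $F^{\mathrm{cyc}}_{0,\emptyset}=1$; these depend only on $[S]$. For a non-Escher cyclic composition $[L]=\operatorname{cComp}[S]$ of $n$, $F^{\mathrm{cyc}}_{[L]}:=F^{\mathrm{cyc}}_{n,S}$. $\mathrm{cQSym}^-$ is the $\mathbb{Q}$-span of all $F^{\mathrm{cyc}}_{n,S}$, $n\ge0$, $S\subseteq[n]$ non-Escher; it is a $\mathbb{Q}$-subalgebra of $\mathbb{Q}[[x_1,x_2,\dots]]$. *)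

theory Defs
  imports "HOL-Algebra.Module" "HOL-Library.Poly_Mapping" "HOL-Library.Sublist"
    "HOL-Library.Multiset" "HOL-Library.Infinite_Typeclass"
begin

hide_const (open) Multiset.mult

section \<open>Permutations, cyclic permutations and shuffles\<close>

definition is_perm :: "nat list \<Rightarrow> bool" where
  "is_perm \<pi> \<longleftrightarrow> distinct \<pi> \<and> (\<forall>x\<in>set \<pi>. 0 < x)"

definition std :: "nat list \<Rightarrow> nat list" where
  "std \<pi> = map (\<lambda>x. card {y \<in> set \<pi>. y \<le> x}) \<pi>"

definition same_order :: "nat list \<Rightarrow> nat list \<Rightarrow> bool" where
  "same_order \<pi> \<sigma> \<longleftrightarrow> std \<pi> = std \<sigma>"

definition perm_disjoint :: "nat list \<Rightarrow> nat list \<Rightarrow> bool" where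
  "perm_disjoint \<pi> \<sigma> \<longleftrightarrow> set \<pi> \<inter> set \<sigma> = {}"

definition Sh :: "nat list \<Rightarrow> nat list \<Rightarrow> nat list set" where
  "Sh \<pi> \<sigma> = {\<tau>. is_perm \<tau> \<and> length \<tau> = length \<pi> + length \<sigma> \<and> subseq \<pi> \<tau> \<and> subseq \<sigma> \<tau>}"

text \<open>The class of a list under rotation; it serves both for cyclic permutations and for cyclic
  compositions.\<close>

definition cyc :: "'a list \<Rightarrow> 'a list set" where
  "cyc xs = {rotate k xs | k. True}"

definition cSh :: "nat list set \<Rightarrow> nat list set \<Rightarrow> nat list set set" where
  "cSh P Q = {cyc \<tau> | \<tau>. \<exists>\<pi>\<in>P. \<exists>\<sigma>\<in>Q. \<tau> \<in> Sh \<pi> \<sigma>}"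

text \<open>A statistic is a function on all sets of lists, of which only the values on cyclic
  permutations matter.\<close>

definition cyclic_statistic :: "(nat list set \<Rightarrow> 'b) \<Rightarrow> bool" where
  "cyclic_statistic cst \<longleftrightarrow>
    (\<forall>\<pi> \<sigma>. is_perm \<pi> \<and> is_perm \<sigma> \<and> same_order \<pi> \<sigma> \<longrightarrow> cst (cyc \<pi>) = cst (cyc \<sigma>))"

definition cyclic_shuffle_compatible :: "(nat list set \<Rightarrow> 'b) \<Rightarrow> bool" where
  "cyclic_shuffle_compatible cst \<longleftrightarrow>
    (\<forall>\<pi> \<sigma> \<pi>' \<sigma>'. is_perm \<pi> \<and> is_perm \<sigma> \<and> perm_disjoint \<pi> \<sigma> \<and>
        is_perm \<pi>' \<and> is_perm \<sigma>' \<and> perm_disjoint \<pi>' \<sigma>' \<and>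
        cst (cyc \<pi>) = cst (cyc \<pi>') \<and> cst (cyc \<sigma>) = cst (cyc \<sigma>') \<and>
        length \<pi> = length \<pi>' \<and> length \<sigma> = length \<sigma>' \<longrightarrow>
      image_mset cst (mset_set (cSh (cyc \<pi>) (cyc \<sigma>))) =
      image_mset cst (mset_set (cSh (cyc \<pi>') (cyc \<sigma>'))))"


section \<open>Cyclic descents and cyclic compositions\<close>

text \<open>Positions are numbered from 1, list indices from 0: letter \<open>i\<close> is \<open>\<pi> ! (i - 1)\<close>, and its
  cyclic successor is \<open>\<pi> ! (i mod n)\<close>.\<close>

definition cDes :: "nat list \<Rightarrow> nat set" where
  "cDes \<pi> = {i \<in> {1..length \<pi>}. \<pi> ! (i - 1) > \<pi> ! (i mod length \<pi>)}"

definition non_Escher :: "nat \<Rightarrow> nat set \<Rightarrow> bool" where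
  "non_Escher n S \<longleftrightarrow> (\<exists>\<pi>. is_perm \<pi> \<and> length \<pi> = n \<and> cDes \<pi> = S)"

definition cComp :: "nat \<Rightarrow> nat set \<Rightarrow> nat list" where
  "cComp n S = (if n = 0 then [] else if n = 1 then [1]
     else (let s = sorted_list_of_set S in map2 (-) (tl s) s @ [n - last s + hd s]))"

text \<open>The cyclic composition of \<open>[\<pi>]\<close>, as a function of a representative \<open>\<pi>\<close>.\<close>

definition cComp_perm :: "nat list \<Rightarrow> nat list set" where
  "cComp_perm \<pi> = cyc (cComp (length \<pi>) (cDes \<pi>))"

definition non_Escher_comps :: "nat list set set" where
  "non_Escher_comps = {cyc (cComp n S) | n S. non_Escher n S}"

definition cyclic_descent_statistic :: "(nat list set \<Rightarrow> 'b) \<Rightarrow> bool" where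
  "cyclic_descent_statistic cst \<longleftrightarrow> cyclic_statistic cst \<and>
    (\<forall>\<pi> \<sigma>. is_perm \<pi> \<and> is_perm \<sigma> \<and> cComp_perm \<pi> = cComp_perm \<sigma> \<longrightarrow>
      cst (cyc \<pi>) = cst (cyc \<sigma>))"

text \<open>The value of a cyclic descent statistic on a non-Escher cyclic composition; the choice of
  \<open>\<pi>\<close> does not matter.\<close>

definition cst_comp :: "(nat list set \<Rightarrow> 'b) \<Rightarrow> nat list set \<Rightarrow> 'b" where
  "cst_comp cst C = cst (cyc (SOME \<pi>. is_perm \<pi> \<and> cComp_perm \<pi> = C))"

definition comp_equiv :: "(nat list set \<Rightarrow> 'b) \<Rightarrow> (nat list set \<times> nat list set) set" where
  "comp_equiv cst = {(cyc L, cyc M) | L M. cyc L \<in> non_Escher_comps \<and> cyc M \<in> non_Escher_comps \<and>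
     sum_list L = sum_list M \<and> cst_comp cst (cyc L) = cst_comp cst (cyc M)}"

definition comp_classes :: "(nat list set \<Rightarrow> 'b) \<Rightarrow> nat list set set set" where
  "comp_classes cst = non_Escher_comps // comp_equiv cst"


section \<open>Algebras over the rationals\<close>

definition rat_ring :: "rat ring" where
  "rat_ring = \<lparr>carrier = UNIV, mult = (*), one = 1, zero = 0, add = (+)\<rparr>"

text \<open>The library locale \<open>algebra\<close> is restricted to commutative algebras; the following is not.\<close>

definition rat_algebra :: "(rat, 'a) module \<Rightarrow> bool" where
  "rat_algebra A \<longleftrightarrow> ring A \<and> Module.module rat_ring A \<and>
    (\<forall>q. \<forall>x\<in>carrier A. \<forall>y\<in>carrier A.
      (q \<odot>\<^bsub>A\<^esub> x) \<otimes>\<^bsub>A\<^esub> y = q \<odot>\<^bsub>A\<^esub> (x \<otimes>\<^bsub>A\<^esub> y) \<and>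
      x \<otimes>\<^bsub>A\<^esub> (q \<odot>\<^bsub>A\<^esub> y) = q \<odot>\<^bsub>A\<^esub> (x \<otimes>\<^bsub>A\<^esub> y))"

definition lincomb :: "(rat, 'a) module \<Rightarrow> ('i \<Rightarrow> 'a) \<Rightarrow> ('i \<Rightarrow>\<^sub>0 rat) \<Rightarrow> 'a" where
  "lincomb A v c = (\<Oplus>\<^bsub>A\<^esub>i\<in>Poly_Mapping.keys c. Poly_Mapping.lookup c i \<odot>\<^bsub>A\<^esub> v i)"

definition lin_span :: "(rat, 'a) module \<Rightarrow> ('i \<Rightarrow> 'a) \<Rightarrow> 'i set \<Rightarrow> 'a set" where
  "lin_span A v I = {lincomb A v c | c. Poly_Mapping.keys c \<subseteq> I}"

definition is_basis :: "(rat, 'a) module \<Rightarrow> ('i \<Rightarrow> 'a) \<Rightarrow> 'i set \<Rightarrow> bool" where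
  "is_basis A v I \<longleftrightarrow> v ` I \<subseteq> carrier A \<and>
    (\<forall>c. Poly_Mapping.keys c \<subseteq> I \<and> lincomb A v c = \<zero>\<^bsub>A\<^esub> \<longrightarrow> c = 0) \<and>
    lin_span A v I = carrier A"

definition alg_hom :: "(rat, 'a) module \<Rightarrow> (rat, 'b) module \<Rightarrow> ('a \<Rightarrow> 'b) set" where
  "alg_hom A B = {f \<in> ring_hom A B. \<forall>q. \<forall>x\<in>carrier A. f (q \<odot>\<^bsub>A\<^esub> x) = q \<odot>\<^bsub>B\<^esub> f x}"

definition alg_iso :: "(rat, 'a) module \<Rightarrow> (rat, 'b) module \<Rightarrow> ('a \<Rightarrow> 'b) set" where
  "alg_iso A B = {f \<in> alg_hom A B. bij_betw f (carrier A) (carrier B)}"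


section \<open>Cyclic quasisymmetric functions\<close>

text \<open>A formal power series is the function mapping a monomial, given by its finitely supported
  exponents, to its coefficient. The index \<open>k\<close> stands for the variable \<open>x\<^bsub>k+1\<^esub>\<close>, so that all
  variables \<open>x\<^sub>1, x\<^sub>2, \<dots>\<close> occur and no others.\<close>

type_synonym power_series = "(nat \<Rightarrow>\<^sub>0 nat) \<Rightarrow> rat"

definition PS :: "(rat, power_series) module" where
  "PS = \<lparr>carrier = UNIV,
     mult = (\<lambda>f g m. \<Sum>(a, b) \<in> {(a, b). a + b = m}. f a * g b),
     one = (\<lambda>m. if m = 0 then 1 else 0),
     zero = (\<lambda>m. 0),
     add = (\<lambda>f g m. f m + g m),
     smult = (\<lambda>q f m. q * f m)\<rparr>"

definition monomial :: "nat list \<Rightarrow> (nat \<Rightarrow>\<^sub>0 nat)" where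
  "monomial w = (\<Sum>k\<leftarrow>w. Poly_Mapping.single k 1)"

text \<open>The coefficient of \<open>m\<close> counts the index sequences \<open>i\<^sub>1 \<le> \<dots> \<le> i\<^sub>n\<close> that contribute \<open>m\<close>.\<close>

definition F :: "nat \<Rightarrow> nat set \<Rightarrow> power_series" where
  "F n T = (\<lambda>m. of_nat (card {w. length w = n \<and>
     (\<forall>j\<in>{1..<n}. w ! (j - 1) \<le> w ! j \<and> (j \<in> T \<longrightarrow> w ! (j - 1) < w ! j)) \<and> monomial w = m}))"

text \<open>\<open>S + i\<close> modulo \<open>n\<close>, with residues represented in \<open>{1..n}\<close>.\<close>

definition cshift :: "nat \<Rightarrow> nat set \<Rightarrow> nat \<Rightarrow> nat set" where
  "cshift n S i = (\<lambda>s. (s + i - 1) mod n + 1) ` S"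

definition Fcyc :: "nat \<Rightarrow> nat set \<Rightarrow> power_series" where
  "Fcyc n S = (if n = 0 then \<one>\<^bsub>PS\<^esub> else (\<lambda>m. \<Sum>i=1..n. F n (cshift n S i \<inter> {1..n - 1}) m))"

definition cQSym_minus :: "(rat, power_series) module" where
  "cQSym_minus = PS\<lparr>carrier := lin_span PS (\<lambda>(n, S). Fcyc n S) {(n, S). non_Escher n S}\<rparr>"


section \<open>The cyclic shuffle algebra of a statistic\<close>

definition perm_equiv :: "(nat list set \<Rightarrow> 'b) \<Rightarrow> (nat list set \<times> nat list set) set" where
  "perm_equiv cst = {(cyc \<pi>, cyc \<sigma>) | \<pi> \<sigma>. is_perm \<pi> \<and> is_perm \<sigma> \<and>
     cst (cyc \<pi>) = cst (cyc \<sigma>) \<and> length \<pi> = length \<sigma>}"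

definition perm_classes :: "(nat list set \<Rightarrow> 'b) \<Rightarrow> nat list set set set" where
  "perm_classes cst = {cyc \<pi> | \<pi>. is_perm \<pi>} // perm_equiv cst"

definition perm_class :: "(nat list set \<Rightarrow> 'b) \<Rightarrow> nat list set \<Rightarrow> nat list set set" where
  "perm_class cst P = perm_equiv cst `` {P}"

text \<open>The product of two basis elements, computed from an arbitrary pair of disjoint
  representatives. Such a pair exists for every cyclic statistic, and the result is independent of
  it if the statistic is cyclic shuffle-compatible; otherwise the product is meaningless.\<close>

definition class_mult ::
  "(nat list set \<Rightarrow> 'b) \<Rightarrow> nat list set set \<Rightarrow> nat list set set \<Rightarrow> (nat list set set \<Rightarrow>\<^sub>0 rat)" where
  "class_mult cst a b =
    (let (\<pi>, \<sigma>) = (SOME (\<pi>, \<sigma>). is_perm \<pi> \<and> is_perm \<sigma> \<and> perm_disjoint \<pi> \<sigma> \<and>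
                      perm_class cst (cyc \<pi>) = a \<and> perm_class cst (cyc \<sigma>) = b)
     in \<Sum>T\<in>cSh (cyc \<pi>) (cyc \<sigma>). Poly_Mapping.single (perm_class cst T) 1)"

definition A_cyc :: "(nat list set \<Rightarrow> 'b) \<Rightarrow> (rat, nat list set set \<Rightarrow>\<^sub>0 rat) module" where
  "A_cyc cst = \<lparr>carrier = {f. Poly_Mapping.keys f \<subseteq> perm_classes cst},
     mult = (\<lambda>f g. \<Sum>a\<in>Poly_Mapping.keys f. \<Sum>b\<in>Poly_Mapping.keys g.
               Poly_Mapping.map ((*) (Poly_Mapping.lookup f a * Poly_Mapping.lookup g b))
                 (class_mult cst a b)),
     one = Poly_Mapping.single (perm_class cst (cyc [])) 1,
     zero = 0,
     add = (+),
     smult = (\<lambda>q. Poly_Mapping.map ((*) q))\<rparr>"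


section \<open>Algebras with basis indexed by the equivalence classes\<close>

text \<open>Such an algebra has a countably infinite carrier, because there are classes of every size. Hence
  every one of them occurs, up to isomorphism, over any type \<open>'v\<close> of class \<open>infinite\<close>, and none over
  a finite type.

  The last clause says \<open>\<phi> F\<^bsub>[L]\<^esub> = v \<alpha>\<close> for \<open>[L] \<in> \<alpha>\<close>, where \<open>[L] = cyc (cComp n S)\<close> and
  \<open>F\<^bsub>[L]\<^esub> = Fcyc n S\<close>.\<close>

definition cQSym_realization ::
  "(nat list set \<Rightarrow> 'b) \<Rightarrow> (rat, 'v) module \<Rightarrow> (nat list set set \<Rightarrow> 'v) \<Rightarrow>
    (power_series \<Rightarrow> 'v) \<Rightarrow> bool" where
  "cQSym_realization cst A v \<phi> \<longleftrightarrow>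
     rat_algebra A \<and> is_basis A v (comp_classes cst) \<and> \<phi> \<in> alg_hom cQSym_minus A \<and>
     (\<forall>\<alpha>\<in>comp_classes cst. \<forall>n S. non_Escher n S \<and> cyc (cComp n S) \<in> \<alpha> \<longrightarrow> \<phi> (Fcyc n S) = v \<alpha>)"

end

theory Submission
  imports Defs "HOL-Algebra.UnivPoly" "HOL-Library.Countable_Set" "HOL-Library.FuncSet"
    "HOL-Library.Product_Lexorder"
begin

text \<open>
The theorem rests on two facts about the series \<open>Fcyc n S\<close>, one about their products and one about
their linear relations.

Product formula (\<open>Fcyc_mult\<close>). If \<open>S = cDes \<pi>\<close>, then the coefficient of a monomial in \<open>Fcyc n S\<close>
counts the labelings of the letters of \<open>\<pi>\<close> by indices of variables that have the given monomial and for
which the letters, sorted by label and then by value, form a rotation of \<open>\<pi>\<close>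
(\<open>Fcyc_cDes_eq_card\<close>). A pair of labelings, of the letters of \<open>\<pi>\<close> and of a disjoint \<open>\<sigma>\<close>, is
one labeling of the union of the two sets of letters. The sorted word of the union restricts to the two
sorted words, so it is a rotation of a cyclic shuffle, and \<open>Fcyc\<close> of \<open>\<pi>\<close> times \<open>Fcyc\<close> of \<open>\<sigma>\<close> is
the sum of \<open>Fcyc\<close> over \<open>cSh\<close>.

Linear relations (\<open>Fcyc_relations\<close>). All of them come from the invariance of \<open>Fcyc n S\<close> under
cyclic shifts of \<open>S\<close>. The coefficient at the word with strict ascents \<open>U\<close> counts the shifts of
\<open>S\<close> that are contained in \<open>insert n U\<close>. Shift invariance gives the corresponding counts for every
nonempty set in place of \<open>insert n U\<close>, and inclusion-exclusion then recovers the coefficient of each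
shift class.

By these two facts, sending \<open>Fcyc n S\<close> to the class of a permutation with cyclic descent set \<open>S\<close> is a
well-defined linear map (\<open>class_map\<close>) from \<open>cQSym_minus\<close> onto the space spanned by the classes. If the statistic is
shuffle-compatible, the map is multiplicative. As it is onto, the shuffle algebra \<open>A_cyc\<close> inherits the
ring axioms from \<open>cQSym_minus\<close>. It has a countable carrier, so an injection of this carrier moves it to
any infinite type.

Conversely, in an algebra \<open>A\<close> as in the theorem the product of two basis vectors is, by the product
formula, the sum over \<open>cSh\<close> of the basis vectors of the classes that occur. It depends only on the two
vectors, and its coordinates are the multiplicities of these classes: this is
shuffle-compatibility (\<open>compatible_if_realization\<close>). The same identity says that the linear bijection
from \<open>A_cyc\<close> to \<open>A\<close> given by the bases is multiplicative (\<open>ex_iso_of_realization\<close>).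
\<close>

section \<open>Rotation classes\<close>

lemma self_in_cyc [simp]: "xs \<in> cyc xs"
  unfolding cyc_def by (auto intro: exI [of _ 0])

lemma rotate_in_cyc [simp]: "rotate k xs \<in> cyc xs"
  unfolding cyc_def by auto

lemma cyc_eq_image: "cyc xs = (\<lambda>k. rotate k xs) ` {..<max 1 (length xs)}"
proof -
  have "rotate k xs \<in> (\<lambda>k. rotate k xs) ` {..<max 1 (length xs)}" for k
  proof (cases "xs = []")
    case False
    then show ?thesis
      by (intro image_eqI [of _ _ "k mod length xs"])
        (auto simp: rotate_conv_mod [symmetric] less_max_iff_disj)
  qed auto
  then show ?thesis unfolding cyc_def by auto
qed

lemma finite_cyc [simp]: "finite (cyc xs)"
  by (simp add: cyc_eq_image)

lemma cyc_Nil [simp]: "cyc [] = {[]}"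
  by (simp add: cyc_def)

lemma set_in_cyc: "ys \<in> cyc xs \<Longrightarrow> set ys = set xs"
  and length_in_cyc: "ys \<in> cyc xs \<Longrightarrow> length ys = length xs"
  and distinct_in_cyc: "ys \<in> cyc xs \<Longrightarrow> distinct ys = distinct xs"
  and sum_list_in_cyc: "ms \<in> cyc ns \<Longrightarrow> sum_list ms = sum_list (ns :: nat list)"
  subgoal unfolding cyc_def by auto
  subgoal unfolding cyc_def by auto
  subgoal unfolding cyc_def by auto
  subgoal unfolding cyc_def
    by (clarsimp simp: rotate_drop_take)
      (metis add.commute append_take_drop_id sum_list_append)
  done

lemma cyc_eq_if_in: assumes "ys \<in> cyc xs" shows "cyc ys = cyc xs"
proof -
  obtain k where k: "ys = rotate k xs" using assms unfolding cyc_def by auto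
  have "rotate j xs \<in> cyc ys" for j
  proof -
    \<comment> \<open>Rotating \<open>length xs - 1\<close> times by \<open>k\<close> undoes the rotation by \<open>k\<close>.\<close>
    have "rotate (j + k * (length xs - 1)) ys = rotate (j + k * (length xs - 1) + k) xs"
      by (simp add: k rotate_rotate)
    also have "\<dots> = rotate j xs"
    proof (cases "xs = []")
      case False
      then have "j + k * (length xs - 1) + k = j + length xs * k"
        by (cases "length xs") (auto simp: algebra_simps)
      then show ?thesis by (metis mod_mult_self2 rotate_conv_mod)
    qed simp
    finally show ?thesis by (metis rotate_in_cyc)
  qed
  moreover have "rotate j ys \<in> cyc xs" for j by (simp add: k rotate_rotate)
  ultimately show ?thesis unfolding cyc_def [of xs] cyc_def [of ys] by (auto simp: cyc_def)
qed

lemma cyc_eq_iff: "cyc ys = cyc xs \<longleftrightarrow> ys \<in> cyc xs"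
  using cyc_eq_if_in self_in_cyc by blast

lemma is_perm_in_cyc: "\<rho> \<in> cyc \<pi> \<Longrightarrow> is_perm \<rho> = is_perm \<pi>"
  using set_in_cyc distinct_in_cyc unfolding is_perm_def by blast

lemma is_perm_rotate [simp]: "is_perm (rotate k \<pi>) = is_perm \<pi>"
  by (simp add: is_perm_def)

lemma filter_rotate_in_cyc: "filter P (rotate k xs) \<in> cyc (filter P xs)"
proof (induction k)
  case (Suc k)
  have "filter P (rotate1 ys) \<in> cyc (filter P ys)" for ys
  proof (cases ys)
    case (Cons a as)
    then show ?thesis
      using rotate_in_cyc [of 1 "filter P ys"] self_in_cyc [of "filter P as"] by auto
  qed simp
  then show ?case using cyc_eq_if_in [OF Suc.IH] by auto
qed simp

lemma filter_in_cyc: "ys \<in> cyc xs \<Longrightarrow> filter P ys \<in> cyc (filter P xs)"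
  using filter_rotate_in_cyc unfolding cyc_def by blast

section \<open>Shuffles as lists with prescribed restrictions\<close>

text \<open>The letters of \<open>\<pi>\<close> in a shuffle form a word that is as long as \<open>\<pi>\<close> and has \<open>\<pi>\<close> as a
  subsequence.\<close>

lemma mem_Sh_iff:
  assumes "is_perm \<pi>" "is_perm \<sigma>" "perm_disjoint \<pi> \<sigma>"
  shows "\<tau> \<in> Sh \<pi> \<sigma> \<longleftrightarrow> distinct \<tau> \<and> set \<tau> = set \<pi> \<union> set \<sigma> \<and>
    filter (\<lambda>x. x \<in> set \<pi>) \<tau> = \<pi> \<and> filter (\<lambda>x. x \<in> set \<sigma>) \<tau> = \<sigma>"
    (is "_ \<longleftrightarrow> ?R")
proof
  have d: "distinct \<pi>" "distinct \<sigma>" "set \<pi> \<inter> set \<sigma> = {}"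
    using assms by (auto simp: is_perm_def perm_disjoint_def)
  have cardu: "card (set \<pi> \<union> set \<sigma>) = length \<pi> + length \<sigma>"
    using d by (simp add: card_Un_disjoint distinct_card)
  {
    assume "\<tau> \<in> Sh \<pi> \<sigma>"
    then have t: "distinct \<tau>" "length \<tau> = length \<pi> + length \<sigma>" "subseq \<pi> \<tau>" "subseq \<sigma> \<tau>"
      by (auto simp: Sh_def is_perm_def)
    have "set \<pi> \<union> set \<sigma> \<subseteq> set \<tau>"
      using t(3,4) by (auto elim: list_emb_set)
    moreover have "card (set \<tau>) = card (set \<pi> \<union> set \<sigma>)"
      using cardu t(1,2) by (simp add: distinct_card)
    ultimately have st: "set \<tau> = set \<pi> \<union> set \<sigma>"
      by (metis List.finite_set card_subset_eq)
    have "filter (\<lambda>x. x \<in> set \<rho>) \<tau> = \<rho>" if r: "subseq \<rho> \<tau>" "distinct \<rho>" for \<rho>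
    proof -
      have "subseq (filter (\<lambda>x. x \<in> set \<rho>) \<rho>) (filter (\<lambda>x. x \<in> set \<rho>) \<tau>)"
        by (rule subseq_filter [OF r(1)])
      then have s: "subseq \<rho> (filter (\<lambda>x. x \<in> set \<rho>) \<tau>)"
        by simp
      have "length (filter (\<lambda>x. x \<in> set \<rho>) \<tau>) = card (set (filter (\<lambda>x. x \<in> set \<rho>) \<tau>))"
        using t(1) by (metis distinct_card distinct_filter)
      also have "\<dots> \<le> card (set \<rho>)"
        by (rule card_mono) auto
      also have "\<dots> = length \<rho>"
        using r(2) by (simp add: distinct_card)
      finally show ?thesis
        using s by (metis le_antisym list_emb_length subseq_same_length)
    qed
    then show ?R using st t d by blast
  }
  assume r: ?R
  then have "length \<tau> = length \<pi> + length \<sigma>"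
    by (metis cardu distinct_card)
  moreover have "is_perm \<tau>" using r assms by (auto simp: is_perm_def)
  ultimately show "\<tau> \<in> Sh \<pi> \<sigma>"
    using r unfolding Sh_def by (metis (mono_tags, lifting) mem_Collect_eq subseq_filter_left)
qed

text \<open>Rotating a shuffle rotates the two words that it shuffles. So belonging to some cyclic shuffle of
  \<open>[\<pi>]\<close> and \<open>[\<sigma>]\<close> is a condition on the two restrictions separately.\<close>

lemma mem_Union_cSh_iff:
  assumes "is_perm \<pi>" "is_perm \<sigma>" "perm_disjoint \<pi> \<sigma>"
  shows "\<rho> \<in> \<Union> (cSh (cyc \<pi>) (cyc \<sigma>)) \<longleftrightarrow> distinct \<rho> \<and> set \<rho> = set \<pi> \<union> set \<sigma> \<and>
    filter (\<lambda>x. x \<in> set \<pi>) \<rho> \<in> cyc \<pi> \<and> filter (\<lambda>x. x \<in> set \<sigma>) \<rho> \<in> cyc \<sigma>"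
    (is "_ \<longleftrightarrow> ?R \<rho>")
proof
  have sh: "\<tau> \<in> Sh \<pi>' \<sigma>' \<longleftrightarrow> distinct \<tau> \<and> set \<tau> = set \<pi> \<union> set \<sigma> \<and>
      filter (\<lambda>x. x \<in> set \<pi>) \<tau> = \<pi>' \<and> filter (\<lambda>x. x \<in> set \<sigma>) \<tau> = \<sigma>'"
    if "\<pi>' \<in> cyc \<pi>" "\<sigma>' \<in> cyc \<sigma>" for \<tau> \<pi>' \<sigma>'
  proof -
    have "is_perm \<pi>'" "is_perm \<sigma>'" "set \<pi>' = set \<pi>" "set \<sigma>' = set \<sigma>"
      using assms(1,2) that is_perm_in_cyc set_in_cyc by blast+
    then show ?thesis
      using mem_Sh_iff [of \<pi>' \<sigma>' \<tau>] assms(3) by (simp add: perm_disjoint_def)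
  qed
  {
    assume "\<rho> \<in> \<Union> (cSh (cyc \<pi>) (cyc \<sigma>))"
    then obtain \<tau> \<pi>' \<sigma>' where t: "\<rho> \<in> cyc \<tau>" "\<pi>' \<in> cyc \<pi>" "\<sigma>' \<in> cyc \<sigma>" "\<tau> \<in> Sh \<pi>' \<sigma>'"
      unfolding cSh_def by blast
    then have "distinct \<tau> \<and> set \<tau> = set \<pi> \<union> set \<sigma>" "filter (\<lambda>x. x \<in> set \<pi>) \<tau> = \<pi>'"
      "filter (\<lambda>x. x \<in> set \<sigma>) \<tau> = \<sigma>'"
      using sh by auto
    then show "?R \<rho>"
      using t(1-3) filter_in_cyc set_in_cyc distinct_in_cyc cyc_eq_if_in by metis
  }
  assume "?R \<rho>"
  then show "\<rho> \<in> \<Union> (cSh (cyc \<pi>) (cyc \<sigma>))"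
    using sh unfolding cSh_def by fastforce
qed

lemma cShE:
  assumes "is_perm \<pi>" "is_perm \<sigma>" "perm_disjoint \<pi> \<sigma>" "T \<in> cSh (cyc \<pi>) (cyc \<sigma>)"
  obtains \<tau> where "T = cyc \<tau>" "is_perm \<tau>" "set \<tau> = set \<pi> \<union> set \<sigma>"
    "length \<tau> = length \<pi> + length \<sigma>"
proof -
  obtain \<tau> \<pi>' \<sigma>' where t: "T = cyc \<tau>" "\<pi>' \<in> cyc \<pi>" "\<sigma>' \<in> cyc \<sigma>" "\<tau> \<in> Sh \<pi>' \<sigma>'"
    using assms(4) unfolding cSh_def by blast
  then have "is_perm \<tau>" "length \<tau> = length \<pi> + length \<sigma>"
    by (auto simp: Sh_def length_in_cyc)
  moreover have "set \<tau> = set \<pi> \<union> set \<sigma>"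
    using mem_Union_cSh_iff [OF assms(1-3), of \<tau>] assms(4) t(1) by (metis UnionI self_in_cyc)
  ultimately show ?thesis using that t(1) by blast
qed

lemma finite_cSh:
  assumes "is_perm \<pi>" "is_perm \<sigma>" "perm_disjoint \<pi> \<sigma>"
  shows "finite (cSh (cyc \<pi>) (cyc \<sigma>))"
proof (rule finite_subset)
  show "cSh (cyc \<pi>) (cyc \<sigma>) \<subseteq>
      cyc ` {\<tau>. set \<tau> \<subseteq> set \<pi> \<union> set \<sigma> \<and> length \<tau> = length \<pi> + length \<sigma>}"
  proof
    fix T assume "T \<in> cSh (cyc \<pi>) (cyc \<sigma>)"
    then obtain \<tau> where "T = cyc \<tau>" "set \<tau> = set \<pi> \<union> set \<sigma>"
        "length \<tau> = length \<pi> + length \<sigma>"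
      using cShE [OF assms] by metis
    then show "T \<in> cyc ` {\<tau>. set \<tau> \<subseteq> set \<pi> \<union> set \<sigma> \<and> length \<tau> = length \<pi> + length \<sigma>}"
      by blast
  qed
  show "finite \<dots>"
    by (intro finite_imageI finite_lists_length_eq) auto
qed

section \<open>Labelings of a set of letters\<close>

text \<open>Ties between equal labels are broken by the value of the letter. So a word \<open>\<rho>\<close> is the letter order
  of \<open>f\<close> if and only if the labels increase weakly along \<open>\<rho>\<close>, and strictly at the descents of \<open>\<rho>\<close>: this
  is the condition on index sequences in the definition of \<open>F\<close>.\<close>

definition letter_order :: "nat set \<Rightarrow> (nat \<Rightarrow> nat) \<Rightarrow> nat list" where
  "letter_order X f = map snd (sorted_list_of_set ((\<lambda>x. (f x, x)) ` X))"

definition label_monomial :: "nat set \<Rightarrow> (nat \<Rightarrow> nat) \<Rightarrow> (nat \<Rightarrow>\<^sub>0 nat)" where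
  "label_monomial X f = (\<Sum>x\<in>X. Poly_Mapping.single (f x) 1)"

lemma letter_order_eq_iff:
  assumes "finite X"
  shows "letter_order X f = \<rho> \<longleftrightarrow>
    set \<rho> = X \<and> sorted_wrt (<) (map (\<lambda>x. (f x, x)) \<rho>)"
proof
  let ?g = "\<lambda>x. (f x, x)"
  let ?s = "sorted_list_of_set (?g ` X)"
  have s: "set ?s = ?g ` X" "sorted_wrt (<) ?s" using assms by auto
  have "map ?g (map snd ?s) = ?s"
    unfolding map_map by (rule map_idI) (use s(1) in auto)
  moreover have "set (map snd ?s) = X" by (simp add: s(1) image_image)
  ultimately have 1: "set (letter_order X f) = X"
      "sorted_wrt (<) (map ?g (letter_order X f))" "map ?g (letter_order X f) = ?s"
    using s(2) by (auto simp: letter_order_def)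
  {
    assume "letter_order X f = \<rho>"
    with 1 show "set \<rho> = X \<and> sorted_wrt (<) (map ?g \<rho>)" by auto
  }
  assume r: "set \<rho> = X \<and> sorted_wrt (<) (map ?g \<rho>)"
  then have "map ?g \<rho> = ?s"
    using s by (intro strict_sorted_equal) auto
  then have "map snd (map ?g \<rho>) = map snd (map ?g (letter_order X f))" using 1(3) by simp
  then show "letter_order X f = \<rho>" by (simp add: comp_def)
qed

lemma set_letter_order [simp]: "finite X \<Longrightarrow> set (letter_order X f) = X"
  using letter_order_eq_iff by blast

lemma distinct_letter_order [simp]: "finite X \<Longrightarrow> distinct (letter_order X f)"
  using letter_order_eq_iff [of X f "letter_order X f"]
  by (auto simp: strict_sorted_iff distinct_map)

text \<open>The comparison of two letters involves their own labels only, so sorting commutes with restriction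
  to a smaller set of letters. This is the step that turns products into shuffles.\<close>

lemma filter_letter_order:
  assumes "finite X" "Y \<subseteq> X" "\<And>x. x \<in> Y \<Longrightarrow> g x = f x"
  shows "filter (\<lambda>x. x \<in> Y) (letter_order X f) = letter_order Y g"
proof (rule sym, subst letter_order_eq_iff)
  show "finite Y" using assms finite_subset by blast
  let ?l = "filter (\<lambda>x. x \<in> Y) (letter_order X f)"
  have s: "set ?l = Y" using assms by auto
  have "sorted_wrt (\<lambda>x y. (f x, x) < (f y, y)) (letter_order X f)"
    using letter_order_eq_iff [of X f "letter_order X f"] assms(1) by (simp add: sorted_wrt_map)
  then have "sorted_wrt (\<lambda>x y. (f x, x) < (f y, y)) ?l"
    by (rule sorted_wrt_filter)
  then have "sorted_wrt (\<lambda>x y. (g x, x) < (g y, y)) ?l"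
    by (rule sorted_wrt_mono_rel [rotated]) (use s assms(3) in auto)
  with s show "set ?l = Y \<and> sorted_wrt (<) (map (\<lambda>x. (g x, x)) ?l)"
    by (simp add: sorted_wrt_map)
qed

lemma lookup_label_monomial:
  "finite X \<Longrightarrow> Poly_Mapping.lookup (label_monomial X f) k = card {x\<in>X. f x = k}"
  by (simp add: label_monomial_def lookup_sum lookup_single when_def sum.If_cases Int_def)

lemma finite_labelings:
  assumes "finite X"
  shows "finite {f \<in> extensional X. Q f \<and> label_monomial X f = m}"
proof (rule finite_subset)
  show "{f \<in> extensional X. Q f \<and> label_monomial X f = m} \<subseteq> X \<rightarrow>\<^sub>E Poly_Mapping.keys m"
  proof (intro subsetI PiE_I)
    fix f x assume f: "f \<in> {f \<in> extensional X. Q f \<and> label_monomial X f = m}" and "x \<in> X"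
    then have "Poly_Mapping.lookup m (f x) = card {y\<in>X. f y = f x}" "x \<in> {y\<in>X. f y = f x}"
      using lookup_label_monomial [OF assms] by auto
    moreover have "finite {y\<in>X. f y = f x}" using assms by simp
    ultimately have "Poly_Mapping.lookup m (f x) \<noteq> 0" by (metis card_0_eq empty_iff)
    then show "f x \<in> Poly_Mapping.keys m" by (simp add: in_keys_iff)
  qed (auto simp: extensional_def)
  show "finite (X \<rightarrow>\<^sub>E Poly_Mapping.keys m)" using assms by (intro finite_PiE) auto
qed

text \<open>Labelings are kept extensional, so that distinct ones differ on \<open>set \<pi>\<close> and can be counted.\<close>

definition cyclic_labelings :: "nat list \<Rightarrow> (nat \<Rightarrow>\<^sub>0 nat) \<Rightarrow> (nat \<Rightarrow> nat) set" where
  "cyclic_labelings \<pi> m = {f \<in> extensional (set \<pi>).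
     letter_order (set \<pi>) f \<in> cyc \<pi> \<and> label_monomial (set \<pi>) f = m}"

section \<open>Cyclic descents under rotation\<close>

lemma cDes_subset: "cDes \<pi> \<subseteq> {1..length \<pi>}"
  by (auto simp: cDes_def)

definition residue_shift :: "nat \<Rightarrow> nat \<Rightarrow> nat \<Rightarrow> nat" where
  "residue_shift n i s = (s + i - 1) mod n + 1"

lemma cshift_eq: "cshift n S i = residue_shift n i ` S"
  by (simp add: cshift_def residue_shift_def)

lemma residue_shift_add:
  assumes "0 < s"
  shows "residue_shift n j (residue_shift n i s) = residue_shift n (i + j) s"
proof -
  have "((s + i - 1) mod n + 1 + j - 1) mod n = (s + i - 1 + j) mod n"
    by (simp add: mod_simps)
  also have "s + i - 1 + j = s + (i + j) - 1" using assms by simp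
  finally show ?thesis by (simp add: residue_shift_def)
qed

lemma residue_shift_self: "s \<in> {1..n} \<Longrightarrow> residue_shift n n s = s"
proof -
  assume s: "s \<in> {1..n}"
  then have "s + n - 1 = (s - 1) + n" by auto
  then have "(s + n - 1) mod n = (s - 1) mod n" by simp
  also have "\<dots> = s - 1" using s by (intro mod_less) auto
  finally show ?thesis using s by (simp add: residue_shift_def)
qed

lemma residue_shift_range: "0 < n \<Longrightarrow> residue_shift n i s \<in> {1..n}"
  by (simp add: residue_shift_def Suc_le_eq)

text \<open>Shifting by \<open>i\<close> and then by \<open>n - i\<close> is the identity on \<open>{1..n}\<close>.\<close>

lemma mem_cshift_iff:
  assumes "S \<subseteq> {1..n}" "t \<in> {1..n}" "i \<le> n"
  shows "t \<in> cshift n S i \<longleftrightarrow> residue_shift n (n - i) t \<in> S"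
proof -
  have n: "0 < n" using assms(2) by auto
  have a: "residue_shift n (n - i) (residue_shift n i s) = s" if "s \<in> {1..n}" for s
    using that assms(3) by (simp add: residue_shift_add residue_shift_self)
  have b: "residue_shift n i (residue_shift n (n - i) t) = t"
    using assms(2,3) by (simp add: residue_shift_add residue_shift_self)
  show ?thesis
    unfolding cshift_eq using a b assms(1) by (metis (no_types, lifting) image_iff subsetD)
qed

lemma cshift_subset: "0 < n \<Longrightarrow> cshift n S i \<subseteq> {1..n}"
  unfolding cshift_eq using residue_shift_range by blast

lemma cDes_rotate:
  assumes "0 < length \<pi>" "k \<le> length \<pi>"
  shows "cDes (rotate k \<pi>) = cshift (length \<pi>) (cDes \<pi>) (length \<pi> - k)"
proof -
  let ?n = "length \<pi>"
  have "i \<in> cDes (rotate k \<pi>) \<longleftrightarrow> residue_shift ?n k i \<in> cDes \<pi>" if i: "i \<in> {1..?n}" for i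
  proof -
    have n: "0 < ?n" by fact
    have "rotate k \<pi> ! (i - 1) = \<pi> ! ((i + k - 1) mod ?n)"
      using i n by (subst nth_rotate) (auto simp: add.commute)
    moreover have "rotate k \<pi> ! (i mod ?n) = \<pi> ! ((i + k - 1 + 1) mod ?n)"
      using i n by (subst nth_rotate) (auto simp: add.commute mod_simps)
    moreover have "((i + k - 1) mod ?n + 1) mod ?n = (i + k - 1 + 1) mod ?n"
      by (simp add: mod_simps)
    moreover have "residue_shift ?n k i \<in> {1..?n}" using residue_shift_range n by blast
    ultimately show ?thesis
      using i unfolding cDes_def residue_shift_def by auto
  qed
  then have "i \<in> cDes (rotate k \<pi>) \<longleftrightarrow> i \<in> cshift ?n (cDes \<pi>) (?n - k)" if "i \<in> {1..?n}" for i
    using that assms(2) mem_cshift_iff [OF cDes_subset that, of "?n - k"] by simp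
  moreover have "cDes (rotate k \<pi>) \<subseteq> {1..?n}" using cDes_subset [of "rotate k \<pi>"] by simp
  moreover have "cshift ?n (cDes \<pi>) (?n - k) \<subseteq> {1..?n}" using cshift_subset assms by blast
  ultimately show ?thesis by blast
qed

section \<open>Cyclic quasisymmetric functions count labelings\<close>

lemma lex_less_iff:
  assumes "x \<noteq> (y::nat)"
  shows "(a::nat, x) < (b, y) \<longleftrightarrow> a \<le> b \<and> (x > y \<longrightarrow> a < b)"
  using assms by (auto simp: less_prod_simp)

text \<open>A labeling \<open>f\<close> corresponds to the word \<open>map f \<rho>\<close> of its labels, read along \<open>\<rho>\<close>.\<close>

lemma F_eq_card_labelings:
  assumes "distinct \<rho>"
  shows "F (length \<rho>) (cDes \<rho> \<inter> {1..length \<rho> - 1}) m =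
    of_nat (card {f \<in> extensional (set \<rho>).
      letter_order (set \<rho>) f = \<rho> \<and> label_monomial (set \<rho>) f = m})" (is "_ = of_nat (card ?L)")
proof -
  let ?n = "length \<rho>"
  let ?W = "{w. length w = ?n \<and>
     (\<forall>j\<in>{1..<?n}. w ! (j - 1) \<le> w ! j \<and> (j \<in> cDes \<rho> \<inter> {1..?n - 1} \<longrightarrow> w ! (j - 1) < w ! j)) \<and>
     monomial w = m}"
  have order: "letter_order (set \<rho>) f = \<rho> \<longleftrightarrow> (\<forall>j\<in>{1..<?n}. map f \<rho> ! (j - 1) \<le> map f \<rho> ! j \<and>
      (j \<in> cDes \<rho> \<inter> {1..?n - 1} \<longrightarrow> map f \<rho> ! (j - 1) < map f \<rho> ! j))" for f
  proof -
    have "letter_order (set \<rho>) f = \<rho> \<longleftrightarrow> (\<forall>i. Suc i < ?n \<longrightarrow>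
        (f (\<rho> ! i), \<rho> ! i) < (f (\<rho> ! Suc i), \<rho> ! Suc i))"
      by (subst letter_order_eq_iff) (auto simp: sorted_wrt_iff_nth_Suc_transp)
    also have "\<dots> \<longleftrightarrow> (\<forall>i. Suc i < ?n \<longrightarrow> f (\<rho> ! i) \<le> f (\<rho> ! Suc i) \<and>
        (\<rho> ! i > \<rho> ! Suc i \<longrightarrow> f (\<rho> ! i) < f (\<rho> ! Suc i)))"
    proof -
      have "\<rho> ! i \<noteq> \<rho> ! Suc i" if "Suc i < ?n" for i
        using that assms nth_eq_iff_index_eq [of \<rho> i "Suc i"] by auto
      then show ?thesis using lex_less_iff by blast
    qed
    also have "\<dots> \<longleftrightarrow> (\<forall>j\<in>{1..<?n}. f (\<rho> ! (j - 1)) \<le> f (\<rho> ! j) \<and>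
        (\<rho> ! (j - 1) > \<rho> ! j \<longrightarrow> f (\<rho> ! (j - 1)) < f (\<rho> ! j)))" (is "?P \<longleftrightarrow> ?Q")
    proof
      assume ?P
      then show ?Q
        by (metis (no_types, lifting) Suc_pred' atLeastLessThan_iff less_eq_Suc_le One_nat_def)
    next
      assume q: ?Q
      show ?P
      proof (intro allI impI)
        fix i assume "Suc i < ?n"
        then show "f (\<rho> ! i) \<le> f (\<rho> ! Suc i) \<and>
            (\<rho> ! i > \<rho> ! Suc i \<longrightarrow> f (\<rho> ! i) < f (\<rho> ! Suc i))"
          using q [rule_format, of "Suc i"] by simp
      qed
    qed
    also have "\<dots> \<longleftrightarrow> (\<forall>j\<in>{1..<?n}. map f \<rho> ! (j - 1) \<le> map f \<rho> ! j \<and>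
        (j \<in> cDes \<rho> \<inter> {1..?n - 1} \<longrightarrow> map f \<rho> ! (j - 1) < map f \<rho> ! j))"
    proof (rule ball_cong [OF refl])
      fix j assume j: "j \<in> {1..<?n}"
      then have "j \<in> cDes \<rho> \<inter> {1..?n - 1} \<longleftrightarrow> \<rho> ! (j - 1) > \<rho> ! j"
        by (auto simp: cDes_def)
      moreover have "map f \<rho> ! (j - 1) = f (\<rho> ! (j - 1))" "map f \<rho> ! j = f (\<rho> ! j)"
        using j by auto
      ultimately show "(f (\<rho> ! (j - 1)) \<le> f (\<rho> ! j) \<and>
          (\<rho> ! (j - 1) > \<rho> ! j \<longrightarrow> f (\<rho> ! (j - 1)) < f (\<rho> ! j))) \<longleftrightarrow>
        (map f \<rho> ! (j - 1) \<le> map f \<rho> ! j \<and>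
          (j \<in> cDes \<rho> \<inter> {1..?n - 1} \<longrightarrow> map f \<rho> ! (j - 1) < map f \<rho> ! j))"
        by simp
    qed
    finally show ?thesis .
  qed
  have mon: "monomial (map f \<rho>) = label_monomial (set \<rho>) f" for f
    using assms by (simp add: monomial_def label_monomial_def sum_list_distinct_conv_sum_set comp_def)
  have "bij_betw (\<lambda>f. map f \<rho>) ?L ?W"
  proof (rule bij_betw_imageI)
    show "inj_on (\<lambda>f. map f \<rho>) ?L"
      by (auto simp: inj_on_def intro: extensionalityI)
    have "w \<in> (\<lambda>f. map f \<rho>) ` ?L" if w: "w \<in> ?W" for w
    proof -
      define f where "f = restrict (\<lambda>x. the (map_of (zip \<rho> w) x)) (set \<rho>)"
      have "map f \<rho> = map (\<lambda>x. the (map_of (zip \<rho> w) x)) \<rho>"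
        by (simp add: f_def)
      also have "\<dots> = w"
        using w assms by (intro nth_equalityI) (auto simp: map_of_zip_nth)
      finally have fw: "map f \<rho> = w" .
      moreover have "f \<in> extensional (set \<rho>)" by (simp add: f_def)
      ultimately have "f \<in> ?L"
        using w order [of f] mon [of f] unfolding mem_Collect_eq by metis
      then show ?thesis using fw by blast
    qed
    moreover have "map f \<rho> \<in> ?W" if "f \<in> ?L" for f
      using that order [of f] mon [of f] by auto
    ultimately show "(\<lambda>f. map f \<rho>) ` ?L = ?W" by blast
  qed
  then show ?thesis
    unfolding F_def by (simp add: bij_betw_same_card)
qed

lemma inj_on_rotate: "distinct xs \<Longrightarrow> inj_on (\<lambda>k. rotate k xs) {..<length xs}"
proof (rule inj_onI)
  fix j k assume d: "distinct xs" and jk: "j \<in> {..<length xs}" "k \<in> {..<length xs}"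
    "rotate j xs = rotate k xs"
  then have "rotate j xs ! 0 = rotate k xs ! 0" "0 < length xs" by auto
  moreover have "rotate i xs ! 0 = xs ! i" if "i < length xs" for i
    using that by (subst nth_rotate) auto
  ultimately have "xs ! j = xs ! k" using jk by (metis lessThan_iff)
  then show "j = k" using jk d by (simp add: nth_eq_iff_index_eq)
qed

lemma finite_cyclic_labelings [simp]: "finite (cyclic_labelings \<pi> m)"
  unfolding cyclic_labelings_def
  by (rule finite_labelings [where Q = "\<lambda>f. letter_order (set \<pi>) f \<in> cyc \<pi>"]) simp

lemma cyclic_labelings_cong: "\<rho> \<in> cyc \<pi> \<Longrightarrow> cyclic_labelings \<rho> m = cyclic_labelings \<pi> m"
  unfolding cyclic_labelings_def using set_in_cyc cyc_eq_if_in by metis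

text \<open>The shifts of \<open>cDes \<pi>\<close> are the cyclic descent sets of the rotations of \<open>\<pi>\<close>, so the summands of \<open>Fcyc\<close>
  count the labelings according to the rotation of \<open>\<pi>\<close> that is their letter order.\<close>

lemma Fcyc_cDes_eq_card:
  assumes "is_perm \<pi>"
  shows "Fcyc (length \<pi>) (cDes \<pi>) m = of_nat (card (cyclic_labelings \<pi> m))"
proof (cases "\<pi> = []")
  case True
  have "cyclic_labelings [] m = (if m = 0 then {\<lambda>x. undefined} else {})"
    by (auto simp: cyclic_labelings_def letter_order_def label_monomial_def extensional_def)
  then show ?thesis
    using True by (auto simp: Fcyc_def PS_def)
next
  case False
  let ?n = "length \<pi>"
  have n: "0 < ?n" "distinct \<pi>" using False assms by (auto simp: is_perm_def)
  let ?L = "\<lambda>\<rho>. {f \<in> extensional (set \<pi>).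
      letter_order (set \<pi>) f = \<rho> \<and> label_monomial (set \<pi>) f = m}"
  have "Fcyc ?n (cDes \<pi>) m = (\<Sum>i=1..?n. F ?n (cshift ?n (cDes \<pi>) i \<inter> {1..?n - 1}) m)"
    using n by (simp add: Fcyc_def)
  also have "\<dots> = (\<Sum>k<?n. F ?n (cDes (rotate k \<pi>) \<inter> {1..?n - 1}) m)"
    by (rule sum.reindex_bij_witness [where i = "\<lambda>k. ?n - k" and j = "\<lambda>i. ?n - i"])
      (use n in \<open>auto simp: cDes_rotate\<close>)
  also have "\<dots> = (\<Sum>k<?n. of_nat (card (?L (rotate k \<pi>))))"
  proof (rule sum.cong [OF refl])
    fix k
    show "F ?n (cDes (rotate k \<pi>) \<inter> {1..?n - 1}) m = of_nat (card (?L (rotate k \<pi>)))"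
      using F_eq_card_labelings [of "rotate k \<pi>" m] n by simp
  qed
  also have "\<dots> = (\<Sum>\<rho>\<in>cyc \<pi>. of_nat (card (?L \<rho>)))"
    using n by (simp add: cyc_eq_image max_def Suc_le_eq sum.reindex inj_on_rotate)
  also have "\<dots> = of_nat (card (\<Union>\<rho>\<in>cyc \<pi>. ?L \<rho>))"
    by (subst card_UN_disjoint) (auto simp: finite_labelings)
  also have "(\<Union>\<rho>\<in>cyc \<pi>. ?L \<rho>) = cyclic_labelings \<pi> m"
    by (auto simp: cyclic_labelings_def)
  finally show ?thesis .
qed

text \<open>The set depends on the representative that is chosen, the series \<open>Fcyc\<close> at this pair does not.\<close>

definition perm_index :: "nat list set \<Rightarrow> nat \<times> nat set" where
  "perm_index P = (let \<pi> = SOME \<pi>. cyc \<pi> = P in (length \<pi>, cDes \<pi>))"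

abbreviation Fcyc_at :: "nat \<times> nat set \<Rightarrow> power_series" where
  "Fcyc_at \<equiv> \<lambda>(n, S). Fcyc n S"

lemma perm_indexE:
  obtains \<rho> where "\<rho> \<in> cyc \<pi>" "cyc \<rho> = cyc \<pi>" "perm_index (cyc \<pi>) = (length \<rho>, cDes \<rho>)"
proof -
  have "cyc (SOME \<rho>. cyc \<rho> = cyc \<pi>) = cyc \<pi>" by (rule someI) simp
  then show ?thesis using that cyc_eq_iff unfolding perm_index_def Let_def by blast
qed

lemma Fcyc_at_perm_index:
  assumes "is_perm \<pi>"
  shows "Fcyc_at (perm_index (cyc \<pi>)) = Fcyc (length \<pi>) (cDes \<pi>)"
proof -
  obtain \<rho> where r: "\<rho> \<in> cyc \<pi>" "perm_index (cyc \<pi>) = (length \<rho>, cDes \<rho>)"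
    by (metis perm_indexE)
  have "Fcyc (length \<rho>) (cDes \<rho>) m = Fcyc (length \<pi>) (cDes \<pi>) m" for m
    using r assms by (simp add: Fcyc_cDes_eq_card is_perm_in_cyc cyclic_labelings_cong)
  then show ?thesis using r by auto
qed

section \<open>The product formula\<close>

text \<open>A factor of \<open>m\<close> is a finitely supported function bounded by \<open>m\<close>.\<close>

lemma finite_monomial_splits: "finite {(a, b). a + b = (m :: nat \<Rightarrow>\<^sub>0 nat)}"
proof -
  define B where "B = (\<Sum>k\<in>Poly_Mapping.keys m. Poly_Mapping.lookup m k)"
  let ?P = "{f. \<forall>x. (x \<in> Poly_Mapping.keys m \<longrightarrow> f x \<in> {..B}) \<and>
    (x \<notin> Poly_Mapping.keys m \<longrightarrow> f x = (0::nat))}"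
  have "finite ?P" by (rule finite_set_of_finite_funs) auto
  then have "finite (Poly_Mapping.lookup -` ?P)"
    by (rule finite_vimageI) (simp add: inj_def)
  moreover have "{(a, b). a + b = m} \<subseteq> (\<lambda>a. (a, m - a)) ` (Poly_Mapping.lookup -` ?P)"
  proof
    fix p assume "p \<in> {(a, b). a + b = m}"
    then obtain a b where p: "p = (a, b)" and m: "m = a + b" by auto
    have le: "Poly_Mapping.lookup a x \<le> Poly_Mapping.lookup m x" for x
      by (simp add: m lookup_add)
    have "Poly_Mapping.lookup m x \<le> B" if "x \<in> Poly_Mapping.keys m" for x
      unfolding B_def by (rule member_le_sum) (use that in auto)
    then have "\<forall>x. (x \<in> Poly_Mapping.keys m \<longrightarrow> Poly_Mapping.lookup a x \<le> B) \<and>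
        (x \<notin> Poly_Mapping.keys m \<longrightarrow> Poly_Mapping.lookup a x = 0)"
      using le by (metis le_trans le_zero_eq not_in_keys_iff_lookup_eq_zero)
    then have "a \<in> Poly_Mapping.lookup -` ?P" by simp
    moreover have "p = (a, m - a)" by (simp add: p m)
    ultimately show "p \<in> (\<lambda>a. (a, m - a)) ` (Poly_Mapping.lookup -` ?P)" by blast
  qed
  ultimately show ?thesis by (meson finite_imageI finite_subset)
qed

text \<open>Restriction to the two sets of letters is a bijection from labelings of the union to pairs of
  labelings, and it restricts the letter order as well. By \<open>mem_Union_cSh_iff\<close>, the pairs counted on the
  left correspond to the labelings whose letter order lies in some member of \<open>cSh\<close>, and the members of
  \<open>cSh\<close> are disjoint.\<close>

lemma Fcyc_mult:
  assumes "is_perm \<pi>" "is_perm \<sigma>" "perm_disjoint \<pi> \<sigma>"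
  shows "Fcyc (length \<pi>) (cDes \<pi>) \<otimes>\<^bsub>PS\<^esub> Fcyc (length \<sigma>) (cDes \<sigma>) =
    (\<lambda>m. \<Sum>T\<in>cSh (cyc \<pi>) (cyc \<sigma>). Fcyc_at (perm_index T) m)"
proof
  fix m :: "nat \<Rightarrow>\<^sub>0 nat"
  let ?X = "set \<pi>" and ?Y = "set \<sigma>" and ?C = "cSh (cyc \<pi>) (cyc \<sigma>)"
  let ?D = "{(a, b). a + b = m}"
  let ?A = "cyclic_labelings \<pi>" and ?B = "cyclic_labelings \<sigma>"
  have disj: "?X \<inter> ?Y = {}" using assms(3) by (simp add: perm_disjoint_def)
  define L where "L = {h \<in> extensional (?X \<union> ?Y). letter_order (?X \<union> ?Y) h \<in> \<Union> ?C \<and>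
    label_monomial (?X \<union> ?Y) h = m}"
  have mon: "label_monomial (?X \<union> ?Y) h =
      label_monomial ?X (restrict h ?X) + label_monomial ?Y (restrict h ?Y)" for h
    unfolding label_monomial_def using disj by (subst sum.union_disjoint) auto
  have split: "h \<in> L \<longleftrightarrow> h \<in> extensional (?X \<union> ?Y) \<and>
      restrict h ?X \<in> ?A (label_monomial ?X (restrict h ?X)) \<and>
      restrict h ?Y \<in> ?B (label_monomial ?Y (restrict h ?Y)) \<and>
      label_monomial ?X (restrict h ?X) + label_monomial ?Y (restrict h ?Y) = m" for h
  proof -
    have fx: "filter (\<lambda>x. x \<in> ?X) (letter_order (?X \<union> ?Y) h) = letter_order ?X (restrict h ?X)"
      by (rule filter_letter_order) auto
    have fy: "filter (\<lambda>x. x \<in> ?Y) (letter_order (?X \<union> ?Y) h) = letter_order ?Y (restrict h ?Y)"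
      by (rule filter_letter_order) auto
    have "letter_order (?X \<union> ?Y) h \<in> \<Union> ?C \<longleftrightarrow>
        letter_order ?X (restrict h ?X) \<in> cyc \<pi> \<and> letter_order ?Y (restrict h ?Y) \<in> cyc \<sigma>"
      unfolding mem_Union_cSh_iff [OF assms] fx fy by simp
    then show ?thesis
      unfolding L_def cyclic_labelings_def mem_Collect_eq mon by auto
  qed
  let ?U = "\<Union>(a, b)\<in>?D. ?A a \<times> ?B b"
  have "bij_betw (\<lambda>h. (restrict h ?X, restrict h ?Y)) L ?U"
  proof (rule bij_betw_imageI)
    show "inj_on (\<lambda>h. (restrict h ?X, restrict h ?Y)) L"
    proof (rule inj_onI, rule extensionalityI [where A = "?X \<union> ?Y"])
      fix h h' x
      assume "(restrict h ?X, restrict h ?Y) = (restrict h' ?X, restrict h' ?Y)" "x \<in> ?X \<union> ?Y"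
      then have "restrict h ?X x = restrict h' ?X x" "restrict h ?Y x = restrict h' ?Y x" by simp_all
      then show "h x = h' x" using \<open>x \<in> ?X \<union> ?Y\<close> by (auto split: if_splits)
    qed (auto simp: split)
    have "(restrict h ?X, restrict h ?Y) \<in> ?U" if "h \<in> L" for h
      using that unfolding split by auto
    moreover have "p \<in> (\<lambda>h. (restrict h ?X, restrict h ?Y)) ` L" if p: "p \<in> ?U" for p
    proof -
      obtain f g a b where fg: "p = (f, g)" "a + b = m" "f \<in> ?A a" "g \<in> ?B b"
        using p by auto
      define h where "h = (\<lambda>z. if z \<in> ?X then f z else g z)"
      have f: "f \<in> extensional ?X" "label_monomial ?X f = a"
        and g: "g \<in> extensional ?Y" "label_monomial ?Y g = b"
        using fg by (auto simp: cyclic_labelings_def)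
      have hx: "restrict h ?X = f" and hy: "restrict h ?Y = g"
        using f(1) g(1) disj by (auto simp: h_def restrict_def extensional_def fun_eq_iff)
      moreover have "h \<in> extensional (?X \<union> ?Y)"
        using g(1) by (auto simp: h_def extensional_def)
      ultimately have "h \<in> L"
        unfolding split hx hy using fg f g by simp
      then show ?thesis using hx hy fg(1) by force
    qed
    ultimately show "(\<lambda>h. (restrict h ?X, restrict h ?Y)) ` L = ?U" by blast
  qed
  then have cardL: "card L = card ?U" by (rule bij_betw_same_card)
  have "card ?U = (\<Sum>(a, b)\<in>?D. card (?A a) * card (?B b))"
  proof -
    have "(case i of (a, b) \<Rightarrow> ?A a \<times> ?B b) \<inter> (case j of (a, b) \<Rightarrow> ?A a \<times> ?B b) = {}"
      if "i \<noteq> j" for i j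
      using that by (auto simp: cyclic_labelings_def)
    then show ?thesis
      by (subst card_UN_disjoint)
        (auto simp: finite_monomial_splits card_cartesian_product intro!: sum.cong)
  qed
  then have "(Fcyc (length \<pi>) (cDes \<pi>) \<otimes>\<^bsub>PS\<^esub> Fcyc (length \<sigma>) (cDes \<sigma>)) m = of_nat (card L)"
    unfolding cardL by (simp add: PS_def Fcyc_cDes_eq_card assms case_prod_beta)
  also have "L = (\<Union>T\<in>?C. {h \<in> extensional (?X \<union> ?Y). letter_order (?X \<union> ?Y) h \<in> T \<and>
    label_monomial (?X \<union> ?Y) h = m})" (is "_ = (\<Union>T\<in>?C. ?L T)")
    unfolding L_def by blast
  also have "card \<dots> = (\<Sum>T\<in>?C. card (?L T))"
  proof (rule card_UN_disjoint)
    show "finite ?C" using finite_cSh assms by blast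
    show "\<forall>T\<in>?C. finite (?L T)"
      by (auto intro!: finite_labelings)
    have "T = T'" if TT: "T \<in> ?C" "T' \<in> ?C" "\<rho> \<in> T" "\<rho> \<in> T'" for T T' \<rho>
    proof -
      obtain \<tau> \<tau>' where "T = cyc \<tau>" "T' = cyc \<tau>'"
        using TT(1,2) cShE [OF assms] by metis
      then show ?thesis using TT(3,4) cyc_eq_if_in by blast
    qed
    then show "\<forall>T\<in>?C. \<forall>T'\<in>?C. T \<noteq> T' \<longrightarrow> ?L T \<inter> ?L T' = {}" by blast
  qed
  also have "(of_nat \<dots> :: rat) = (\<Sum>T\<in>?C. of_nat (card (?L T)))" by simp
  also have "\<dots> = (\<Sum>T\<in>?C. Fcyc_at (perm_index T) m)"
  proof (rule sum.cong [OF refl])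
    fix T assume "T \<in> ?C"
    then obtain \<tau> where t: "T = cyc \<tau>" "is_perm \<tau>" "set \<tau> = ?X \<union> ?Y"
      using cShE [OF assms] by metis
    then have "?L T = cyclic_labelings \<tau> m"
      by (simp add: cyclic_labelings_def)
    then show "of_nat (card (?L T)) = Fcyc_at (perm_index T) m"
      using t by (simp add: Fcyc_at_perm_index Fcyc_cDes_eq_card)
  qed
  finally show "(Fcyc (length \<pi>) (cDes \<pi>) \<otimes>\<^bsub>PS\<^esub> Fcyc (length \<sigma>) (cDes \<sigma>)) m =
    (\<Sum>T\<in>?C. Fcyc_at (perm_index T) m)" .
qed

section \<open>Linear independence\<close>

text \<open>The value at \<open>c\<close> of the linear functional that sends the basis element \<open>i\<close> to \<open>t i\<close>. All
  linear maps below are handled through their coordinates, which have this form.\<close>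

definition pairing :: "('i \<Rightarrow>\<^sub>0 rat) \<Rightarrow> ('i \<Rightarrow> rat) \<Rightarrow> rat" where
  "pairing c t = (\<Sum>i\<in>Poly_Mapping.keys c. Poly_Mapping.lookup c i * t i)"

lemma pairing_superset:
  assumes "finite J" "Poly_Mapping.keys c \<subseteq> J"
  shows "pairing c t = (\<Sum>i\<in>J. Poly_Mapping.lookup c i * t i)"
  unfolding pairing_def
  by (rule sum.mono_neutral_left) (use assms in \<open>auto simp: in_keys_iff\<close>)

lemma pairing_zero [simp]: "pairing 0 t = 0"
  by (simp add: pairing_def)

lemma pairing_single [simp]: "pairing (Poly_Mapping.single i q) t = q * t i"
  by (simp add: pairing_superset [of "{i}"])

lemma pairing_add: "pairing (c + d) t = pairing c t + pairing d t"
proof -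
  let ?J = "Poly_Mapping.keys c \<union> Poly_Mapping.keys d"
  have "Poly_Mapping.keys (c + d) \<subseteq> ?J" by (rule Poly_Mapping.keys_add)
  then show ?thesis
    by (simp add: pairing_superset [of ?J] lookup_add distrib_right sum.distrib)
qed

lemma pairing_sum: "pairing (\<Sum>x\<in>X. c x) t = (\<Sum>x\<in>X. pairing (c x) t)"
  by (induction X rule: infinite_finite_induct) (auto simp: pairing_add)

lemma lookup_scale [simp]:
  "Poly_Mapping.lookup (Poly_Mapping.map ((*) (q::rat)) c) i = q * Poly_Mapping.lookup c i"
  by (simp add: Poly_Mapping.map.rep_eq when_def)

lemma keys_scale: "Poly_Mapping.keys (Poly_Mapping.map ((*) (q::rat)) c) \<subseteq> Poly_Mapping.keys c"
  by (auto simp: in_keys_iff)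

lemma pairing_scale: "pairing (Poly_Mapping.map ((*) q) c) t = q * pairing c t"
  by (subst pairing_superset [OF finite_keys keys_scale])
    (simp add: pairing_def sum_distrib_left mult.assoc)

lemma pairing_minus: "pairing (c - d) t = pairing c t - pairing d t"
proof -
  have "pairing c t = pairing (c - d) t + pairing d t"
    by (simp flip: pairing_add)
  then show ?thesis by simp
qed

text \<open>A monomial is the content of a word; so a weakly increasing word is determined by its monomial.\<close>

lemma lookup_monomial: "Poly_Mapping.lookup (monomial w) k = count_list w k"
  by (induction w) (auto simp: monomial_def lookup_add lookup_single when_def)

lemma monomial_eq_iff: "monomial w = monomial w' \<longleftrightarrow> mset w = mset w'"
  by (simp add: poly_mapping_eq_iff fun_eq_iff lookup_monomial multiset_eq_iff count_mset)

text \<open>The weakly increasing word of length \<open>n\<close> whose strict ascents are at the positions in \<open>U\<close>.\<close>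

definition ascent_word :: "nat \<Rightarrow> nat set \<Rightarrow> nat list" where
  "ascent_word n U = map (\<lambda>i. card {u \<in> U. u \<le> i}) [0..<n]"

lemma length_ascent_word [simp]: "length (ascent_word n U) = n"
  by (simp add: ascent_word_def)

lemma ascent_word_step:
  assumes "finite U" "j \<in> {1..<n}"
  shows "ascent_word n U ! j = ascent_word n U ! (j - 1) + of_bool (j \<in> U)"
proof -
  have "{u \<in> U. u \<le> j} = {u \<in> U. u \<le> j - 1} \<union> (if j \<in> U then {j} else {})"
    using assms(2) by (auto simp: le_less Suc_le_eq)
  then have "card {u \<in> U. u \<le> j} = card {u \<in> U. u \<le> j - 1} + of_bool (j \<in> U)"
    using assms by (auto simp: card_insert_if)
  moreover have "ascent_word n U ! i = card {u \<in> U. u \<le> i}" if "i < n" for i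
    using that by (simp add: ascent_word_def)
  ultimately show ?thesis using assms(2) by auto
qed

text \<open>The only weakly increasing word with this monomial is the ascent word itself, and it increases strictly
  at all positions in \<open>T\<close> exactly if \<open>T\<close> consists of ascents.\<close>

lemma F_ascent_word:
  assumes "U \<subseteq> {1..n - 1}" "T \<subseteq> {1..n - 1}"
  shows "F n T (monomial (ascent_word n U)) = of_bool (T \<subseteq> U)"
proof -
  let ?u = "ascent_word n U"
  have fin: "finite U" using assms finite_subset by blast
  define W where "W = {w. length w = n \<and>
    (\<forall>j\<in>{1..<n}. w ! (j - 1) \<le> w ! j \<and> (j \<in> T \<longrightarrow> w ! (j - 1) < w ! j)) \<and>
    monomial w = monomial ?u}"
  have sorted: "sorted w" if "length w = n" "\<forall>j\<in>{1..<n}. w ! (j - 1) \<le> w ! j" for w :: "nat list"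
    unfolding sorted_iff_nth_Suc
  proof (intro allI impI)
    fix i assume "Suc i < length w"
    then show "w ! i \<le> w ! Suc i" using that(2) [rule_format, of "Suc i"] that(1) by simp
  qed
  have su: "sorted ?u"
    by (rule sorted) (use ascent_word_step [OF fin] in auto)
  have uniq: "w = ?u" if "w \<in> W" for w
  proof -
    have "sorted w" using that by (intro sorted) (auto simp: W_def)
    moreover have "mset w = mset ?u" using that by (simp add: W_def monomial_eq_iff)
    ultimately show ?thesis using su by (metis properties_for_sort)
  qed
  have mem: "?u \<in> W \<longleftrightarrow> T \<subseteq> U"
  proof -
    have "?u \<in> W \<longleftrightarrow> (\<forall>j\<in>{1..<n}. j \<in> T \<longrightarrow> j \<in> U)"
      using ascent_word_step [OF fin] by (auto simp: W_def)
    also have "\<dots> \<longleftrightarrow> T \<subseteq> U" using assms(2) by fastforce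
    finally show ?thesis .
  qed
  have "W = (if T \<subseteq> U then {?u} else {})" using uniq mem by auto
  then show ?thesis unfolding F_def W_def [symmetric] by simp
qed

lemma F_other_length: "length w \<noteq> n \<Longrightarrow> F n T (monomial w) = 0"
proof -
  assume "length w \<noteq> n"
  then have "{v. length v = n \<and> (\<forall>j\<in>{1..<n}. v ! (j - 1) \<le> v ! j \<and>
      (j \<in> T \<longrightarrow> v ! (j - 1) < v ! j)) \<and> monomial v = monomial w} = {}"
    by (auto simp: monomial_eq_iff dest: mset_eq_length)
  then show ?thesis unfolding F_def by (metis card.empty of_nat_0)
qed

lemma Fcyc_other_length:
  assumes "length w \<noteq> n"
  shows "Fcyc n S (monomial w) = 0"
proof (cases "n = 0")
  case True
  have "monomial w \<noteq> monomial []" using assms True by (auto simp: monomial_eq_iff)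
  then show ?thesis using True by (simp add: Fcyc_def PS_def monomial_def)
qed (use assms in \<open>simp add: Fcyc_def F_other_length\<close>)

text \<open>The series \<open>F n T\<close> sees only the part of a shift of \<open>S\<close> in \<open>{1..n - 1}\<close>; membership of \<open>n\<close> does not
  matter for being a subset of a set that contains \<open>n\<close>.\<close>

lemma Fcyc_ascent_word:
  assumes "0 < n" "n \<in> V" "V \<subseteq> {1..n}"
  shows "Fcyc n S (monomial (ascent_word n (V \<inter> {1..n - 1}))) =
    (\<Sum>i=1..n. of_bool (cshift n S i \<subseteq> V))"
proof -
  have "cshift n S i \<inter> {1..n - 1} \<subseteq> V \<inter> {1..n - 1} \<longleftrightarrow> cshift n S i \<subseteq> V" for i
  proof -
    have "{1..n} = insert n {1..n - 1}" using assms(1) by auto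
    then have "cshift n S i \<subseteq> insert n {1..n - 1}" using cshift_subset [OF assms(1), of S i] by simp
    then show ?thesis using assms(2) by blast
  qed
  then show ?thesis
    using assms(1) by (simp add: Fcyc_def F_ascent_word)
qed

lemma non_Escher_subset: "non_Escher n S \<Longrightarrow> S \<subseteq> {1..n}"
  unfolding non_Escher_def using cDes_subset by blast

text \<open>The cyclic successor of the largest letter is smaller than it.\<close>

lemma non_Escher_nonempty:
  assumes "non_Escher n S" "2 \<le> n"
  shows "S \<noteq> {}"
proof -
  obtain \<pi> where p: "is_perm \<pi>" "length \<pi> = n" "cDes \<pi> = S"
    using assms(1) by (auto simp: non_Escher_def)
  have ne: "set \<pi> \<noteq> {}" using p(2) assms(2) by auto
  then obtain i where i: "i < n" "\<pi> ! i = Max (set \<pi>)"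
    using p(2) by (metis List.finite_set Max_in in_set_conv_nth)
  have s: "Suc i mod n < n" "Suc i mod n \<noteq> i"
    using i(1) assms(2) by (auto simp: mod_Suc)
  then have "\<pi> ! (Suc i mod n) \<noteq> \<pi> ! i"
    using p i(1) by (auto simp: is_perm_def nth_eq_iff_index_eq)
  moreover have "\<pi> ! (Suc i mod n) \<le> \<pi> ! i"
    using s p(2) by (simp add: i(2))
  ultimately have "Suc i \<in> cDes \<pi>" using i(1) p(2) by (auto simp: cDes_def)
  then show ?thesis using p(3) by blast
qed

lemma non_Escher_short: "non_Escher n S \<Longrightarrow> n \<le> 1 \<Longrightarrow> S = {}"
  by (auto simp: non_Escher_def cDes_def le_Suc_eq)

lemma inj_on_residue_shift:
  assumes "j \<le> n"
  shows "inj_on (residue_shift n j) {1..n}"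
proof (rule inj_on_inverseI)
  fix s assume "s \<in> {1..n}"
  then show "residue_shift n (n - j) (residue_shift n j s) = s"
    using assms by (simp add: residue_shift_add residue_shift_self)
qed

lemma bij_betw_residue_shift:
  assumes "j \<le> n" "0 < n"
  shows "bij_betw (residue_shift n j) {1..n} {1..n}"
proof -
  have "residue_shift n j ` {1..n} \<subseteq> {1..n}"
    using residue_shift_range [OF assms(2)] by blast
  then have "residue_shift n j ` {1..n} = {1..n}"
    by (intro endo_inj_surj inj_on_residue_shift assms) auto
  then show ?thesis using inj_on_residue_shift [OF assms(1)] by (simp add: bij_betw_def)
qed

text \<open>Shifting the shift: \<open>residue_shift\<close> is symmetric in the residue and the amount, up to the
  representative of the result.\<close>

lemma cshift_residue_shift:
  assumes "S \<subseteq> {1..n}" "0 < i"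
  shows "cshift n S (residue_shift n j i) = cshift n (cshift n S i) j"
proof -
  have "residue_shift n (residue_shift n j i) s = residue_shift n j (residue_shift n i s)"
    if "s \<in> S" for s
  proof -
    have "0 < s" using that assms by auto
    have "residue_shift n (residue_shift n j i) s = residue_shift n s (residue_shift n j i)"
      by (simp add: residue_shift_def add.commute)
    also have "\<dots> = residue_shift n (j + s) i" using assms by (simp add: residue_shift_add)
    also have "\<dots> = residue_shift n (i + j) s" by (simp add: residue_shift_def algebra_simps)
    also have "\<dots> = residue_shift n j (residue_shift n i s)"
      using \<open>0 < s\<close> by (simp add: residue_shift_add)
    finally show ?thesis .
  qed
  then show ?thesis unfolding cshift_eq image_image by (rule image_cong [OF refl])
qed

text \<open>Let \<open>D V\<close> be the sum of \<open>c S\<close> over all pairs of an \<open>S \<in> K\<close> and a shift of \<open>S\<close> that is contained in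
  \<open>V\<close>. It is a coefficient of the given vanishing combination if \<open>n \<in> V\<close>, and it does not change when
  \<open>V\<close> is shifted; hence it is \<open>0\<close> for every nonempty \<open>V\<close>. For \<open>V = {}\<close> it is an empty sum if \<open>n \<ge> 2\<close>,
  as non-Escher sets are then nonempty, and if \<open>n = 1\<close> it agrees with \<open>D {1}\<close>. Replacing "contained in
  \<open>V\<close>" by "equal to \<open>V\<close>" is inclusion-exclusion.\<close>

lemma shift_counts_zero:
  fixes c :: "nat set \<Rightarrow> rat"
  assumes n: "0 < n" and K: "finite K" "\<And>S. S \<in> K \<Longrightarrow> non_Escher n S"
    and zero: "\<And>w. length w = n \<Longrightarrow> (\<Sum>S\<in>K. c S * Fcyc n S (monomial w)) = 0"
    and V: "V \<subseteq> {1..n}"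
  shows "(\<Sum>S\<in>K. c S * (\<Sum>i=1..n. of_bool (cshift n S i = V))) = 0"
proof -
  define D where "D V = (\<Sum>S\<in>K. c S * (\<Sum>i=1..n. of_bool (cshift n S i \<subseteq> V)))" for V
  define E where "E V = (\<Sum>S\<in>K. c S * (\<Sum>i=1..n. of_bool (cshift n S i = V)))" for V
  have D1: "D V = 0" if "n \<in> V" "V \<subseteq> {1..n}" for V
    unfolding D_def Fcyc_ascent_word [OF n that, symmetric] by (rule zero) simp
  have D_shift: "D (cshift n V j) = D V" if V: "V \<subseteq> {1..n}" and j: "j \<le> n" for V j
  proof -
    have "(\<Sum>i=1..n. of_bool (cshift n S i \<subseteq> cshift n V j) :: rat) =
        (\<Sum>i=1..n. of_bool (cshift n S i \<subseteq> V))" if "S \<in> K" for S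
    proof -
      have S: "S \<subseteq> {1..n}" using K(2) that non_Escher_subset by blast
      have "(\<Sum>i=1..n. of_bool (cshift n S i \<subseteq> cshift n V j) :: rat) =
          (\<Sum>i=1..n. of_bool (cshift n S (residue_shift n j i) \<subseteq> cshift n V j))"
        by (rule sum.reindex_bij_betw [OF bij_betw_residue_shift [OF j n], symmetric])
      also have "\<dots> = (\<Sum>i=1..n. of_bool (cshift n S i \<subseteq> V))"
      proof (rule sum.cong [OF refl])
        fix i assume "i \<in> {1..n}"
        then have "cshift n S (residue_shift n j i) = residue_shift n j ` cshift n S i"
          using cshift_residue_shift [OF S, of i j] cshift_eq by simp
        moreover have "residue_shift n j ` cshift n S i \<subseteq> residue_shift n j ` V \<longleftrightarrow> cshift n S i \<subseteq> V"
          using inj_on_image_mem_iff [OF inj_on_residue_shift [OF j] _ V] cshift_subset [OF n, of S i]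
          by blast
        ultimately show "of_bool (cshift n S (residue_shift n j i) \<subseteq> cshift n V j) =
            (of_bool (cshift n S i \<subseteq> V) :: rat)"
          by (simp add: cshift_eq [of n V])
      qed
      finally show ?thesis .
    qed
    then show ?thesis unfolding D_def by (intro sum.cong refl) simp
  qed
  have D0: "D V = 0" if V: "V \<subseteq> {1..n}" for V
  proof (cases "V = {}")
    case False
    then obtain v where v: "v \<in> V" by blast
    then have vn: "v \<in> {1..n}" using V by blast
    \<comment> \<open>Shift \<open>V\<close> so that one of its elements becomes \<open>n\<close>.\<close>
    have "residue_shift n (n - v) v = (n - 1) mod n + 1"
      using vn by (simp add: residue_shift_def)
    also have "\<dots> = n" using n by simp
    finally have "n \<in> cshift n V (n - v)" using v by (metis cshift_eq imageI)
    then show ?thesis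
      using D1 [of "cshift n V (n - v)"] D_shift [OF V, of "n - v"] cshift_subset [OF n] by simp
  next
    case True
    show ?thesis
    proof (cases "n = 1")
      case n1: True
      then have "S = {}" if "S \<in> K" for S using K(2) that non_Escher_short by blast
      then have "cshift n S i = {}" if "S \<in> K" for S i using that by (simp add: cshift_eq)
      then have "D {} = D {1}" unfolding D_def by (intro sum.cong refl) simp
      then show ?thesis using D1 [of "{1}"] n1 True by simp
    next
      case False
      then have "S \<noteq> {}" if "S \<in> K" for S using K(2) that n non_Escher_nonempty by force
      then show ?thesis using True by (auto simp: D_def cshift_eq intro!: sum.neutral)
    qed
  qed
  have DE: "D V = (\<Sum>W\<in>Pow V. E W)" if V: "V \<subseteq> {1..n}" for V
  proof -
    have fin: "finite (Pow V)" using V finite_subset by blast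
    have "of_bool (cshift n S i \<subseteq> V) = (\<Sum>W\<in>Pow V. of_bool (cshift n S i = W) :: rat)" for S i
      using fin by (simp add: of_bool_def sum.delta')
    then have "D V = (\<Sum>S\<in>K. c S * (\<Sum>i=1..n. \<Sum>W\<in>Pow V. of_bool (cshift n S i = W)))"
      unfolding D_def by (intro sum.cong refl) metis
    also have "\<dots> = (\<Sum>S\<in>K. \<Sum>W\<in>Pow V. c S * (\<Sum>i=1..n. of_bool (cshift n S i = W)))"
      unfolding sum_distrib_left [where A = "Pow V", symmetric]
      by (intro sum.cong refl arg_cong [of _ _ "(*) _"] sum.swap)
    also have "\<dots> = (\<Sum>W\<in>Pow V. E W)"
      unfolding E_def by (rule sum.swap)
    finally show ?thesis .
  qed
  have "finite V" using V finite_subset by blast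
  then have "E V = 0" using V
  proof (induction V rule: finite_psubset_induct)
    case (psubset V)
    have "Pow V = insert V {W. W \<subset> V}" by auto
    moreover have "finite {W. W \<subset> V}" using psubset.hyps
      by (metis finite_Pow_iff finite_insert \<open>Pow V = insert V {W. W \<subset> V}\<close>)
    ultimately have "D V = E V + (\<Sum>W\<in>{W. W \<subset> V}. E W)"
      using DE [OF psubset.prems] by simp
    moreover have "(\<Sum>W\<in>{W. W \<subset> V}. E W) = 0"
      using psubset by (intro sum.neutral) auto
    ultimately show ?case using D0 [OF psubset.prems] by simp
  qed
  then show ?thesis by (simp add: E_def)
qed

text \<open>Linear independence of the series, up to their invariance under shifts. It is stated for the linear
  functionals that respect this invariance, because this is how it is used: they take equal values on two
  formal combinations that represent the same series. For each \<open>n\<close>, the average of \<open>t\<close> over the shifts of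
  \<open>S\<close> is again \<open>t\<close>, so the pairing is a combination of the counts that vanish by \<open>shift_counts_zero\<close>.\<close>

lemma Fcyc_relations:
  assumes c: "Poly_Mapping.keys c \<subseteq> {(n, S). non_Escher n S}"
    and zero: "\<And>m. pairing c (\<lambda>i. Fcyc_at i m) = 0"
    and shift: "\<And>n S i. non_Escher n S \<Longrightarrow> i \<in> {1..n} \<Longrightarrow> t (n, cshift n S i) = t (n, S)"
  shows "pairing c t = 0"
proof -
  define K where "K n = {S. (n, S) \<in> Poly_Mapping.keys c}" for n
  define c' where "c' n S = Poly_Mapping.lookup c (n, S)" for n S
  have finK: "finite (K n)" for n
    unfolding K_def by (rule finite_vimageI [of _ "Pair n", unfolded vimage_def]) (auto simp: inj_def)
  have neK: "non_Escher n S" if "S \<in> K n" for n S using that c by (auto simp: K_def)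
  have slice: "pairing c u = (\<Sum>n\<in>fst ` Poly_Mapping.keys c. \<Sum>S\<in>K n. c' n S * u (n, S))" for u
  proof -
    have "pairing c u = (\<Sum>n\<in>fst ` Poly_Mapping.keys c.
        \<Sum>i\<in>{i \<in> Poly_Mapping.keys c. fst i = n}. Poly_Mapping.lookup c i * u i)"
      unfolding pairing_def by (rule sum.image_gen) simp
    also have "\<dots> = (\<Sum>n\<in>fst ` Poly_Mapping.keys c. \<Sum>S\<in>K n. c' n S * u (n, S))"
    proof (rule sum.cong [OF refl])
      fix n
      show "(\<Sum>i\<in>{i \<in> Poly_Mapping.keys c. fst i = n}. Poly_Mapping.lookup c i * u i) =
          (\<Sum>S\<in>K n. c' n S * u (n, S))"
        by (rule sum.reindex_bij_witness [where i = "Pair n" and j = snd])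
          (auto simp: K_def c'_def)
    qed
    finally show ?thesis .
  qed
  have zero': "(\<Sum>S\<in>K n. c' n S * Fcyc n S (monomial w)) = 0" if w: "length w = n" for n w
  proof (cases "n \<in> fst ` Poly_Mapping.keys c")
    case True
    have "0 = (\<Sum>k\<in>fst ` Poly_Mapping.keys c. \<Sum>S\<in>K k. c' k S * Fcyc k S (monomial w))"
      using zero [of "monomial w"] by (simp add: slice)
    also have "\<dots> = (\<Sum>k\<in>fst ` Poly_Mapping.keys c.
        if k = n then \<Sum>S\<in>K n. c' n S * Fcyc n S (monomial w) else 0)"
      by (rule sum.cong [OF refl]) (use w in \<open>auto simp: Fcyc_other_length\<close>)
    also have "\<dots> = (\<Sum>S\<in>K n. c' n S * Fcyc n S (monomial w))"
      using True by (simp add: sum.delta)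
    finally show ?thesis by simp
  next
    case False
    then have "K n = {}" by (force simp: K_def)
    then show ?thesis by simp
  qed
  have "(\<Sum>S\<in>K n. c' n S * t (n, S)) = 0" for n
  proof (cases "n = 0")
    case True
    have "Fcyc n S (monomial []) = 1" for S using True by (simp add: Fcyc_def PS_def monomial_def)
    then have "(\<Sum>S\<in>K n. c' n S) = 0" using zero' [of "[]" n] True by simp
    moreover have "(\<Sum>S\<in>K n. c' n S * t (n, S)) = (\<Sum>S\<in>K n. c' n S * t (n, {}))"
      using neK non_Escher_short True by (intro sum.cong refl) auto
    ultimately show ?thesis by (simp flip: sum_distrib_right)
  next
    case False
    then have n: "0 < n" by simp
    let ?P = "Pow {1..n}"
    \<comment> \<open>Average \<open>t\<close> over all shifts, then collect the shifts that are equal to a given set.\<close>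
    have "of_nat n * (\<Sum>S\<in>K n. c' n S * t (n, S)) =
        (\<Sum>S\<in>K n. c' n S * (\<Sum>i=1..n. t (n, cshift n S i)))"
      unfolding sum_distrib_left by (rule sum.cong [OF refl]) (simp add: shift neK algebra_simps)
    also have "\<dots> = (\<Sum>S\<in>K n. c' n S * (\<Sum>i=1..n. \<Sum>V\<in>?P. of_bool (cshift n S i = V) * t (n, V)))"
    proof -
      have "(\<Sum>V\<in>?P. of_bool (X = V) * t (n, V)) = t (n, X)" if "X \<subseteq> {1..n}" for X
      proof -
        have "(\<Sum>V\<in>?P. of_bool (X = V) * t (n, V)) = (\<Sum>V\<in>?P. if V = X then t (n, V) else 0)"
          by (rule sum.cong) auto
        then show ?thesis using that by (simp add: sum.delta)
      qed
      then show ?thesis using cshift_subset [OF n] by simp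
    qed
    also have "\<dots> = (\<Sum>V\<in>?P. t (n, V) * (\<Sum>S\<in>K n. c' n S * (\<Sum>i=1..n. of_bool (cshift n S i = V))))"
    proof -
      have "(\<Sum>S\<in>K n. c' n S * (\<Sum>i=1..n. \<Sum>V\<in>?P. of_bool (cshift n S i = V) * t (n, V))) =
        (\<Sum>S\<in>K n. \<Sum>V\<in>?P. t (n, V) * (c' n S * (\<Sum>i=1..n. of_bool (cshift n S i = V))))"
        by (subst sum.swap) (simp add: sum_distrib_left sum_distrib_right mult_ac)
      also have "\<dots> = (\<Sum>V\<in>?P. \<Sum>S\<in>K n. t (n, V) * (c' n S * (\<Sum>i=1..n. of_bool (cshift n S i = V))))"
        by (rule sum.swap)
      finally show ?thesis by (simp add: sum_distrib_left)
    qed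
    also have "\<dots> = 0"
      using shift_counts_zero [OF n finK neK zero'] by (intro sum.neutral) auto
    finally show ?thesis using n by simp
  qed
  then show ?thesis by (simp add: slice)
qed

section \<open>Algebras over the rationals\<close>

lemma cring_rat_ring: "cring rat_ring"
  by (rule cringI)
    (auto simp: rat_ring_def algebra_simps intro!: abelian_groupI comm_monoidI
      exI [of _ "- x" for x])

lemma rat_ring_simps [simp]: "carrier rat_ring = UNIV" "mult rat_ring = (*)" "one rat_ring = 1"
  "zero rat_ring = 0" "add rat_ring = (+)"
  by (simp_all add: rat_ring_def)

lemma rat_algebraD:
  assumes "rat_algebra A"
  shows "ring A" "Module.module rat_ring A" "abelian_group A" "abelian_monoid A"
proof -
  show "ring A" and "Module.module rat_ring A" using assms by (simp_all add: rat_algebra_def)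
  then show "abelian_group A" by (simp add: ring.is_abelian_group)
  then show "abelian_monoid A" by (simp add: abelian_group_def)
qed

lemma rat_algebra_mult_smult:
  assumes "rat_algebra A" "x \<in> carrier A" "y \<in> carrier A"
  shows "(q \<odot>\<^bsub>A\<^esub> x) \<otimes>\<^bsub>A\<^esub> y = q \<odot>\<^bsub>A\<^esub> (x \<otimes>\<^bsub>A\<^esub> y)"
    "x \<otimes>\<^bsub>A\<^esub> (q \<odot>\<^bsub>A\<^esub> y) = q \<odot>\<^bsub>A\<^esub> (x \<otimes>\<^bsub>A\<^esub> y)"
  using assms by (auto simp: rat_algebra_def)

lemma rat_algebra_smult_add:
  assumes "rat_algebra A" "x \<in> carrier A" "y \<in> carrier A"
  shows "q \<odot>\<^bsub>A\<^esub> (x \<oplus>\<^bsub>A\<^esub> y) = q \<odot>\<^bsub>A\<^esub> x \<oplus>\<^bsub>A\<^esub> q \<odot>\<^bsub>A\<^esub> y"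
proof -
  interpret Module.module rat_ring A using rat_algebraD assms by blast
  show ?thesis using smult_r_distr [of q x y] assms by simp
qed

lemma rat_algebra_smult:
  assumes "rat_algebra A" "x \<in> carrier A"
  shows "q \<odot>\<^bsub>A\<^esub> x \<in> carrier A"
    "(q + r) \<odot>\<^bsub>A\<^esub> x = q \<odot>\<^bsub>A\<^esub> x \<oplus>\<^bsub>A\<^esub> r \<odot>\<^bsub>A\<^esub> x"
    "(q * r) \<odot>\<^bsub>A\<^esub> x = q \<odot>\<^bsub>A\<^esub> (r \<odot>\<^bsub>A\<^esub> x)"
    "1 \<odot>\<^bsub>A\<^esub> x = x" "0 \<odot>\<^bsub>A\<^esub> x = \<zero>\<^bsub>A\<^esub>"
proof -
  interpret Module.module rat_ring A using rat_algebraD assms by blast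
  show "q \<odot>\<^bsub>A\<^esub> x \<in> carrier A" using smult_closed assms by simp
  show "(q + r) \<odot>\<^bsub>A\<^esub> x = q \<odot>\<^bsub>A\<^esub> x \<oplus>\<^bsub>A\<^esub> r \<odot>\<^bsub>A\<^esub> x"
    using smult_l_distr [of q r x] assms by simp
  show "(q * r) \<odot>\<^bsub>A\<^esub> x = q \<odot>\<^bsub>A\<^esub> (r \<odot>\<^bsub>A\<^esub> x)"
    using smult_assoc1 [of q r x] assms by simp
  show "1 \<odot>\<^bsub>A\<^esub> x = x" using smult_one [of x] assms by simp
  show "0 \<odot>\<^bsub>A\<^esub> x = \<zero>\<^bsub>A\<^esub>" using smult_l_null [of x] assms by simp
qed

lemma rat_algebra_closed:
  assumes "rat_algebra A" "x \<in> carrier A" "y \<in> carrier A"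
  shows "x \<oplus>\<^bsub>A\<^esub> y \<in> carrier A" "x \<otimes>\<^bsub>A\<^esub> y \<in> carrier A"
proof -
  interpret ring A using rat_algebraD assms by blast
  show "x \<oplus>\<^bsub>A\<^esub> y \<in> carrier A" "x \<otimes>\<^bsub>A\<^esub> y \<in> carrier A" using assms by auto
qed

lemma rat_algebra_const_closed:
  assumes "rat_algebra A"
  shows "\<zero>\<^bsub>A\<^esub> \<in> carrier A" "\<one>\<^bsub>A\<^esub> \<in> carrier A"
proof -
  interpret ring A using rat_algebraD assms by blast
  show "\<zero>\<^bsub>A\<^esub> \<in> carrier A" "\<one>\<^bsub>A\<^esub> \<in> carrier A" by auto
qed

lemma alg_hom_closed: "f \<in> alg_hom A B \<Longrightarrow> x \<in> carrier A \<Longrightarrow> f x \<in> carrier B"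
  and alg_hom_smult: "f \<in> alg_hom A B \<Longrightarrow> x \<in> carrier A \<Longrightarrow> f (q \<odot>\<^bsub>A\<^esub> x) = q \<odot>\<^bsub>B\<^esub> f x"
  and alg_hom_mult: "f \<in> alg_hom A B \<Longrightarrow> x \<in> carrier A \<Longrightarrow> y \<in> carrier A \<Longrightarrow>
    f (x \<otimes>\<^bsub>A\<^esub> y) = f x \<otimes>\<^bsub>B\<^esub> f y"
  and alg_hom_add: "f \<in> alg_hom A B \<Longrightarrow> x \<in> carrier A \<Longrightarrow> y \<in> carrier A \<Longrightarrow>
    f (x \<oplus>\<^bsub>A\<^esub> y) = f x \<oplus>\<^bsub>B\<^esub> f y"
  by (auto simp: alg_hom_def ring_hom_def)

lemmas alg_homD = alg_hom_closed alg_hom_mult alg_hom_add alg_hom_smult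

lemma alg_hom_one: "f \<in> alg_hom A B \<Longrightarrow> f \<one>\<^bsub>A\<^esub> = \<one>\<^bsub>B\<^esub>"
  by (simp add: alg_hom_def ring_hom_def)

lemma alg_homI:
  assumes "\<And>x. x \<in> carrier A \<Longrightarrow> f x \<in> carrier B"
    "\<And>x y. x \<in> carrier A \<Longrightarrow> y \<in> carrier A \<Longrightarrow> f (x \<otimes>\<^bsub>A\<^esub> y) = f x \<otimes>\<^bsub>B\<^esub> f y"
    "\<And>x y. x \<in> carrier A \<Longrightarrow> y \<in> carrier A \<Longrightarrow> f (x \<oplus>\<^bsub>A\<^esub> y) = f x \<oplus>\<^bsub>B\<^esub> f y"
    "\<And>q x. x \<in> carrier A \<Longrightarrow> f (q \<odot>\<^bsub>A\<^esub> x) = q \<odot>\<^bsub>B\<^esub> f x"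
    "f \<one>\<^bsub>A\<^esub> = \<one>\<^bsub>B\<^esub>"
  shows "f \<in> alg_hom A B"
  using assms by (auto simp: alg_hom_def ring_hom_def)

lemma alg_hom_compose:
  assumes "f \<in> alg_hom A B" "g \<in> alg_hom B C"
  shows "g \<circ> f \<in> alg_hom A C"
  by (rule alg_homI) (use assms in \<open>simp_all add: alg_homD alg_hom_one\<close>)

text \<open>All axioms of an algebra are identities, up to the existence of negatives, so they pass to
  the image of any map that respects the operations.\<close>

lemma rat_algebra_image:
  assumes A: "rat_algebra A" and f: "f \<in> alg_hom A B"
    and surj: "f ` carrier A = carrier B" and zero: "f \<zero>\<^bsub>A\<^esub> = \<zero>\<^bsub>B\<^esub>"
  shows "rat_algebra B"
proof -
  interpret A: ring A using rat_algebraD(1) A .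
  note hom = alg_hom_mult [OF f, symmetric] alg_hom_add [OF f, symmetric] alg_hom_smult [OF f, symmetric]
  have pre: "\<exists>x'. x' \<in> carrier A \<and> x = f x'" if "x \<in> carrier B" for x
    using that surj by blast
  have closed: "f x \<in> carrier B" if "x \<in> carrier A" for x using that surj by blast
  note simps = hom closed zero [symmetric] alg_hom_one [OF f, symmetric]
  have ag: "abelian_group B"
  proof (rule abelian_groupI)
    fix x y z assume "x \<in> carrier B" "y \<in> carrier B" "z \<in> carrier B"
    then obtain x' y' z' where [simp]: "x' \<in> carrier A" "x = f x'" "y' \<in> carrier A" "y = f y'"
      "z' \<in> carrier A" "z = f z'" by (metis pre)
    show "x \<oplus>\<^bsub>B\<^esub> y \<in> carrier B" by (simp add: simps)
    show "x \<oplus>\<^bsub>B\<^esub> y \<oplus>\<^bsub>B\<^esub> z = x \<oplus>\<^bsub>B\<^esub> (y \<oplus>\<^bsub>B\<^esub> z)" by (simp add: simps A.a_assoc)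
    show "x \<oplus>\<^bsub>B\<^esub> y = y \<oplus>\<^bsub>B\<^esub> x" by (simp add: simps A.a_comm)
    show "\<zero>\<^bsub>B\<^esub> \<oplus>\<^bsub>B\<^esub> x = x" by (simp add: simps)
    have "f (\<ominus>\<^bsub>A\<^esub> x') \<oplus>\<^bsub>B\<^esub> x = \<zero>\<^bsub>B\<^esub>" by (simp add: simps A.l_neg)
    then show "\<exists>y\<in>carrier B. y \<oplus>\<^bsub>B\<^esub> x = \<zero>\<^bsub>B\<^esub>" using closed by force
  qed (simp add: simps)
  have "ring B"
  proof (rule ringI [OF ag])
    show "Group.monoid B"
    proof (rule Group.monoidI)
      fix x y z assume "x \<in> carrier B" "y \<in> carrier B" "z \<in> carrier B"
      then obtain x' y' z' where [simp]: "x' \<in> carrier A" "x = f x'" "y' \<in> carrier A" "y = f y'"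
        "z' \<in> carrier A" "z = f z'" by (metis pre)
      show "x \<otimes>\<^bsub>B\<^esub> y \<in> carrier B" by (simp add: simps)
      show "x \<otimes>\<^bsub>B\<^esub> y \<otimes>\<^bsub>B\<^esub> z = x \<otimes>\<^bsub>B\<^esub> (y \<otimes>\<^bsub>B\<^esub> z)" by (simp add: simps A.m_assoc)
      show "\<one>\<^bsub>B\<^esub> \<otimes>\<^bsub>B\<^esub> x = x" "x \<otimes>\<^bsub>B\<^esub> \<one>\<^bsub>B\<^esub> = x" by (simp_all add: simps)
    qed (simp add: simps)
    fix x y z assume "x \<in> carrier B" "y \<in> carrier B" "z \<in> carrier B"
    then obtain x' y' z' where [simp]: "x' \<in> carrier A" "x = f x'" "y' \<in> carrier A" "y = f y'"
      "z' \<in> carrier A" "z = f z'" by (metis pre)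
    show "(x \<oplus>\<^bsub>B\<^esub> y) \<otimes>\<^bsub>B\<^esub> z = x \<otimes>\<^bsub>B\<^esub> z \<oplus>\<^bsub>B\<^esub> y \<otimes>\<^bsub>B\<^esub> z" by (simp add: simps A.l_distr)
    show "z \<otimes>\<^bsub>B\<^esub> (x \<oplus>\<^bsub>B\<^esub> y) = z \<otimes>\<^bsub>B\<^esub> x \<oplus>\<^bsub>B\<^esub> z \<otimes>\<^bsub>B\<^esub> y" by (simp add: simps A.r_distr)
  qed
  moreover have "Module.module rat_ring B"
  proof (rule Module.moduleI [OF cring_rat_ring ag])
    fix q r x y assume "x \<in> carrier B" "y \<in> carrier B"
    then obtain x' y' where [simp]: "x' \<in> carrier A" "x = f x'" "y' \<in> carrier A" "y = f y'"
      by (metis pre)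
    note s = rat_algebra_smult [OF A] rat_algebra_smult_add [OF A]
    show "q \<odot>\<^bsub>B\<^esub> x \<in> carrier B" by (simp add: simps s)
    show "(q \<oplus>\<^bsub>rat_ring\<^esub> r) \<odot>\<^bsub>B\<^esub> x = q \<odot>\<^bsub>B\<^esub> x \<oplus>\<^bsub>B\<^esub> r \<odot>\<^bsub>B\<^esub> x" by (simp add: simps s)
    show "q \<odot>\<^bsub>B\<^esub> (x \<oplus>\<^bsub>B\<^esub> y) = q \<odot>\<^bsub>B\<^esub> x \<oplus>\<^bsub>B\<^esub> q \<odot>\<^bsub>B\<^esub> y" by (simp add: simps s)
    show "(q \<otimes>\<^bsub>rat_ring\<^esub> r) \<odot>\<^bsub>B\<^esub> x = q \<odot>\<^bsub>B\<^esub> (r \<odot>\<^bsub>B\<^esub> x)" by (simp add: simps s)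
    show "\<one>\<^bsub>rat_ring\<^esub> \<odot>\<^bsub>B\<^esub> x = x" by (simp add: simps s)
  qed
  moreover have "(q \<odot>\<^bsub>B\<^esub> x) \<otimes>\<^bsub>B\<^esub> y = q \<odot>\<^bsub>B\<^esub> (x \<otimes>\<^bsub>B\<^esub> y) \<and>
      x \<otimes>\<^bsub>B\<^esub> (q \<odot>\<^bsub>B\<^esub> y) = q \<odot>\<^bsub>B\<^esub> (x \<otimes>\<^bsub>B\<^esub> y)"
    if xy: "x \<in> carrier B" "y \<in> carrier B" for q x y
  proof -
    obtain x' y' where [simp]: "x' \<in> carrier A" "x = f x'" "y' \<in> carrier A" "y = f y'"
      using xy by (metis pre)
    show ?thesis by (simp add: simps rat_algebra_smult [OF A] rat_algebra_mult_smult [OF A])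
  qed
  ultimately show ?thesis unfolding rat_algebra_def by blast
qed

lemma rat_algebra_subalgebra:
  assumes A: "rat_algebra A" and H: "H \<subseteq> carrier A" "\<one>\<^bsub>A\<^esub> \<in> H"
    and add: "\<And>x y. x \<in> H \<Longrightarrow> y \<in> H \<Longrightarrow> x \<oplus>\<^bsub>A\<^esub> y \<in> H"
    and mult: "\<And>x y. x \<in> H \<Longrightarrow> y \<in> H \<Longrightarrow> x \<otimes>\<^bsub>A\<^esub> y \<in> H"
    and smult: "\<And>q x. x \<in> H \<Longrightarrow> q \<odot>\<^bsub>A\<^esub> x \<in> H"
  shows "rat_algebra (A\<lparr>carrier := H\<rparr>)"
proof -
  interpret A: ring A using rat_algebraD(1) A .
  let ?B = "A\<lparr>carrier := H\<rparr>"
  have in_A [simp]: "x \<in> carrier A" if "x \<in> H" for x using that H by blast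
  note s = rat_algebra_smult [OF A] rat_algebra_smult_add [OF A]
  have zero: "\<zero>\<^bsub>A\<^esub> \<in> H" using smult [of "\<one>\<^bsub>A\<^esub>" 0] s(5) H(2) by auto
  have ag: "abelian_group ?B"
  proof (rule abelian_groupI)
    fix x assume x: "x \<in> carrier ?B"
    have "(- 1 + 1) \<odot>\<^bsub>A\<^esub> x = (- 1) \<odot>\<^bsub>A\<^esub> x \<oplus>\<^bsub>A\<^esub> 1 \<odot>\<^bsub>A\<^esub> x"
      using s(2) [of x "- 1" 1] x by simp
    then have "(- 1) \<odot>\<^bsub>A\<^esub> x \<oplus>\<^bsub>A\<^esub> x = \<zero>\<^bsub>A\<^esub>" using x s(4,5) [of x] by simp
    then show "\<exists>y\<in>carrier ?B. y \<oplus>\<^bsub>?B\<^esub> x = \<zero>\<^bsub>?B\<^esub>" using smult x by force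
  qed (auto simp: add zero A.a_ac)
  have "ring ?B"
    by (rule ringI [OF ag]) (auto intro!: Group.monoidI simp: mult H A.m_assoc A.l_distr A.r_distr)
  moreover have "Module.module rat_ring ?B"
    by (rule Module.moduleI [OF cring_rat_ring ag]) (auto simp: smult s)
  ultimately show ?thesis
    unfolding rat_algebra_def using rat_algebra_mult_smult [OF A] by simp
qed

section \<open>Linear combinations\<close>

text \<open>A fixed finite index set \<open>J\<close> makes combinations with different supports comparable.\<close>

lemma lincomb_superset:
  assumes A: "rat_algebra A" and J: "finite J" "Poly_Mapping.keys c \<subseteq> J" "v ` J \<subseteq> carrier A"
  shows "lincomb A v c = (\<Oplus>\<^bsub>A\<^esub>i\<in>J. Poly_Mapping.lookup c i \<odot>\<^bsub>A\<^esub> v i)"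
proof -
  interpret abelian_monoid A using rat_algebraD(4) A .
  have in_A: "v i \<in> carrier A" if "i \<in> J" for i using J that by blast
  have "(\<Oplus>\<^bsub>A\<^esub>i\<in>J. Poly_Mapping.lookup c i \<odot>\<^bsub>A\<^esub> v i) =
      (\<Oplus>\<^bsub>A\<^esub>i\<in>Poly_Mapping.keys c. Poly_Mapping.lookup c i \<odot>\<^bsub>A\<^esub> v i)"
  proof (rule add.finprod_mono_neutral_cong_right)
    fix i assume "i \<in> J - Poly_Mapping.keys c"
    then show "Poly_Mapping.lookup c i \<odot>\<^bsub>A\<^esub> v i = \<zero>\<^bsub>A\<^esub>"
      using in_A rat_algebra_smult(5) [OF A] by (simp add: in_keys_iff)
  qed (use J in_A rat_algebra_smult(1) [OF A] in auto)
  then show ?thesis by (simp add: lincomb_def)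
qed

lemma lincomb_closed:
  assumes A: "rat_algebra A" and v: "v ` Poly_Mapping.keys c \<subseteq> carrier A"
  shows "lincomb A v c \<in> carrier A"
proof -
  interpret abelian_monoid A using rat_algebraD(4) A .
  have "v i \<in> carrier A" if "i \<in> Poly_Mapping.keys c" for i using v that by blast
  then show ?thesis unfolding lincomb_def
    by (intro finsum_closed) (auto intro!: rat_algebra_smult(1) [OF A])
qed

lemma lincomb_zero:
  assumes A: "rat_algebra A"
  shows "lincomb A v 0 = \<zero>\<^bsub>A\<^esub>"
proof -
  interpret abelian_monoid A using rat_algebraD(4) A .
  show ?thesis by (simp add: lincomb_def)
qed

lemma lincomb_single:
  assumes A: "rat_algebra A" and v: "v i \<in> carrier A"
  shows "lincomb A v (Poly_Mapping.single i q) = q \<odot>\<^bsub>A\<^esub> v i"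
proof -
  interpret abelian_monoid A using rat_algebraD(4) A .
  show ?thesis
    using rat_algebra_smult(1) [OF A v]
    by (subst lincomb_superset [OF A, of "{i}"]) (auto simp: v)
qed

lemma lincomb_add:
  assumes A: "rat_algebra A" and v: "v ` Poly_Mapping.keys c \<subseteq> carrier A"
    "v ` Poly_Mapping.keys d \<subseteq> carrier A"
  shows "lincomb A v (c + d) = lincomb A v c \<oplus>\<^bsub>A\<^esub> lincomb A v d"
proof -
  interpret abelian_monoid A using rat_algebraD(4) A .
  let ?J = "Poly_Mapping.keys c \<union> Poly_Mapping.keys d"
  have in_A: "v i \<in> carrier A" if "i \<in> ?J" for i using v that by blast
  have J: "finite ?J" "v ` ?J \<subseteq> carrier A" using v by auto
  have k: "Poly_Mapping.keys (c + d) \<subseteq> ?J" by (rule Poly_Mapping.keys_add)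
  have "lincomb A v (c + d) =
      (\<Oplus>\<^bsub>A\<^esub>i\<in>?J. Poly_Mapping.lookup c i \<odot>\<^bsub>A\<^esub> v i \<oplus>\<^bsub>A\<^esub> Poly_Mapping.lookup d i \<odot>\<^bsub>A\<^esub> v i)"
    unfolding lincomb_superset [OF A J(1) k J(2)]
    by (rule add.finprod_cong')
      (auto simp: lookup_add in_A rat_algebra_smult [OF A] intro!: rat_algebra_closed [OF A])
  also have "\<dots> = lincomb A v c \<oplus>\<^bsub>A\<^esub> lincomb A v d"
    unfolding lincomb_superset [OF A J(1) Un_upper1 J(2)] lincomb_superset [OF A J(1) Un_upper2 J(2)]
    by (rule finsum_addf) (auto simp: in_A rat_algebra_smult [OF A])
  finally show ?thesis .
qed

lemma lincomb_scale:
  assumes A: "rat_algebra A" and v: "v ` Poly_Mapping.keys c \<subseteq> carrier A"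
  shows "lincomb A v (Poly_Mapping.map ((*) q) c) = q \<odot>\<^bsub>A\<^esub> lincomb A v c"
proof -
  interpret Module.module rat_ring A using rat_algebraD(2) A .
  have in_A: "v i \<in> carrier A" if "i \<in> Poly_Mapping.keys c" for i using v that by blast
  have "lincomb A v (Poly_Mapping.map ((*) q) c) =
      (\<Oplus>\<^bsub>A\<^esub>i\<in>Poly_Mapping.keys c. q \<odot>\<^bsub>A\<^esub> (Poly_Mapping.lookup c i \<odot>\<^bsub>A\<^esub> v i))"
    unfolding lincomb_superset [OF A finite_keys keys_scale v]
    by (rule M.finsum_cong') (auto simp: in_A rat_algebra_smult [OF A])
  also have "\<dots> = q \<odot>\<^bsub>A\<^esub> lincomb A v c"
    unfolding lincomb_def
    by (rule finsum_smult_ldistr [symmetric]) (auto simp: in_A rat_algebra_smult [OF A])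
  finally show ?thesis .
qed

lemma keys_sum_subset: "(\<And>x. x \<in> X \<Longrightarrow> Poly_Mapping.keys (c x) \<subseteq> J) \<Longrightarrow>
    Poly_Mapping.keys (\<Sum>x\<in>X. c x) \<subseteq> J"
proof (induction X rule: infinite_finite_induct)
  case (insert x X)
  then show ?case using Poly_Mapping.keys_add [of "c x" "sum c X"] by auto
qed auto

lemma lincomb_sum:
  assumes A: "rat_algebra A" and X: "finite X"
    and v: "\<And>x. x \<in> X \<Longrightarrow> v ` Poly_Mapping.keys (c x) \<subseteq> carrier A"
  shows "lincomb A v (\<Sum>x\<in>X. c x) = (\<Oplus>\<^bsub>A\<^esub>x\<in>X. lincomb A v (c x))"
  using X v
proof (induction X)
  case empty
  interpret abelian_monoid A using rat_algebraD(4) A .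
  show ?case by (simp add: lincomb_zero [OF A])
next
  case (insert x X)
  interpret abelian_monoid A using rat_algebraD(4) A .
  let ?J = "v -` carrier A"
  have "Poly_Mapping.keys (\<Sum>x\<in>X. c x) \<subseteq> ?J"
    by (rule keys_sum_subset) (use insert.prems in auto)
  then have "lincomb A v (\<Sum>x\<in>insert x X. c x) =
      lincomb A v (c x) \<oplus>\<^bsub>A\<^esub> lincomb A v (\<Sum>x\<in>X. c x)"
    using insert by (simp add: lincomb_add [OF A] image_subset_iff_subset_vimage)
  also have "\<dots> = (\<Oplus>\<^bsub>A\<^esub>x\<in>insert x X. lincomb A v (c x))"
    by (subst finsum_insert)
      (use insert.hyps insert.IH [OF insert.prems] in \<open>auto intro!: lincomb_closed [OF A insert.prems]\<close>)
  finally show ?case .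
qed

text \<open>The linear extension of a map between index sets.\<close>

definition push :: "('i \<Rightarrow> 'j) \<Rightarrow> ('i \<Rightarrow>\<^sub>0 rat) \<Rightarrow> ('j \<Rightarrow>\<^sub>0 rat)" where
  "push \<kappa> c = (\<Sum>i\<in>Poly_Mapping.keys c. Poly_Mapping.single (\<kappa> i) (Poly_Mapping.lookup c i))"

lemma pairing_push: "pairing (push \<kappa> c) t = pairing c (\<lambda>i. t (\<kappa> i))"
  by (simp add: push_def pairing_sum) (simp add: pairing_def)

lemma lookup_eq_pairing: "Poly_Mapping.lookup c k = pairing c (\<lambda>i. of_bool (i = k))"
proof -
  have "pairing c (\<lambda>i. of_bool (i = k)) =
      (\<Sum>i\<in>Poly_Mapping.keys c. if i = k then Poly_Mapping.lookup c i else 0)"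
    unfolding pairing_def by (rule sum.cong) auto
  then show ?thesis by (simp add: sum.delta in_keys_iff)
qed

lemma poly_mapping_eq_by_pairing: "(\<And>t. pairing c t = pairing d t) \<Longrightarrow> c = d"
  by (rule poly_mapping_eqI) (simp add: lookup_eq_pairing)

lemma pairing_cong: "(\<And>i. i \<in> Poly_Mapping.keys c \<Longrightarrow> t i = u i) \<Longrightarrow> pairing c t = pairing c u"
  unfolding pairing_def by (rule sum.cong) auto

lemma keys_push: "Poly_Mapping.keys (push \<kappa> c) \<subseteq> \<kappa> ` Poly_Mapping.keys c"
  unfolding push_def by (rule keys_sum_subset) auto

lemma push_push_inverse:
  assumes "\<And>i. i \<in> Poly_Mapping.keys c \<Longrightarrow> \<kappa> (\<iota> i) = i"
  shows "push \<kappa> (push \<iota> c) = c"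
  by (rule poly_mapping_eq_by_pairing) (use assms in \<open>auto simp: pairing_push intro: pairing_cong\<close>)

lemma lincomb_push:
  assumes A: "rat_algebra A" and v: "\<And>i. i \<in> Poly_Mapping.keys c \<Longrightarrow> v (\<kappa> i) \<in> carrier A"
  shows "lincomb A v (push \<kappa> c) = lincomb A (\<lambda>i. v (\<kappa> i)) c"
proof -
  interpret abelian_monoid A using rat_algebraD(4) A .
  have "lincomb A v (push \<kappa> c) = (\<Oplus>\<^bsub>A\<^esub>i\<in>Poly_Mapping.keys c.
      lincomb A v (Poly_Mapping.single (\<kappa> i) (Poly_Mapping.lookup c i)))"
    unfolding push_def by (rule lincomb_sum [OF A]) (use v in auto)
  also have "\<dots> = lincomb A (\<lambda>i. v (\<kappa> i)) c"
    unfolding lincomb_def [of A "\<lambda>i. v (\<kappa> i)"]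
    by (rule add.finprod_cong') (auto simp: lincomb_single [OF A] v rat_algebra_smult [OF A])
  finally show ?thesis .
qed

lemma hom_lincomb:
  assumes A: "rat_algebra A" and B: "rat_algebra B" and f: "f \<in> alg_hom A B"
    and v: "v ` Poly_Mapping.keys c \<subseteq> carrier A"
  shows "f (lincomb A v c) = lincomb B (\<lambda>i. f (v i)) c"
proof -
  interpret A: ring A using rat_algebraD(1) A .
  interpret B: ring B using rat_algebraD(1) B .
  interpret ring_hom_ring A B f
    by (rule ring_hom_ringI2) (use f in \<open>auto simp: alg_hom_def A.ring_axioms B.ring_axioms\<close>)
  have in_A: "v i \<in> carrier A" if "i \<in> Poly_Mapping.keys c" for i using v that by blast
  have "f (lincomb A v c) = (\<Oplus>\<^bsub>B\<^esub>i\<in>Poly_Mapping.keys c. f (Poly_Mapping.lookup c i \<odot>\<^bsub>A\<^esub> v i))"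
    unfolding lincomb_def
    by (subst hom_finsum) (auto simp: in_A rat_algebra_smult [OF A] comp_def)
  also have "\<dots> = lincomb B (\<lambda>i. f (v i)) c"
    unfolding lincomb_def
    by (rule B.add.finprod_cong') (auto simp: in_A alg_homD [OF f] rat_algebra_smult [OF B])
  finally show ?thesis .
qed

text \<open>The product of formal combinations for given products \<open>E i j\<close> of basis elements. Both the
  multiplication of \<open>A_cyc\<close> and that of the series \<open>Fcyc\<close> are of this form.\<close>

definition bilinear_ext :: "('i \<Rightarrow> 'j \<Rightarrow> ('k \<Rightarrow>\<^sub>0 rat)) \<Rightarrow> ('i \<Rightarrow>\<^sub>0 rat) \<Rightarrow> ('j \<Rightarrow>\<^sub>0 rat) \<Rightarrow> ('k \<Rightarrow>\<^sub>0 rat)" where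
  "bilinear_ext E c d = (\<Sum>i\<in>Poly_Mapping.keys c. \<Sum>j\<in>Poly_Mapping.keys d.
     Poly_Mapping.map ((*) (Poly_Mapping.lookup c i * Poly_Mapping.lookup d j)) (E i j))"

lemma pairing_bilinear_ext:
  "pairing (bilinear_ext E c d) t = pairing c (\<lambda>i. pairing d (\<lambda>j. pairing (E i j) t))"
  by (simp add: bilinear_ext_def pairing_sum pairing_scale)
    (simp add: pairing_def sum_distrib_left mult.assoc)

lemma keys_bilinear_ext:
  assumes "\<And>i j. i \<in> Poly_Mapping.keys c \<Longrightarrow> j \<in> Poly_Mapping.keys d \<Longrightarrow> Poly_Mapping.keys (E i j) \<subseteq> J"
  shows "Poly_Mapping.keys (bilinear_ext E c d) \<subseteq> J"
  unfolding bilinear_ext_def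
  by (intro keys_sum_subset) (rule subset_trans [OF keys_scale assms])

lemma lincomb_bilinear_ext:
  assumes A: "rat_algebra A"
    and v: "v ` Poly_Mapping.keys c \<subseteq> carrier A" "u ` Poly_Mapping.keys d \<subseteq> carrier A"
    and E: "\<And>i j. i \<in> Poly_Mapping.keys c \<Longrightarrow> j \<in> Poly_Mapping.keys d \<Longrightarrow>
      w ` Poly_Mapping.keys (E i j) \<subseteq> carrier A \<and> lincomb A w (E i j) = v i \<otimes>\<^bsub>A\<^esub> u j"
  shows "lincomb A w (bilinear_ext E c d) = lincomb A v c \<otimes>\<^bsub>A\<^esub> lincomb A u d"
proof -
  interpret ring A using rat_algebraD(1) A .
  note s = rat_algebra_smult [OF A]
  have vA: "v i \<in> carrier A" if "i \<in> Poly_Mapping.keys c" for i using v that by blast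
  have uA: "u j \<in> carrier A" if "j \<in> Poly_Mapping.keys d" for j using v that by blast
  let ?q = "\<lambda>i j. Poly_Mapping.lookup c i * Poly_Mapping.lookup d j"
  have E': "w ` Poly_Mapping.keys (Poly_Mapping.map ((*) q) (E i j)) \<subseteq> carrier A"
    if "i \<in> Poly_Mapping.keys c" "j \<in> Poly_Mapping.keys d" for q i j
    using E [OF that] keys_scale [of q "E i j"] by blast
  have inner: "w ` Poly_Mapping.keys (\<Sum>j\<in>Poly_Mapping.keys d. Poly_Mapping.map ((*) (?q i j)) (E i j))
      \<subseteq> carrier A" if "i \<in> Poly_Mapping.keys c" for i
    unfolding image_subset_iff_subset_vimage
    by (rule keys_sum_subset) (use E' that in \<open>simp add: image_subset_iff_subset_vimage\<close>)
  have "lincomb A w (bilinear_ext E c d) = (\<Oplus>\<^bsub>A\<^esub>i\<in>Poly_Mapping.keys c.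
      lincomb A w (\<Sum>j\<in>Poly_Mapping.keys d. Poly_Mapping.map ((*) (?q i j)) (E i j)))"
    unfolding bilinear_ext_def by (rule lincomb_sum [OF A finite_keys inner])
  also have "\<dots> = (\<Oplus>\<^bsub>A\<^esub>i\<in>Poly_Mapping.keys c. \<Oplus>\<^bsub>A\<^esub>j\<in>Poly_Mapping.keys d.
      lincomb A w (Poly_Mapping.map ((*) (?q i j)) (E i j)))"
    by (intro add.finprod_cong' refl Pi_I finsum_closed lincomb_sum [OF A finite_keys E']
      lincomb_closed [OF A E'])
  also have "\<dots> = (\<Oplus>\<^bsub>A\<^esub>i\<in>Poly_Mapping.keys c. \<Oplus>\<^bsub>A\<^esub>j\<in>Poly_Mapping.keys d.
      (Poly_Mapping.lookup c i \<odot>\<^bsub>A\<^esub> v i) \<otimes>\<^bsub>A\<^esub> (Poly_Mapping.lookup d j \<odot>\<^bsub>A\<^esub> u j))"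
    by (intro add.finprod_cong' refl Pi_I finsum_closed)
      (auto simp: E lincomb_scale [OF A] s(1) s(3) [symmetric] mult.commute vA uA
        rat_algebra_mult_smult [OF A])
  also have "\<dots> = lincomb A v c \<otimes>\<^bsub>A\<^esub> lincomb A u d"
  proof -
    have "(\<Oplus>\<^bsub>A\<^esub>j\<in>Poly_Mapping.keys d.
        (Poly_Mapping.lookup c i \<odot>\<^bsub>A\<^esub> v i) \<otimes>\<^bsub>A\<^esub> (Poly_Mapping.lookup d j \<odot>\<^bsub>A\<^esub> u j)) =
        (Poly_Mapping.lookup c i \<odot>\<^bsub>A\<^esub> v i) \<otimes>\<^bsub>A\<^esub> lincomb A u d" if "i \<in> Poly_Mapping.keys c" for i
      unfolding lincomb_def by (rule finsum_rdistr [symmetric]) (use that in \<open>auto simp: s vA uA\<close>)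
    moreover have "lincomb A u d \<in> carrier A" using lincomb_closed [OF A] v by blast
    ultimately show ?thesis
      unfolding lincomb_def [of A v]
      by (subst finsum_ldistr) (auto simp: s vA intro!: add.finprod_cong')
  qed
  finally show ?thesis .
qed

lemma basis_reindex:
  assumes A: "rat_algebra A" and v: "is_basis A v J" and \<theta>: "bij_betw \<theta> I J"
  shows "is_basis A (\<lambda>i. v (\<theta> i)) I"
proof -
  have inA: "v (\<theta> i) \<in> carrier A" if "i \<in> I" for i
    using v \<theta> that by (auto simp: is_basis_def bij_betw_def)
  have push: "lincomb A v (push \<theta> c) = lincomb A (\<lambda>i. v (\<theta> i)) c"
      "Poly_Mapping.keys (push \<theta> c) \<subseteq> J"
    if "Poly_Mapping.keys c \<subseteq> I" for c
  proof -
    show "lincomb A v (push \<theta> c) = lincomb A (\<lambda>i. v (\<theta> i)) c"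
      using that inA by (intro lincomb_push [OF A]) auto
    show "Poly_Mapping.keys (push \<theta> c) \<subseteq> J"
      using that \<theta> keys_push [of \<theta> c] unfolding bij_betw_def by blast
  qed
  have inj: "the_inv_into I \<theta> (\<theta> i) = i" if "i \<in> I" for i
    using \<theta> that by (simp add: bij_betw_def the_inv_into_f_f)
  have indep: "c = 0" if "Poly_Mapping.keys c \<subseteq> I" "lincomb A (\<lambda>i. v (\<theta> i)) c = \<zero>\<^bsub>A\<^esub>" for c
  proof -
    have "push \<theta> c = 0" using v push that unfolding is_basis_def by metis
    then have "push (the_inv_into I \<theta>) (push \<theta> c) = 0" by (simp add: push_def)
    moreover have "push (the_inv_into I \<theta>) (push \<theta> c) = c"
      by (rule push_push_inverse) (use inj that in blast)
    ultimately show ?thesis by simp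
  qed
  have "lin_span A (\<lambda>i. v (\<theta> i)) I = lin_span A v J"
  proof
    show "lin_span A (\<lambda>i. v (\<theta> i)) I \<subseteq> lin_span A v J"
    proof
      fix x assume "x \<in> lin_span A (\<lambda>i. v (\<theta> i)) I"
      then obtain c where c: "x = lincomb A (\<lambda>i. v (\<theta> i)) c" "Poly_Mapping.keys c \<subseteq> I"
        by (auto simp: lin_span_def)
      then have "x = lincomb A v (push \<theta> c)" using push(1) [OF c(2)] by simp
      then show "x \<in> lin_span A v J"
        unfolding lin_span_def mem_Collect_eq using push(2) [OF c(2)] by metis
    qed
    show "lin_span A v J \<subseteq> lin_span A (\<lambda>i. v (\<theta> i)) I"
    proof
      fix x assume "x \<in> lin_span A v J"
      then obtain d where d: "x = lincomb A v d" "Poly_Mapping.keys d \<subseteq> J"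
        by (auto simp: lin_span_def)
      let ?c = "push (the_inv_into I \<theta>) d"
      have "the_inv_into I \<theta> ` J \<subseteq> I"
        using \<theta> by (auto simp: bij_betw_def the_inv_into_into)
      then have c: "Poly_Mapping.keys ?c \<subseteq> I"
        using keys_push [of "the_inv_into I \<theta>" d] d(2) by blast
      have "push \<theta> ?c = d"
        by (rule push_push_inverse) (use d(2) \<theta> in \<open>auto simp: bij_betw_def f_the_inv_into_f\<close>)
      then show "x \<in> lin_span A (\<lambda>i. v (\<theta> i)) I"
        unfolding lin_span_def mem_Collect_eq using push(1) [OF c] c d(1) by metis
    qed
  qed
  then show ?thesis
    using v indep inA unfolding is_basis_def by auto
qed

text \<open>The operations are conjugated by the injection, and its image inherits the axioms by
  \<open>rat_algebra_image\<close>.\<close>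

lemma transport_algebra:
  fixes A :: "(rat, 'a) module"
  assumes A: "rat_algebra A" and inj: "inj_on g (carrier A)"
  obtains B :: "(rat, 'v) module" where "rat_algebra B" "g \<in> alg_iso A B"
    "\<And>(v :: 'i \<Rightarrow> 'a) I. is_basis A v I \<Longrightarrow> is_basis B (\<lambda>i. g (v i)) I"
proof -
  define h where "h = the_inv_into (carrier A) g"
  have h: "h (g x) = x" if "x \<in> carrier A" for x
    using that inj by (simp add: h_def the_inv_into_f_f)
  define B where "B = \<lparr>carrier = g ` carrier A, mult = \<lambda>x y. g (h x \<otimes>\<^bsub>A\<^esub> h y), one = g \<one>\<^bsub>A\<^esub>,
    zero = g \<zero>\<^bsub>A\<^esub>, add = \<lambda>x y. g (h x \<oplus>\<^bsub>A\<^esub> h y), smult = \<lambda>q x. g (q \<odot>\<^bsub>A\<^esub> h x)\<rparr>"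
  have hom: "g \<in> alg_hom A B"
    by (rule alg_homI) (auto simp: B_def h)
  have B: "rat_algebra B"
    by (rule rat_algebra_image [OF A hom]) (auto simp: B_def)
  have "g \<in> alg_iso A B"
    using hom inj by (auto simp: alg_iso_def bij_betw_def B_def)
  moreover have "is_basis B (\<lambda>i. g (v i)) I" if v: "is_basis A v I" for v :: "'i \<Rightarrow> 'a" and I
  proof -
    have lc: "g (lincomb A v c) = lincomb B (\<lambda>i. g (v i)) c" and lcA: "lincomb A v c \<in> carrier A"
      if "Poly_Mapping.keys c \<subseteq> I" for c
    proof -
      have "v ` Poly_Mapping.keys c \<subseteq> carrier A" using v that by (auto simp: is_basis_def)
      then show "g (lincomb A v c) = lincomb B (\<lambda>i. g (v i)) c" "lincomb A v c \<in> carrier A"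
        using hom_lincomb [OF A B hom] lincomb_closed [OF A] by auto
    qed
    have "c = 0" if c: "Poly_Mapping.keys c \<subseteq> I" "lincomb B (\<lambda>i. g (v i)) c = \<zero>\<^bsub>B\<^esub>" for c
    proof -
      have "g (lincomb A v c) = g \<zero>\<^bsub>A\<^esub>" using lc c by (simp add: B_def)
      then have "lincomb A v c = \<zero>\<^bsub>A\<^esub>"
        using inj lcA c(1) rat_algebra_const_closed(1) [OF A] by (auto dest: inj_onD)
      then show ?thesis using v c(1) by (simp add: is_basis_def)
    qed
    moreover have "lin_span B (\<lambda>i. g (v i)) I = g ` lin_span A v I"
    proof -
      have "lin_span B (\<lambda>i. g (v i)) I = (\<lambda>c. lincomb B (\<lambda>i. g (v i)) c) ` {c. Poly_Mapping.keys c \<subseteq> I}"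
        unfolding lin_span_def by blast
      also have "\<dots> = (\<lambda>c. g (lincomb A v c)) ` {c. Poly_Mapping.keys c \<subseteq> I}"
        by (rule image_cong) (auto simp: lc)
      also have "\<dots> = g ` lin_span A v I" unfolding lin_span_def by blast
      finally show ?thesis .
    qed
    ultimately show ?thesis
      using v by (auto simp: is_basis_def B_def)
  qed
  ultimately show ?thesis using that B by blast
qed

section \<open>The algebra of cyclic quasisymmetric functions\<close>

lemma PS_simps [simp]: "carrier PS = UNIV" "zero PS = (\<lambda>m. 0)"
  "one PS = (\<lambda>m. if m = 0 then 1 else 0)" "add PS = (\<lambda>f g m. f m + g m)"
  "smult PS = (\<lambda>q f m. q * f m)"
  by (simp_all add: PS_def)

lemma PS_mult: "(f \<otimes>\<^bsub>PS\<^esub> g) m = (\<Sum>(a, b)\<in>{(a, b). a + b = m}. f a * g b)"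
  by (simp add: PS_def)

text \<open>Both sides are sums over the factorizations of \<open>m\<close> into three monomials.\<close>

lemma PS_mult_assoc: "(f \<otimes>\<^bsub>PS\<^esub> g) \<otimes>\<^bsub>PS\<^esub> h = f \<otimes>\<^bsub>PS\<^esub> (g \<otimes>\<^bsub>PS\<^esub> h)"
proof
  fix m :: "nat \<Rightarrow>\<^sub>0 nat"
  let ?S = "\<lambda>m::nat \<Rightarrow>\<^sub>0 nat. {(a, b). a + b = m}"
  have "((f \<otimes>\<^bsub>PS\<^esub> g) \<otimes>\<^bsub>PS\<^esub> h) m =
      (\<Sum>p\<in>?S m. \<Sum>q\<in>?S (fst p). f (fst q) * g (snd q) * h (snd p))"
    by (simp add: PS_mult case_prod_beta sum_distrib_right)
  also have "\<dots> = (\<Sum>(p, q)\<in>(SIGMA p:?S m. ?S (fst p)). f (fst q) * g (snd q) * h (snd p))"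
    by (rule sum.Sigma) (auto simp: finite_monomial_splits)
  also have "\<dots> = (\<Sum>(p, q)\<in>(SIGMA p:?S m. ?S (snd p)). f (fst p) * (g (fst q) * h (snd q)))"
    by (rule sum.reindex_bij_witness
        [where i = "\<lambda>(p, q). ((fst p + fst q, snd q), (fst p, fst q))"
          and j = "\<lambda>(p, q). ((fst q, snd q + snd p), (snd q, snd p))"])
      (auto simp: add.assoc mult.assoc)
  also have "\<dots> = (\<Sum>p\<in>?S m. \<Sum>q\<in>?S (snd p). f (fst p) * (g (fst q) * h (snd q)))"
    by (rule sum.Sigma [symmetric]) (auto simp: finite_monomial_splits)
  also have "\<dots> = (f \<otimes>\<^bsub>PS\<^esub> (g \<otimes>\<^bsub>PS\<^esub> h)) m"
    by (simp add: PS_mult case_prod_beta sum_distrib_left)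
  finally show "((f \<otimes>\<^bsub>PS\<^esub> g) \<otimes>\<^bsub>PS\<^esub> h) m = (f \<otimes>\<^bsub>PS\<^esub> (g \<otimes>\<^bsub>PS\<^esub> h)) m" .
qed

lemma PS_mult_comm: "f \<otimes>\<^bsub>PS\<^esub> g = g \<otimes>\<^bsub>PS\<^esub> f"
proof
  fix m :: "nat \<Rightarrow>\<^sub>0 nat"
  show "(f \<otimes>\<^bsub>PS\<^esub> g) m = (g \<otimes>\<^bsub>PS\<^esub> f) m"
    unfolding PS_mult
    by (rule sum.reindex_bij_witness [where i = "\<lambda>(a, b). (b, a)" and j = "\<lambda>(a, b). (b, a)"])
      (auto simp: add.commute mult.commute)
qed

lemma PS_mult_one: "\<one>\<^bsub>PS\<^esub> \<otimes>\<^bsub>PS\<^esub> f = f"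
proof
  fix m :: "nat \<Rightarrow>\<^sub>0 nat"
  have "(\<one>\<^bsub>PS\<^esub> \<otimes>\<^bsub>PS\<^esub> f) m = (\<Sum>(a, b)\<in>{(0, m)}. \<one>\<^bsub>PS\<^esub> a * f b)"
    unfolding PS_mult
    by (rule sum.mono_neutral_right) (auto simp: finite_monomial_splits split: if_splits)
  then show "(\<one>\<^bsub>PS\<^esub> \<otimes>\<^bsub>PS\<^esub> f) m = f m" by simp
qed

text \<open>The multiplication is commutative, so one distributive law suffices.\<close>

lemma rat_algebra_PS: "rat_algebra PS"
proof -
  have ag: "abelian_group PS"
    by (rule abelian_groupI) (auto simp: algebra_simps intro!: exI [of _ "\<lambda>m. - x m" for x])
  have "cring PS"
  proof (rule cringI [OF ag])
    show "comm_monoid PS"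
      by (rule comm_monoidI) (simp, simp, rule PS_mult_assoc, rule PS_mult_one, rule PS_mult_comm)
    fix f g h
    show "(f \<oplus>\<^bsub>PS\<^esub> g) \<otimes>\<^bsub>PS\<^esub> h = f \<otimes>\<^bsub>PS\<^esub> h \<oplus>\<^bsub>PS\<^esub> g \<otimes>\<^bsub>PS\<^esub> h"
      by (rule ext) (simp add: PS_mult case_prod_beta algebra_simps sum.distrib)
  qed
  moreover have "Module.module rat_ring PS"
    by (rule Module.moduleI [OF cring_rat_ring ag]) (auto simp: algebra_simps)
  moreover have "(q \<odot>\<^bsub>PS\<^esub> f) \<otimes>\<^bsub>PS\<^esub> g = q \<odot>\<^bsub>PS\<^esub> (f \<otimes>\<^bsub>PS\<^esub> g)"
    "f \<otimes>\<^bsub>PS\<^esub> (q \<odot>\<^bsub>PS\<^esub> g) = q \<odot>\<^bsub>PS\<^esub> (f \<otimes>\<^bsub>PS\<^esub> g)" for q f g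
    by (rule ext, simp add: PS_mult case_prod_beta sum_distrib_left algebra_simps)+
  ultimately show ?thesis
    unfolding rat_algebra_def by (auto simp: cring.axioms(1) simp del: PS_simps)
qed

lemma lincomb_PS: "lincomb PS v c m = pairing c (\<lambda>i. v i m)"
proof -
  interpret abelian_monoid PS using rat_algebraD(4) [OF rat_algebra_PS] .
  have "finite J \<Longrightarrow> (\<Oplus>\<^bsub>PS\<^esub>i\<in>J. g i) m = (\<Sum>i\<in>J. g i m)" for J and g :: "'a \<Rightarrow> power_series"
    by (induction J rule: finite_induct) auto
  then show ?thesis by (simp add: lincomb_def pairing_def)
qed

abbreviation non_Escher_pairs :: "(nat \<times> nat set) set" where
  "non_Escher_pairs \<equiv> {(n, S). non_Escher n S}"

lemma cDes_in_non_Escher_pairs: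
  "is_perm \<pi> \<Longrightarrow> (length \<pi>, cDes \<pi>) \<in> non_Escher_pairs"
  by (auto simp: non_Escher_def)

lemma perm_index_in_non_Escher_pairs:
  assumes "is_perm \<pi>"
  shows "perm_index (cyc \<pi>) \<in> non_Escher_pairs"
proof -
  obtain \<rho> where "\<rho> \<in> cyc \<pi>" "perm_index (cyc \<pi>) = (length \<rho>, cDes \<rho>)"
    by (metis perm_indexE)
  then show ?thesis using cDes_in_non_Escher_pairs is_perm_in_cyc assms by metis
qed

text \<open>Raising all letters of \<open>\<sigma>\<close> above those of \<open>\<pi>\<close> does not change the comparisons between them.\<close>

lemma disjoint_perms:
  assumes "is_perm \<pi>" "is_perm \<sigma>"
  obtains \<sigma>' where "is_perm \<sigma>'" "perm_disjoint \<pi> \<sigma>'" "length \<sigma>' = length \<sigma>" "cDes \<sigma>' = cDes \<sigma>"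
proof
  define N where "N = Max (insert 0 (set \<pi>))"
  let ?s = "map (\<lambda>x. x + N) \<sigma>"
  show "is_perm ?s" using assms(2) by (auto simp: is_perm_def distinct_map inj_on_def)
  have "x \<le> N" if "x \<in> set \<pi>" for x using that by (simp add: N_def)
  moreover have "x > N" if "x \<in> set ?s" for x using that assms(2) by (auto simp: is_perm_def)
  ultimately show "perm_disjoint \<pi> ?s" unfolding perm_disjoint_def by (meson disjoint_iff not_le)
  show "length ?s = length \<sigma>" by simp
  have "?s ! (i - 1) > ?s ! (i mod length \<sigma>) \<longleftrightarrow> \<sigma> ! (i - 1) > \<sigma> ! (i mod length \<sigma>)"
    if "i \<in> {1..length \<sigma>}" for i
  proof -
    have "0 < length \<sigma>" "i - 1 < length \<sigma>" using that by auto
    moreover from this have "i mod length \<sigma> < length \<sigma>" by simp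
    ultimately show ?thesis by simp
  qed
  then show "cDes ?s = cDes \<sigma>" unfolding cDes_def length_map by blast
qed

definition shuffle_indices :: "nat list \<Rightarrow> nat list \<Rightarrow> (nat \<times> nat set \<Rightarrow>\<^sub>0 rat)" where
  "shuffle_indices \<pi> \<sigma> = (\<Sum>T\<in>cSh (cyc \<pi>) (cyc \<sigma>). Poly_Mapping.single (perm_index T) 1)"

lemma keys_shuffle_indices:
  assumes "is_perm \<pi>" "is_perm \<sigma>" "perm_disjoint \<pi> \<sigma>"
  shows "Poly_Mapping.keys (shuffle_indices \<pi> \<sigma>) \<subseteq> non_Escher_pairs"
  unfolding shuffle_indices_def
proof (rule keys_sum_subset)
  fix T assume "T \<in> cSh (cyc \<pi>) (cyc \<sigma>)"
  then obtain \<tau> where "T = cyc \<tau>" "is_perm \<tau>" using cShE [OF assms] by metis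
  then show "Poly_Mapping.keys (Poly_Mapping.single (perm_index T) (1::rat)) \<subseteq> non_Escher_pairs"
    using perm_index_in_non_Escher_pairs by simp
qed

lemma Fcyc_mult_lincomb:
  assumes "is_perm \<pi>" "is_perm \<sigma>" "perm_disjoint \<pi> \<sigma>"
  shows "lincomb PS Fcyc_at (shuffle_indices \<pi> \<sigma>) =
    Fcyc (length \<pi>) (cDes \<pi>) \<otimes>\<^bsub>PS\<^esub> Fcyc (length \<sigma>) (cDes \<sigma>)"
  by (rule ext) (simp add: lincomb_PS shuffle_indices_def pairing_sum Fcyc_mult [OF assms])

lemma ex_disjoint_perms_at:
  assumes "i \<in> non_Escher_pairs" "j \<in> non_Escher_pairs"
  shows "\<exists>r. is_perm (fst r) \<and> is_perm (snd r) \<and> perm_disjoint (fst r) (snd r) \<and>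
    (length (fst r), cDes (fst r)) = i \<and> (length (snd r), cDes (snd r)) = j"
proof -
  have "\<exists>\<pi>. is_perm \<pi> \<and> (length \<pi>, cDes \<pi>) = k" if "k \<in> non_Escher_pairs" for k
    using that by (cases k) (auto simp: non_Escher_def)
  then obtain \<pi> \<sigma> where p: "is_perm \<pi>" "(length \<pi>, cDes \<pi>) = i"
    and s: "is_perm \<sigma>" "(length \<sigma>, cDes \<sigma>) = j"
    using assms by metis
  obtain \<sigma>' where "is_perm \<sigma>'" "perm_disjoint \<pi> \<sigma>'" "length \<sigma>' = length \<sigma>" "cDes \<sigma>' = cDes \<sigma>"
    by (rule disjoint_perms [OF p(1) s(1)])
  with p s show ?thesis by (intro exI [of _ "(\<pi>, \<sigma>')"]) simp
qed

text \<open>The product of the series at two index pairs, as a formal combination of index pairs. It is read off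
  from an arbitrary pair of disjoint permutations with these cyclic descent sets.\<close>

definition index_product :: "nat \<times> nat set \<Rightarrow> nat \<times> nat set \<Rightarrow> (nat \<times> nat set \<Rightarrow>\<^sub>0 rat)" where
  "index_product i j =
    (let r = SOME r. is_perm (fst r) \<and> is_perm (snd r) \<and> perm_disjoint (fst r) (snd r) \<and>
      (length (fst r), cDes (fst r)) = i \<and> (length (snd r), cDes (snd r)) = j
     in shuffle_indices (fst r) (snd r))"

lemma index_productE:
  assumes "i \<in> non_Escher_pairs" "j \<in> non_Escher_pairs"
  obtains \<pi> \<sigma> where "is_perm \<pi>" "is_perm \<sigma>" "perm_disjoint \<pi> \<sigma>" "(length \<pi>, cDes \<pi>) = i"
    "(length \<sigma>, cDes \<sigma>) = j" "index_product i j = shuffle_indices \<pi> \<sigma>"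
  using someI_ex [OF ex_disjoint_perms_at [OF assms]] that
  unfolding index_product_def Let_def by blast

lemma keys_index_product:
  assumes "i \<in> non_Escher_pairs" "j \<in> non_Escher_pairs"
  shows "Poly_Mapping.keys (index_product i j) \<subseteq> non_Escher_pairs"
  by (rule index_productE [OF assms]) (metis keys_shuffle_indices)

lemma lincomb_index_product:
  assumes "i \<in> non_Escher_pairs" "j \<in> non_Escher_pairs"
  shows "lincomb PS Fcyc_at (index_product i j) = Fcyc_at i \<otimes>\<^bsub>PS\<^esub> Fcyc_at j"
proof (rule index_productE [OF assms])
  fix \<pi> \<sigma>
  assume "is_perm \<pi>" "is_perm \<sigma>" "perm_disjoint \<pi> \<sigma>" and i: "(length \<pi>, cDes \<pi>) = i"
    and j: "(length \<sigma>, cDes \<sigma>) = j" and "index_product i j = shuffle_indices \<pi> \<sigma>"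
  then show ?thesis
    unfolding i [symmetric] j [symmetric] by (simp add: Fcyc_mult_lincomb)
qed

lemma Fcyc_lincomb_mult:
  assumes "Poly_Mapping.keys c \<subseteq> non_Escher_pairs" "Poly_Mapping.keys d \<subseteq> non_Escher_pairs"
  shows "lincomb PS Fcyc_at (bilinear_ext index_product c d) =
      lincomb PS Fcyc_at c \<otimes>\<^bsub>PS\<^esub> lincomb PS Fcyc_at d"
    "Poly_Mapping.keys (bilinear_ext index_product c d) \<subseteq> non_Escher_pairs"
proof -
  have i: "i \<in> non_Escher_pairs" if "i \<in> Poly_Mapping.keys c" for i using assms(1) that by blast
  have j: "j \<in> non_Escher_pairs" if "j \<in> Poly_Mapping.keys d" for j using assms(2) that by blast
  show "lincomb PS Fcyc_at (bilinear_ext index_product c d) =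
      lincomb PS Fcyc_at c \<otimes>\<^bsub>PS\<^esub> lincomb PS Fcyc_at d"
  proof (rule lincomb_bilinear_ext [OF rat_algebra_PS])
    fix k l assume "k \<in> Poly_Mapping.keys c" "l \<in> Poly_Mapping.keys d"
    then show "Fcyc_at ` Poly_Mapping.keys (index_product k l) \<subseteq> carrier PS \<and>
        lincomb PS Fcyc_at (index_product k l) = Fcyc_at k \<otimes>\<^bsub>PS\<^esub> Fcyc_at l"
      using lincomb_index_product [OF i j] by simp
  qed simp_all
  show "Poly_Mapping.keys (bilinear_ext index_product c d) \<subseteq> non_Escher_pairs"
    by (rule keys_bilinear_ext) (rule keys_index_product [OF i j])
qed

lemma cQSym_minus_simps [simp]:
  "carrier cQSym_minus = lin_span PS Fcyc_at non_Escher_pairs"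
  "mult cQSym_minus = mult PS" "one cQSym_minus = one PS" "zero cQSym_minus = zero PS"
  "add cQSym_minus = add PS" "smult cQSym_minus = smult PS"
  by (simp_all add: cQSym_minus_def)

lemma Fcyc_Nil: "Fcyc 0 {} = \<one>\<^bsub>PS\<^esub>"
  by (simp add: Fcyc_def)

lemma non_Escher_Nil: "(0, {}) \<in> non_Escher_pairs"
  using cDes_in_non_Escher_pairs [of "[]"] by (simp add: is_perm_def cDes_def)

lemma Fcyc_at_in_span: "i \<in> non_Escher_pairs \<Longrightarrow> Fcyc_at i \<in> lin_span PS Fcyc_at non_Escher_pairs"
proof -
  assume "i \<in> non_Escher_pairs"
  moreover have "lincomb PS Fcyc_at (Poly_Mapping.single i 1) = Fcyc_at i"
    by (rule ext) (simp add: lincomb_PS)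
  moreover have "Poly_Mapping.keys (Poly_Mapping.single i (1::rat)) = {i}" by simp
  ultimately show ?thesis unfolding lin_span_def by (metis (mono_tags, lifting) CollectI empty_subsetI insert_subset)
qed

lemma rat_algebra_cQSym_minus: "rat_algebra cQSym_minus"
  unfolding cQSym_minus_def
proof (rule rat_algebra_subalgebra [OF rat_algebra_PS])
  let ?H = "lin_span PS Fcyc_at non_Escher_pairs"
  have I: "f \<in> ?H" if "f = lincomb PS Fcyc_at c" "Poly_Mapping.keys c \<subseteq> non_Escher_pairs" for f c
    using that unfolding lin_span_def by blast
  show "\<one>\<^bsub>PS\<^esub> \<in> ?H" using Fcyc_at_in_span [OF non_Escher_Nil] Fcyc_Nil by simp
  fix f g assume "f \<in> ?H" "g \<in> ?H"
  then obtain c d where c: "f = lincomb PS Fcyc_at c" "Poly_Mapping.keys c \<subseteq> non_Escher_pairs"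
    and d: "g = lincomb PS Fcyc_at d" "Poly_Mapping.keys d \<subseteq> non_Escher_pairs"
    by (auto simp: lin_span_def)
  show "f \<oplus>\<^bsub>PS\<^esub> g \<in> ?H"
  proof (rule I)
    show "f \<oplus>\<^bsub>PS\<^esub> g = lincomb PS Fcyc_at (c + d)"
      by (rule ext) (simp add: c d lincomb_PS pairing_add)
    show "Poly_Mapping.keys (c + d) \<subseteq> non_Escher_pairs"
      using c(2) d(2) by (intro subset_trans [OF Poly_Mapping.keys_add]) simp
  qed
  show "q \<odot>\<^bsub>PS\<^esub> f \<in> ?H" for q
  proof (rule I)
    show "q \<odot>\<^bsub>PS\<^esub> f = lincomb PS Fcyc_at (Poly_Mapping.map ((*) q) c)"
      by (rule ext) (simp add: c lincomb_PS pairing_scale)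
    show "Poly_Mapping.keys (Poly_Mapping.map ((*) q) c) \<subseteq> non_Escher_pairs"
      using keys_scale c(2) by (rule subset_trans)
  qed
  show "f \<otimes>\<^bsub>PS\<^esub> g \<in> ?H"
    using Fcyc_lincomb_mult [OF c(2) d(2)] by (intro I) (simp_all add: c(1) d(1))
qed simp

lemma lincomb_cQSym_minus:
  assumes "Poly_Mapping.keys c \<subseteq> non_Escher_pairs"
  shows "lincomb cQSym_minus Fcyc_at c = lincomb PS Fcyc_at c"
proof -
  interpret P: abelian_monoid PS using rat_algebraD(4) [OF rat_algebra_PS] .
  interpret Q: abelian_monoid cQSym_minus using rat_algebraD(4) [OF rat_algebra_cQSym_minus] .
  have "finite J \<Longrightarrow> g ` J \<subseteq> carrier cQSym_minus \<Longrightarrow> finsum cQSym_minus g J = finsum PS g J"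
    for J and g :: "nat \<times> nat set \<Rightarrow> power_series"
  proof (induction J rule: finite_induct)
    case (insert i J)
    then have "g \<in> J \<rightarrow> carrier cQSym_minus" "g i \<in> carrier cQSym_minus" by blast+
    moreover have "g \<in> J \<rightarrow> carrier PS" "g i \<in> carrier PS" by simp_all
    ultimately show ?case
      using insert by (simp add: Q.finsum_insert P.finsum_insert del: cQSym_minus_simps(1) PS_simps)
  qed simp
  moreover have "(\<lambda>i. Poly_Mapping.lookup c i \<odot>\<^bsub>cQSym_minus\<^esub> Fcyc_at i) ` Poly_Mapping.keys c \<subseteq>
      carrier cQSym_minus"
  proof (rule image_subsetI)
    fix i assume "i \<in> Poly_Mapping.keys c"
    then have "Fcyc_at i \<in> carrier cQSym_minus"
      using assms Fcyc_at_in_span by auto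
    then show "Poly_Mapping.lookup c i \<odot>\<^bsub>cQSym_minus\<^esub> Fcyc_at i \<in> carrier cQSym_minus"
      by (rule rat_algebra_smult(1) [OF rat_algebra_cQSym_minus])
  qed
  ultimately show ?thesis unfolding lincomb_def by simp
qed

section \<open>Classes of cyclic permutations and of cyclic compositions\<close>

lemma sum_list_differences:
  "sorted (x # xs) \<Longrightarrow> sum_list (map2 (-) xs (x # xs)) = last (x # xs) - (x :: nat)"
proof (induction xs arbitrary: x)
  case (Cons y ys)
  then have "sum_list (map2 (-) ys (y # ys)) = last (y # ys) - y" by simp
  moreover have "y \<le> last (y # ys)" using Cons.prems by (cases ys) (auto simp: last_in_set)
  ultimately show ?case using Cons.prems by simp
qed simp

text \<open>The first \<open>j - 1\<close> parts telescope to \<open>s\<^sub>j - s\<^sub>1\<close>, and the last part is \<open>n - s\<^sub>j + s\<^sub>1\<close>. Hence the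
  relation between compositions, which compares sizes, compares the lengths of permutations.\<close>

lemma sum_list_cComp:
  assumes "non_Escher n S"
  shows "sum_list (cComp n S) = n"
proof (cases "n \<le> 1")
  case True
  then show ?thesis by (auto simp: cComp_def le_Suc_eq)
next
  case False
  let ?s = "sorted_list_of_set S"
  have fin: "finite S" using non_Escher_subset [OF assms] finite_subset by blast
  moreover have "S \<noteq> {}" using non_Escher_nonempty [OF assms] False by simp
  ultimately have "?s \<noteq> []" by simp
  then obtain x xs where s: "?s = x # xs" by (cases ?s) auto
  have srt: "sorted (x # xs)" by (metis s sorted_sorted_list_of_set)
  have "set (x # xs) = S" using fin s by (metis set_sorted_list_of_set)
  then have "last (x # xs) \<le> n"
    using non_Escher_subset [OF assms] last_in_set [of "x # xs"] by (metis atLeastAtMost_iff list.distinct(1) subsetD)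
  moreover have "x \<le> last (x # xs)" using srt by (cases xs) (auto simp: last_in_set)
  ultimately show ?thesis
    using False sum_list_differences [OF srt] by (simp add: cComp_def s Let_def)
qed

lemma perm_class_eq:
  assumes "is_perm \<pi>"
  shows "perm_class cst (cyc \<pi>) =
    {cyc \<sigma> | \<sigma>. is_perm \<sigma> \<and> cst (cyc \<pi>) = cst (cyc \<sigma>) \<and> length \<pi> = length \<sigma>}" (is "?l = ?r")
proof
  show "?r \<subseteq> ?l" using assms by (auto simp: perm_class_def perm_equiv_def)
  show "?l \<subseteq> ?r"
  proof
    fix P assume "P \<in> ?l"
    then obtain \<pi>' \<sigma> where "cyc \<pi> = cyc \<pi>'" "P = cyc \<sigma>" "is_perm \<sigma>" "cst (cyc \<pi>') = cst (cyc \<sigma>)"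
        "length \<pi>' = length \<sigma>"
      by (auto simp: perm_class_def perm_equiv_def)
    moreover from this have "length \<pi> = length \<pi>'" using cyc_eq_iff length_in_cyc by blast
    ultimately show "P \<in> ?r" by auto
  qed
qed

lemma perm_class_eq_iff:
  assumes "is_perm \<pi>" "is_perm \<sigma>"
  shows "perm_class cst (cyc \<pi>) = perm_class cst (cyc \<sigma>) \<longleftrightarrow>
    cst (cyc \<pi>) = cst (cyc \<sigma>) \<and> length \<pi> = length \<sigma>"
proof
  assume "perm_class cst (cyc \<pi>) = perm_class cst (cyc \<sigma>)"
  then have "cyc \<pi> \<in> perm_class cst (cyc \<sigma>)" using assms by (auto simp: perm_class_eq)
  then obtain \<rho> where "cyc \<pi> = cyc \<rho>" "cst (cyc \<sigma>) = cst (cyc \<rho>)" "length \<sigma> = length \<rho>"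
    using assms by (auto simp: perm_class_eq)
  then show "cst (cyc \<pi>) = cst (cyc \<sigma>) \<and> length \<pi> = length \<sigma>"
    using cyc_eq_iff length_in_cyc by metis
qed (simp add: perm_class_eq assms)

lemma perm_classes_eq: "perm_classes cst = {perm_class cst (cyc \<pi>) | \<pi>. is_perm \<pi>}"
  by (auto simp: perm_classes_def quotient_def perm_class_def)

lemma cst_comp_cComp_perm:
  assumes "cyclic_descent_statistic cst" "is_perm \<pi>"
  shows "cst_comp cst (cComp_perm \<pi>) = cst (cyc \<pi>)"
proof -
  let ?P = "\<lambda>\<sigma>. is_perm \<sigma> \<and> cComp_perm \<sigma> = cComp_perm \<pi>"
  have "?P (SOME \<sigma>. ?P \<sigma>)" by (rule someI [of ?P \<pi>]) (simp add: assms)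
  then show ?thesis
    using assms unfolding cst_comp_def cyclic_descent_statistic_def by blast
qed

lemma non_Escher_comps_eq: "non_Escher_comps = {cComp_perm \<pi> | \<pi>. is_perm \<pi>}"
  unfolding non_Escher_comps_def non_Escher_def cComp_perm_def by blast

definition comp_class :: "(nat list set \<Rightarrow> 'b) \<Rightarrow> nat list set \<Rightarrow> nat list set set" where
  "comp_class cst C = comp_equiv cst `` {C}"

text \<open>Like the equivalence of permutations, the equivalence of compositions compares the value of the
  statistic and the size. This gives the bijection between the two kinds of classes.\<close>

lemma mem_comp_class_iff:
  assumes "cyclic_descent_statistic cst" "is_perm \<pi>" "is_perm \<sigma>"
  shows "cComp_perm \<sigma> \<in> comp_class cst (cComp_perm \<pi>) \<longleftrightarrow>
    cst (cyc \<pi>) = cst (cyc \<sigma>) \<and> length \<pi> = length \<sigma>"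
proof -
  have s: "sum_list L = length \<rho>" if "cyc L = cComp_perm \<rho>" "is_perm \<rho>" for L \<rho>
  proof -
    have "L \<in> cyc (cComp (length \<rho>) (cDes \<rho>))"
      using that(1) cyc_eq_iff unfolding cComp_perm_def by blast
    then show ?thesis
      using cDes_in_non_Escher_pairs [OF that(2)] by (simp add: sum_list_in_cyc sum_list_cComp)
  qed
  note cst = cst_comp_cComp_perm [OF assms(1,2)] cst_comp_cComp_perm [OF assms(1,3)]
  show ?thesis
  proof
    assume "cComp_perm \<sigma> \<in> comp_class cst (cComp_perm \<pi>)"
    then obtain L M where L: "cyc L = cComp_perm \<pi>" "cyc M = cComp_perm \<sigma>" "sum_list L = sum_list M"
        and "cst_comp cst (cComp_perm \<pi>) = cst_comp cst (cComp_perm \<sigma>)"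
      unfolding comp_class_def comp_equiv_def by auto
    then show "cst (cyc \<pi>) = cst (cyc \<sigma>) \<and> length \<pi> = length \<sigma>"
      using s [OF L(1) assms(2)] s [OF L(2) assms(3)] cst by simp
  next
    assume eq: "cst (cyc \<pi>) = cst (cyc \<sigma>) \<and> length \<pi> = length \<sigma>"
    let ?L = "\<lambda>\<rho>. cComp (length \<rho>) (cDes \<rho>)"
    have "sum_list (?L \<pi>) = sum_list (?L \<sigma>)"
      using s [of "?L \<pi>" \<pi>] s [of "?L \<sigma>" \<sigma>] assms(2,3) eq by (simp add: cComp_perm_def)
    moreover have "cyc (?L \<pi>) \<in> non_Escher_comps" "cyc (?L \<sigma>) \<in> non_Escher_comps"
      using assms(2,3) unfolding non_Escher_comps_eq cComp_perm_def by auto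
    moreover have "cst_comp cst (cyc (?L \<pi>)) = cst_comp cst (cyc (?L \<sigma>))"
      using cst eq by (simp add: cComp_perm_def)
    ultimately show "cComp_perm \<sigma> \<in> comp_class cst (cComp_perm \<pi>)"
      unfolding comp_class_def comp_equiv_def cComp_perm_def Image_singleton_iff by blast
  qed
qed

lemma comp_class_subset: "comp_class cst C \<subseteq> non_Escher_comps"
  by (auto simp: comp_class_def comp_equiv_def)

lemma comp_class_eq_iff:
  assumes "cyclic_descent_statistic cst" "is_perm \<pi>" "is_perm \<sigma>"
  shows "comp_class cst (cComp_perm \<pi>) = comp_class cst (cComp_perm \<sigma>) \<longleftrightarrow>
    cst (cyc \<pi>) = cst (cyc \<sigma>) \<and> length \<pi> = length \<sigma>"
proof
  assume "comp_class cst (cComp_perm \<pi>) = comp_class cst (cComp_perm \<sigma>)"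
  moreover have "cComp_perm \<sigma> \<in> comp_class cst (cComp_perm \<sigma>)"
    using mem_comp_class_iff assms by blast
  ultimately show "cst (cyc \<pi>) = cst (cyc \<sigma>) \<and> length \<pi> = length \<sigma>"
    using mem_comp_class_iff assms by blast
next
  assume eq: "cst (cyc \<pi>) = cst (cyc \<sigma>) \<and> length \<pi> = length \<sigma>"
  have "C \<in> comp_class cst (cComp_perm \<pi>) \<longleftrightarrow> C \<in> comp_class cst (cComp_perm \<sigma>)"
    if C: "C \<in> non_Escher_comps" for C
  proof -
    obtain \<rho> where "is_perm \<rho>" "C = cComp_perm \<rho>" using C unfolding non_Escher_comps_eq by auto
    then show ?thesis using mem_comp_class_iff [OF assms(1)] assms(2,3) eq by simp
  qed
  then show "comp_class cst (cComp_perm \<pi>) = comp_class cst (cComp_perm \<sigma>)"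
    using comp_class_subset by blast
qed

lemma comp_classes_eq: "comp_classes cst = {comp_class cst (cComp_perm \<pi>) | \<pi>. is_perm \<pi>}"
  by (auto simp: comp_classes_def quotient_def comp_class_def non_Escher_comps_eq)

lemma comp_class_unique:
  assumes "cyclic_descent_statistic cst" "is_perm \<pi>" "\<alpha> \<in> comp_classes cst" "cComp_perm \<pi> \<in> \<alpha>"
  shows "\<alpha> = comp_class cst (cComp_perm \<pi>)"
proof -
  obtain \<sigma> where "is_perm \<sigma>" "\<alpha> = comp_class cst (cComp_perm \<sigma>)"
    using assms(3) unfolding comp_classes_eq by auto
  then show ?thesis
    using assms mem_comp_class_iff [OF assms(1)] comp_class_eq_iff [OF assms(1)] by simp
qed

lemma ex_class_bijection:
  assumes "cyclic_descent_statistic cst"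
  obtains \<theta> where "bij_betw \<theta> (perm_classes cst) (comp_classes cst)"
    "\<And>\<pi>. is_perm \<pi> \<Longrightarrow> \<theta> (perm_class cst (cyc \<pi>)) = comp_class cst (cComp_perm \<pi>)"
proof -
  define \<theta> where "\<theta> a = comp_class cst (cComp_perm (SOME \<pi>. is_perm \<pi> \<and> perm_class cst (cyc \<pi>) = a))"
    for a
  have \<theta>: "\<theta> (perm_class cst (cyc \<pi>)) = comp_class cst (cComp_perm \<pi>)" if "is_perm \<pi>" for \<pi>
  proof -
    let ?P = "\<lambda>\<sigma>. is_perm \<sigma> \<and> perm_class cst (cyc \<sigma>) = perm_class cst (cyc \<pi>)"
    define \<sigma> where "\<sigma> = (SOME \<sigma>. ?P \<sigma>)"
    have s: "is_perm \<sigma>" "perm_class cst (cyc \<sigma>) = perm_class cst (cyc \<pi>)"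
      using someI [of ?P \<pi>] that by (auto simp: \<sigma>_def)
    have "\<theta> (perm_class cst (cyc \<pi>)) = comp_class cst (cComp_perm \<sigma>)"
      by (simp add: \<theta>_def \<sigma>_def)
    then show ?thesis
      using s(2) perm_class_eq_iff [OF s(1) that, of cst] comp_class_eq_iff [OF assms s(1) that]
      by simp
  qed
  have "bij_betw \<theta> (perm_classes cst) (comp_classes cst)"
  proof (rule bij_betw_imageI)
    show "inj_on \<theta> (perm_classes cst)"
    proof (rule inj_onI)
      fix a b assume "a \<in> perm_classes cst" "b \<in> perm_classes cst" and eq: "\<theta> a = \<theta> b"
      then obtain \<pi> \<sigma> where p: "is_perm \<pi>" "a = perm_class cst (cyc \<pi>)"
        and s: "is_perm \<sigma>" "b = perm_class cst (cyc \<sigma>)"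
        unfolding perm_classes_eq by blast
      show "a = b"
        using eq unfolding p(2) s(2) \<theta> [OF p(1)] \<theta> [OF s(1)]
        by (simp add: comp_class_eq_iff [OF assms p(1) s(1)] perm_class_eq_iff [OF p(1) s(1)])
    qed
    have "\<theta> ` perm_classes cst = (\<lambda>\<pi>. \<theta> (perm_class cst (cyc \<pi>))) ` {\<pi>. is_perm \<pi>}"
      unfolding perm_classes_eq by auto
    also have "\<dots> = (\<lambda>\<pi>. comp_class cst (cComp_perm \<pi>)) ` {\<pi>. is_perm \<pi>}"
      by (rule image_cong) (auto simp: \<theta>)
    also have "\<dots> = comp_classes cst" unfolding comp_classes_eq by blast
    finally show "\<theta> ` perm_classes cst = comp_classes cst" .
  qed
  then show ?thesis using \<theta> that by blast
qed

section \<open>Shuffle-compatibility\<close>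

definition pair_class :: "(nat list set \<Rightarrow> 'b) \<Rightarrow> nat \<times> nat set \<Rightarrow> nat list set set" where
  "pair_class cst i = perm_class cst (cyc (SOME \<pi>. is_perm \<pi> \<and> (length \<pi>, cDes \<pi>) = i))"

lemma perm_class_eq_if_cDes_eq:
  assumes cst: "cyclic_descent_statistic cst" and "is_perm \<pi>" "is_perm \<sigma>"
    and eq: "length \<pi> = length \<sigma>" "cDes \<pi> = cDes \<sigma>"
  shows "perm_class cst (cyc \<pi>) = perm_class cst (cyc \<sigma>)"
proof -
  have "cComp_perm \<pi> = cComp_perm \<sigma>" by (simp add: cComp_perm_def eq)
  then have "cst (cyc \<pi>) = cst (cyc \<sigma>)"
    using assms(2,3) cst unfolding cyclic_descent_statistic_def by blast
  then show ?thesis using perm_class_eq_iff [OF assms(2,3), of cst] eq(1) by simp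
qed

text \<open>A descent statistic does not distinguish permutations with the same cyclic descent set.\<close>

lemma pair_class_cDes:
  assumes cst: "cyclic_descent_statistic cst" and p: "is_perm \<pi>"
  shows "pair_class cst (length \<pi>, cDes \<pi>) = perm_class cst (cyc \<pi>)"
proof -
  let ?P = "\<lambda>\<sigma>. is_perm \<sigma> \<and> (length \<sigma>, cDes \<sigma>) = (length \<pi>, cDes \<pi>)"
  have "?P (SOME \<sigma>. ?P \<sigma>)" by (rule someI [of ?P \<pi>]) (simp add: p)
  then show ?thesis
    unfolding pair_class_def by (intro perm_class_eq_if_cDes_eq [OF cst]) (simp_all add: p)
qed

lemma pair_class_perm_index:
  assumes cst: "cyclic_descent_statistic cst" and p: "is_perm \<pi>"
  shows "pair_class cst (perm_index (cyc \<pi>)) = perm_class cst (cyc \<pi>)"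
proof -
  obtain \<rho> where r: "\<rho> \<in> cyc \<pi>" "cyc \<rho> = cyc \<pi>" "perm_index (cyc \<pi>) = (length \<rho>, cDes \<rho>)"
    by (rule perm_indexE)
  then have "is_perm \<rho>" using is_perm_in_cyc p by blast
  then show ?thesis using pair_class_cDes [OF cst] r by metis
qed

lemma pair_class_in_perm_classes:
  assumes cst: "cyclic_descent_statistic cst" and i: "i \<in> non_Escher_pairs"
  shows "pair_class cst i \<in> perm_classes cst"
proof -
  obtain \<pi> where "is_perm \<pi>" "i = (length \<pi>, cDes \<pi>)" using i by (auto simp: non_Escher_def)
  then show ?thesis using pair_class_cDes [OF cst] unfolding perm_classes_eq by auto
qed

text \<open>A shift of \<open>cDes \<pi>\<close> is the cyclic descent set of a rotation of \<open>\<pi>\<close>, which represents the same cyclic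
  permutation. This invariance is the hypothesis of \<open>Fcyc_relations\<close>.\<close>

lemma pair_class_cshift:
  assumes cst: "cyclic_descent_statistic cst" and S: "non_Escher n S" and i: "i \<in> {1..n}"
  shows "pair_class cst (n, cshift n S i) = pair_class cst (n, S)"
proof -
  obtain \<pi> where p: "is_perm \<pi>" "length \<pi> = n" "cDes \<pi> = S"
    using S by (auto simp: non_Escher_def)
  let ?r = "rotate (n - i) \<pi>"
  have "cDes ?r = cshift n S i" using cDes_rotate [of \<pi> "n - i"] i p by simp
  then have "pair_class cst (n, cshift n S i) = perm_class cst (cyc ?r)"
    using pair_class_cDes [OF cst, of ?r] p by simp
  also have "cyc ?r = cyc \<pi>" by (simp add: cyc_eq_iff)
  finally show ?thesis using pair_class_cDes [OF cst p(1)] p by simp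
qed

lemma perm_classes_disjointE:
  assumes cst: "cyclic_descent_statistic cst" and ab: "a \<in> perm_classes cst" "b \<in> perm_classes cst"
  obtains \<pi> \<sigma> where "is_perm \<pi>" "is_perm \<sigma>" "perm_disjoint \<pi> \<sigma>"
    "a = perm_class cst (cyc \<pi>)" "b = perm_class cst (cyc \<sigma>)"
proof -
  obtain \<pi> \<sigma> where p: "is_perm \<pi>" "a = perm_class cst (cyc \<pi>)"
    and s: "is_perm \<sigma>" "b = perm_class cst (cyc \<sigma>)"
    using ab unfolding perm_classes_eq by blast
  obtain \<sigma>' where s': "is_perm \<sigma>'" "perm_disjoint \<pi> \<sigma>'" "length \<sigma>' = length \<sigma>" "cDes \<sigma>' = cDes \<sigma>"
    by (rule disjoint_perms [OF p(1) s(1)])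
  then have "b = perm_class cst (cyc \<sigma>')"
    using perm_class_eq_if_cDes_eq [OF cst s'(1) s(1)] s(2) by simp
  then show ?thesis using that p s' by blast
qed

definition shuffle_classes :: "(nat list set \<Rightarrow> 'b) \<Rightarrow> nat list \<Rightarrow> nat list \<Rightarrow>
    (nat list set set \<Rightarrow>\<^sub>0 rat)" where
  "shuffle_classes cst \<pi> \<sigma> =
    (\<Sum>T\<in>cSh (cyc \<pi>) (cyc \<sigma>). Poly_Mapping.single (perm_class cst T) 1)"

lemma keys_shuffle_classes:
  assumes "is_perm \<pi>" "is_perm \<sigma>" "perm_disjoint \<pi> \<sigma>"
  shows "Poly_Mapping.keys (shuffle_classes cst \<pi> \<sigma>) \<subseteq> perm_classes cst"
  unfolding shuffle_classes_def
proof (rule keys_sum_subset)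
  fix T assume "T \<in> cSh (cyc \<pi>) (cyc \<sigma>)"
  then obtain \<tau> where "T = cyc \<tau>" "is_perm \<tau>" using cShE [OF assms] by metis
  then show "Poly_Mapping.keys (Poly_Mapping.single (perm_class cst T) (1::rat)) \<subseteq> perm_classes cst"
    unfolding perm_classes_eq by auto
qed

lemma push_shuffle_indices:
  assumes cst: "cyclic_descent_statistic cst" and ps: "is_perm \<pi>" "is_perm \<sigma>" "perm_disjoint \<pi> \<sigma>"
  shows "push (pair_class cst) (shuffle_indices \<pi> \<sigma>) = shuffle_classes cst \<pi> \<sigma>"
proof (rule poly_mapping_eq_by_pairing)
  fix t
  have "pair_class cst (perm_index T) = perm_class cst T" if T: "T \<in> cSh (cyc \<pi>) (cyc \<sigma>)" for T
    using cShE [OF ps T] pair_class_perm_index [OF cst] by metis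
  then show "pairing (push (pair_class cst) (shuffle_indices \<pi> \<sigma>)) t =
      pairing (shuffle_classes cst \<pi> \<sigma>) t"
    by (simp add: pairing_push shuffle_indices_def shuffle_classes_def pairing_sum)
qed

lemma sum_single_eq_iff:
  assumes "finite X" "finite Y"
  shows "(\<Sum>x\<in>X. Poly_Mapping.single (f x) (1::rat)) = (\<Sum>y\<in>Y. Poly_Mapping.single (f y) 1) \<longleftrightarrow>
    image_mset f (mset_set X) = image_mset f (mset_set Y)"
proof -
  have l: "Poly_Mapping.lookup (\<Sum>x\<in>Z. Poly_Mapping.single (f x) (1::rat)) k =
      of_nat (count (image_mset f (mset_set Z)) k)" if "finite Z" for Z k
    using that
  proof (induction Z rule: finite_induct)
    case (insert z Z)
    then show ?case by (simp add: lookup_add lookup_single when_def)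
  qed simp
  show ?thesis
    unfolding poly_mapping_eq_iff fun_eq_iff multiset_eq_iff l [OF assms(1)] l [OF assms(2)]
    by simp
qed

text \<open>All members of \<open>cSh\<close> have the same length, so the multiset of their classes and the multiset of their
  values of the statistic determine each other.\<close>

lemma cyclic_shuffle_compatible_iff:
  "cyclic_shuffle_compatible cst \<longleftrightarrow> (\<forall>\<pi> \<sigma> \<pi>' \<sigma>'.
    is_perm \<pi> \<and> is_perm \<sigma> \<and> perm_disjoint \<pi> \<sigma> \<and> is_perm \<pi>' \<and> is_perm \<sigma>' \<and> perm_disjoint \<pi>' \<sigma>' \<and>
    perm_class cst (cyc \<pi>) = perm_class cst (cyc \<pi>') \<and>
    perm_class cst (cyc \<sigma>) = perm_class cst (cyc \<sigma>') \<longrightarrow>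
    shuffle_classes cst \<pi> \<sigma> = shuffle_classes cst \<pi>' \<sigma>')"
proof -
  have key: "image_mset cst (mset_set (cSh (cyc \<pi>) (cyc \<sigma>))) =
        image_mset cst (mset_set (cSh (cyc \<pi>') (cyc \<sigma>'))) \<longleftrightarrow>
      shuffle_classes cst \<pi> \<sigma> = shuffle_classes cst \<pi>' \<sigma>'"
    if ps: "is_perm \<pi>" "is_perm \<sigma>" "perm_disjoint \<pi> \<sigma>" "is_perm \<pi>'" "is_perm \<sigma>'"
      "perm_disjoint \<pi>' \<sigma>'" and len: "length \<pi> = length \<pi>'" "length \<sigma> = length \<sigma>'" for \<pi> \<sigma> \<pi>' \<sigma>'
  proof -
    let ?M = "mset_set (cSh (cyc \<pi>) (cyc \<sigma>))" and ?M' = "mset_set (cSh (cyc \<pi>') (cyc \<sigma>'))"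
    define K where "K x = {cyc \<rho> | \<rho>. is_perm \<rho> \<and> x = cst (cyc \<rho>) \<and> length \<pi> + length \<sigma> = length \<rho>}"
      for x
    define val where "val a = cst (SOME P. P \<in> a)" for a
    have fin: "finite (cSh (cyc \<pi>) (cyc \<sigma>))" "finite (cSh (cyc \<pi>') (cyc \<sigma>'))"
      using finite_cSh ps by blast+
    have T: "\<exists>\<tau>. T = cyc \<tau> \<and> is_perm \<tau> \<and> length \<tau> = length \<pi> + length \<sigma>"
      if T: "T \<in># ?M \<or> T \<in># ?M'" for T
    proof -
      consider "T \<in> cSh (cyc \<pi>) (cyc \<sigma>)" | "T \<in> cSh (cyc \<pi>') (cyc \<sigma>')"
        using T fin by auto
      then show ?thesis
      proof cases
        case 1
        show ?thesis by (rule cShE [OF ps(1-3) 1]) blast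
      next
        case 2
        show ?thesis by (rule cShE [OF ps(4-6) 2]) (use len in auto)
      qed
    qed
    have K: "perm_class cst T = K (cst T)" and val: "val (perm_class cst T) = cst T"
      if Tm: "T \<in># ?M \<or> T \<in># ?M'" for T
    proof -
      obtain \<tau> where t: "T = cyc \<tau>" "is_perm \<tau>" "length \<tau> = length \<pi> + length \<sigma>"
        using T [OF Tm] by blast
      show "perm_class cst T = K (cst T)"
        unfolding t(1) perm_class_eq [OF t(2)] K_def t(3) by simp
      have "T \<in> perm_class cst T" unfolding t(1) perm_class_eq [OF t(2)] using t(2) by blast
      then have "(SOME P. P \<in> perm_class cst T) \<in> perm_class cst T" by (rule someI)
      moreover have "cst P = cst T" if "P \<in> perm_class cst T" for P
        using that unfolding t(1) perm_class_eq [OF t(2)] by auto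
      ultimately show "val (perm_class cst T) = cst T" unfolding val_def by blast
    qed
    have c1: "image_mset (perm_class cst) N = image_mset K (image_mset cst N)"
      and c2: "image_mset cst N = image_mset val (image_mset (perm_class cst) N)"
      if "N = ?M \<or> N = ?M'" for N
    proof -
      show "image_mset (perm_class cst) N = image_mset K (image_mset cst N)"
        unfolding multiset.map_comp comp_def by (rule image_mset_cong) (use K that in blast)
      show "image_mset cst N = image_mset val (image_mset (perm_class cst) N)"
        unfolding multiset.map_comp comp_def by (rule image_mset_cong) (use val that in metis)
    qed
    have "image_mset cst ?M = image_mset cst ?M' \<longleftrightarrow>
        image_mset (perm_class cst) ?M = image_mset (perm_class cst) ?M'"
      using c1 [of ?M] c1 [of ?M'] c2 [of ?M] c2 [of ?M'] by metis
    also have "\<dots> \<longleftrightarrow> shuffle_classes cst \<pi> \<sigma> = shuffle_classes cst \<pi>' \<sigma>'"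
      unfolding shuffle_classes_def using sum_single_eq_iff [OF fin] by blast
    finally show ?thesis .
  qed
  show ?thesis
    unfolding cyclic_shuffle_compatible_def
  proof (intro iff_allI)
    fix \<pi> \<sigma> \<pi>' \<sigma>'
    show "(is_perm \<pi> \<and> is_perm \<sigma> \<and> perm_disjoint \<pi> \<sigma> \<and> is_perm \<pi>' \<and> is_perm \<sigma>' \<and>
        perm_disjoint \<pi>' \<sigma>' \<and> cst (cyc \<pi>) = cst (cyc \<pi>') \<and> cst (cyc \<sigma>) = cst (cyc \<sigma>') \<and>
        length \<pi> = length \<pi>' \<and> length \<sigma> = length \<sigma>' \<longrightarrow>
        image_mset cst (mset_set (cSh (cyc \<pi>) (cyc \<sigma>))) =
        image_mset cst (mset_set (cSh (cyc \<pi>') (cyc \<sigma>')))) \<longleftrightarrow>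
      (is_perm \<pi> \<and> is_perm \<sigma> \<and> perm_disjoint \<pi> \<sigma> \<and> is_perm \<pi>' \<and> is_perm \<sigma>' \<and>
        perm_disjoint \<pi>' \<sigma>' \<and> perm_class cst (cyc \<pi>) = perm_class cst (cyc \<pi>') \<and>
        perm_class cst (cyc \<sigma>) = perm_class cst (cyc \<sigma>') \<longrightarrow>
        shuffle_classes cst \<pi> \<sigma> = shuffle_classes cst \<pi>' \<sigma>')"
      using key [of \<pi> \<sigma> \<pi>' \<sigma>'] perm_class_eq_iff [of \<pi> \<pi>' cst] perm_class_eq_iff [of \<sigma> \<sigma>' cst]
      by argo
  qed
qed

lemma class_mult_eq:
  assumes comp: "cyclic_shuffle_compatible cst" and ps: "is_perm \<pi>" "is_perm \<sigma>" "perm_disjoint \<pi> \<sigma>"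
  shows "class_mult cst (perm_class cst (cyc \<pi>)) (perm_class cst (cyc \<sigma>)) = shuffle_classes cst \<pi> \<sigma>"
proof -
  let ?P = "\<lambda>(\<pi>', \<sigma>'). is_perm \<pi>' \<and> is_perm \<sigma>' \<and> perm_disjoint \<pi>' \<sigma>' \<and>
    perm_class cst (cyc \<pi>') = perm_class cst (cyc \<pi>) \<and> perm_class cst (cyc \<sigma>') = perm_class cst (cyc \<sigma>)"
  obtain \<pi>' \<sigma>' where c: "(SOME r. ?P r) = (\<pi>', \<sigma>')" by (cases "SOME r. ?P r")
  have "?P (SOME r. ?P r)" by (rule someI [of ?P "(\<pi>, \<sigma>)"]) (simp add: ps)
  then have r: "is_perm \<pi>'" "is_perm \<sigma>'" "perm_disjoint \<pi>' \<sigma>'"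
      "perm_class cst (cyc \<pi>') = perm_class cst (cyc \<pi>)"
      "perm_class cst (cyc \<sigma>') = perm_class cst (cyc \<sigma>)"
    unfolding c by simp_all
  have "shuffle_classes cst \<pi>' \<sigma>' = shuffle_classes cst \<pi> \<sigma>"
    by (rule comp [unfolded cyclic_shuffle_compatible_iff, rule_format]) (intro conjI r ps)
  then show ?thesis
    unfolding class_mult_def c by (simp add: shuffle_classes_def)
qed

lemma A_cyc_simps [simp]:
  "carrier (A_cyc cst) = {f. Poly_Mapping.keys f \<subseteq> perm_classes cst}"
  "mult (A_cyc cst) = bilinear_ext (class_mult cst)"
  "one (A_cyc cst) = Poly_Mapping.single (perm_class cst (cyc [])) 1"
  "zero (A_cyc cst) = 0" "add (A_cyc cst) = (+)"
  "smult (A_cyc cst) = (\<lambda>q. Poly_Mapping.map ((*) q))"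
  by (auto simp: A_cyc_def bilinear_ext_def fun_eq_iff)

section \<open>From a shuffle-compatible statistic to a homomorphism\<close>

text \<open>The linear map that sends \<open>Fcyc n S\<close> to the class of \<open>(n, S)\<close>. As these series are not
  independent, it is defined through an arbitrary representation of its argument.\<close>

definition class_map :: "(nat list set \<Rightarrow> 'b) \<Rightarrow> power_series \<Rightarrow> (nat list set set \<Rightarrow>\<^sub>0 rat)" where
  "class_map cst f = push (pair_class cst)
    (SOME c. Poly_Mapping.keys c \<subseteq> non_Escher_pairs \<and> lincomb PS Fcyc_at c = f)"

text \<open>Two representations of the same series differ by a linear relation. Every functional \<open>t\<close> on the classes
  is invariant under shifts when read on the index pairs, so by \<open>Fcyc_relations\<close> it vanishes on this
  relation.\<close>

lemma class_map_lincomb: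
  assumes cst: "cyclic_descent_statistic cst" and c: "Poly_Mapping.keys c \<subseteq> non_Escher_pairs"
  shows "class_map cst (lincomb PS Fcyc_at c) = push (pair_class cst) c"
proof -
  let ?P = "\<lambda>d. Poly_Mapping.keys d \<subseteq> non_Escher_pairs \<and> lincomb PS Fcyc_at d = lincomb PS Fcyc_at c"
  define d where "d = (SOME d. ?P d)"
  have d: "?P d" unfolding d_def by (rule someI [of ?P c]) (simp add: c)
  have "push (pair_class cst) d = push (pair_class cst) c"
  proof (rule poly_mapping_eq_by_pairing)
    fix t
    have "pairing (d - c) (\<lambda>i. t (pair_class cst i)) = 0"
    proof (rule Fcyc_relations)
      show "Poly_Mapping.keys (d - c) \<subseteq> non_Escher_pairs"
      proof -
        have "Poly_Mapping.keys (d - c) \<subseteq> Poly_Mapping.keys d \<union> Poly_Mapping.keys c"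
          by (auto simp: in_keys_iff lookup_minus)
        then show ?thesis using c d by blast
      qed
      show "pairing (d - c) (\<lambda>i. Fcyc_at i m) = 0" for m
      proof -
        have "lincomb PS Fcyc_at d m = lincomb PS Fcyc_at c m" using d by simp
        then show ?thesis by (simp add: lincomb_PS pairing_minus)
      qed
      show "t (pair_class cst (n, cshift n S i)) = t (pair_class cst (n, S))"
        if "non_Escher n S" "i \<in> {1..n}" for n S i
        using pair_class_cshift [OF cst that] by simp
    qed
    then show "pairing (push (pair_class cst) d) t = pairing (push (pair_class cst) c) t"
      by (simp add: pairing_push pairing_minus)
  qed
  then show ?thesis unfolding class_map_def d_def .
qed

lemma class_map_Fcyc:
  assumes cst: "cyclic_descent_statistic cst" and p: "is_perm \<pi>"
  shows "class_map cst (Fcyc (length \<pi>) (cDes \<pi>)) = Poly_Mapping.single (perm_class cst (cyc \<pi>)) 1"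
proof -
  let ?c = "Poly_Mapping.single (length \<pi>, cDes \<pi>) (1::rat)"
  have "lincomb PS Fcyc_at ?c = Fcyc (length \<pi>) (cDes \<pi>)"
    by (rule ext) (simp add: lincomb_PS)
  moreover have "Poly_Mapping.keys ?c \<subseteq> non_Escher_pairs"
    using cDes_in_non_Escher_pairs [OF p] by simp
  ultimately have "class_map cst (Fcyc (length \<pi>) (cDes \<pi>)) = push (pair_class cst) ?c"
    using class_map_lincomb [OF cst, of ?c] by simp
  then show ?thesis by (simp add: push_def pair_class_cDes [OF cst p])
qed

lemma keys_push_pair_class:
  assumes cst: "cyclic_descent_statistic cst" and c: "Poly_Mapping.keys c \<subseteq> non_Escher_pairs"
  shows "Poly_Mapping.keys (push (pair_class cst) c) \<subseteq> perm_classes cst"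
proof -
  have "pair_class cst ` Poly_Mapping.keys c \<subseteq> perm_classes cst"
    using pair_class_in_perm_classes [OF cst] c by blast
  then show ?thesis using keys_push by (rule subset_trans [rotated])
qed

text \<open>The map is multiplicative because shuffle-compatibility makes \<open>class_mult\<close> agree with the product of
  the series for every choice of disjoint representatives.\<close>

lemma class_map_hom:
  assumes cst: "cyclic_descent_statistic cst" and comp: "cyclic_shuffle_compatible cst"
  shows "class_map cst \<in> alg_hom cQSym_minus (A_cyc cst)"
proof (rule alg_homI)
  note map = class_map_lincomb [OF cst]
  have E: "\<exists>c. f = lincomb PS Fcyc_at c \<and> Poly_Mapping.keys c \<subseteq> non_Escher_pairs"
    if "f \<in> carrier cQSym_minus" for f
    using that by (auto simp: lin_span_def)
  fix f g assume fg: "f \<in> carrier cQSym_minus" "g \<in> carrier cQSym_minus"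
  obtain c where c: "f = lincomb PS Fcyc_at c" "Poly_Mapping.keys c \<subseteq> non_Escher_pairs"
    using E [OF fg(1)] by blast
  obtain d where d: "g = lincomb PS Fcyc_at d" "Poly_Mapping.keys d \<subseteq> non_Escher_pairs"
    using E [OF fg(2)] by blast
  show "class_map cst f \<in> carrier (A_cyc cst)"
    using keys_push_pair_class [OF cst c(2)] by (simp add: c map)
  show "class_map cst (f \<oplus>\<^bsub>cQSym_minus\<^esub> g) = class_map cst f \<oplus>\<^bsub>A_cyc cst\<^esub> class_map cst g"
  proof -
    have "f \<oplus>\<^bsub>cQSym_minus\<^esub> g = lincomb PS Fcyc_at (c + d)"
      by (rule ext) (simp add: c d lincomb_PS pairing_add)
    moreover have "Poly_Mapping.keys (c + d) \<subseteq> non_Escher_pairs"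
      using c(2) d(2) by (intro subset_trans [OF Poly_Mapping.keys_add]) simp
    moreover have "push (pair_class cst) (c + d) = push (pair_class cst) c + push (pair_class cst) d"
      by (rule poly_mapping_eq_by_pairing) (simp add: pairing_push pairing_add)
    ultimately show ?thesis by (simp add: map c d)
  qed
  show "class_map cst (q \<odot>\<^bsub>cQSym_minus\<^esub> f) = q \<odot>\<^bsub>A_cyc cst\<^esub> class_map cst f" for q
  proof -
    have "q \<odot>\<^bsub>cQSym_minus\<^esub> f = lincomb PS Fcyc_at (Poly_Mapping.map ((*) q) c)"
      by (rule ext) (simp add: c lincomb_PS pairing_scale)
    moreover have "Poly_Mapping.keys (Poly_Mapping.map ((*) q) c) \<subseteq> non_Escher_pairs"
      using keys_scale c(2) by (rule subset_trans)
    moreover have "push (pair_class cst) (Poly_Mapping.map ((*) q) c) =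
        Poly_Mapping.map ((*) q) (push (pair_class cst) c)"
      by (rule poly_mapping_eq_by_pairing) (simp add: pairing_push pairing_scale)
    ultimately show ?thesis by (simp add: map c)
  qed
  show "class_map cst (f \<otimes>\<^bsub>cQSym_minus\<^esub> g) = class_map cst f \<otimes>\<^bsub>A_cyc cst\<^esub> class_map cst g"
  proof -
    have prod: "push (pair_class cst) (index_product i j) =
        class_mult cst (pair_class cst i) (pair_class cst j)"
      if ij: "i \<in> non_Escher_pairs" "j \<in> non_Escher_pairs" for i j
    proof (rule index_productE [OF ij])
      fix \<pi> \<sigma>
      assume ps: "is_perm \<pi>" "is_perm \<sigma>" "perm_disjoint \<pi> \<sigma>" and i: "(length \<pi>, cDes \<pi>) = i"
        and j: "(length \<sigma>, cDes \<sigma>) = j" and ip: "index_product i j = shuffle_indices \<pi> \<sigma>"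
      show ?thesis
        unfolding ip unfolding i [symmetric] j [symmetric]
        using ps by (simp add: push_shuffle_indices [OF cst] class_mult_eq [OF comp] pair_class_cDes [OF cst])
    qed
    have "push (pair_class cst) (bilinear_ext index_product c d) =
        bilinear_ext (class_mult cst) (push (pair_class cst) c) (push (pair_class cst) d)"
    proof (rule poly_mapping_eq_by_pairing)
      fix t
      have "pairing (push (pair_class cst) (bilinear_ext index_product c d)) t =
          pairing c (\<lambda>i. pairing d (\<lambda>j. pairing (push (pair_class cst) (index_product i j)) t))"
        by (simp add: pairing_push pairing_bilinear_ext)
      also have "\<dots> = pairing c (\<lambda>i. pairing d (\<lambda>j.
          pairing (class_mult cst (pair_class cst i) (pair_class cst j)) t))"
      proof (intro pairing_cong)
        fix i j assume "i \<in> Poly_Mapping.keys c" "j \<in> Poly_Mapping.keys d"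
        then have "i \<in> non_Escher_pairs" "j \<in> non_Escher_pairs" using c(2) d(2) by blast+
        then show "pairing (push (pair_class cst) (index_product i j)) t =
            pairing (class_mult cst (pair_class cst i) (pair_class cst j)) t"
          by (simp add: prod)
      qed
      also have "\<dots> = pairing (bilinear_ext (class_mult cst) (push (pair_class cst) c)
          (push (pair_class cst) d)) t"
        by (simp add: pairing_push pairing_bilinear_ext)
      finally show "pairing (push (pair_class cst) (bilinear_ext index_product c d)) t = \<dots>" .
    qed
    then show ?thesis
      using map [OF Fcyc_lincomb_mult(2) [OF c(2) d(2)]] Fcyc_lincomb_mult(1) [OF c(2) d(2)]
      by (simp add: c d map)
  qed
next
  show "class_map cst \<one>\<^bsub>cQSym_minus\<^esub> = \<one>\<^bsub>A_cyc cst\<^esub>"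
    using class_map_Fcyc [OF cst, of "[]"] by (simp add: is_perm_def cDes_def Fcyc_Nil)
qed

text \<open>Every class is the class of some index pair, so \<open>class_map\<close> is onto.\<close>

lemma rat_algebra_A_cyc:
  assumes cst: "cyclic_descent_statistic cst" and comp: "cyclic_shuffle_compatible cst"
  shows "rat_algebra (A_cyc cst)"
proof (rule rat_algebra_image [OF rat_algebra_cQSym_minus class_map_hom [OF cst comp]])
  have "f \<in> class_map cst ` carrier cQSym_minus" if f: "f \<in> carrier (A_cyc cst)" for f
  proof -
    have "\<exists>i. i \<in> non_Escher_pairs \<and> pair_class cst i = a" if a: "a \<in> perm_classes cst" for a
    proof -
      obtain \<pi> where "is_perm \<pi>" "a = perm_class cst (cyc \<pi>)"
        using a unfolding perm_classes_eq by auto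
      then show ?thesis
        using cDes_in_non_Escher_pairs pair_class_cDes [OF cst] by metis
    qed
    then obtain \<iota> where \<iota>: "\<And>a. a \<in> perm_classes cst \<Longrightarrow> \<iota> a \<in> non_Escher_pairs \<and> pair_class cst (\<iota> a) = a"
      by metis
    have fk: "a \<in> perm_classes cst" if "a \<in> Poly_Mapping.keys f" for a using f that by auto
    have k: "Poly_Mapping.keys (push \<iota> f) \<subseteq> non_Escher_pairs"
    proof
      fix i assume "i \<in> Poly_Mapping.keys (push \<iota> f)"
      then obtain a where "a \<in> Poly_Mapping.keys f" "i = \<iota> a" using keys_push by fast
      then show "i \<in> non_Escher_pairs" using \<iota> [OF fk] by simp
    qed
    have "class_map cst (lincomb PS Fcyc_at (push \<iota> f)) = f"
      unfolding class_map_lincomb [OF cst k] by (rule push_push_inverse) (use \<iota> fk in blast)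
    moreover have "lincomb PS Fcyc_at (push \<iota> f) \<in> carrier cQSym_minus"
      unfolding cQSym_minus_simps lin_span_def using k by blast
    ultimately show ?thesis by (metis imageI)
  qed
  moreover have "class_map cst ` carrier cQSym_minus \<subseteq> carrier (A_cyc cst)"
    using alg_hom_closed [OF class_map_hom [OF cst comp]] by blast
  ultimately show "class_map cst ` carrier cQSym_minus = carrier (A_cyc cst)" by blast
  have "lincomb PS Fcyc_at 0 = \<zero>\<^bsub>cQSym_minus\<^esub>" by (rule ext) (simp add: lincomb_PS)
  then show "class_map cst \<zero>\<^bsub>cQSym_minus\<^esub> = \<zero>\<^bsub>A_cyc cst\<^esub>"
    using class_map_lincomb [OF cst, of 0] by (simp add: push_def)
qed

lemma poly_mapping_sum_singles:
  fixes c :: "'i \<Rightarrow>\<^sub>0 rat"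
  shows "(\<Sum>i\<in>Poly_Mapping.keys c. Poly_Mapping.single i (Poly_Mapping.lookup c i)) = c"
  by (rule poly_mapping_eq_by_pairing) (simp add: pairing_sum, simp add: pairing_def)

lemma basis_A_cyc:
  assumes cst: "cyclic_descent_statistic cst" and comp: "cyclic_shuffle_compatible cst"
  shows "is_basis (A_cyc cst) (\<lambda>a. Poly_Mapping.single a 1) (perm_classes cst)"
proof -
  interpret abelian_monoid "A_cyc cst" using rat_algebraD(4) [OF rat_algebra_A_cyc [OF cst comp]] .
  have sum: "finite J \<Longrightarrow> g ` J \<subseteq> carrier (A_cyc cst) \<Longrightarrow> finsum (A_cyc cst) g J = sum g J"
    for J and g :: "nat list set set \<Rightarrow> _"
  proof (induction J rule: finite_induct)
    case (insert i J)
    then have "g \<in> J \<rightarrow> carrier (A_cyc cst)" "g i \<in> carrier (A_cyc cst)" by blast+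
    then have "finsum (A_cyc cst) g (insert i J) = g i \<oplus>\<^bsub>A_cyc cst\<^esub> finsum (A_cyc cst) g J"
      using insert by (simp add: finsum_insert del: A_cyc_simps)
    then show ?case using insert by simp
  qed simp
  have lc: "lincomb (A_cyc cst) (\<lambda>a. Poly_Mapping.single a 1) c = c"
    if "Poly_Mapping.keys c \<subseteq> perm_classes cst" for c
  proof -
    have "Poly_Mapping.map ((*) q) (Poly_Mapping.single a 1) = Poly_Mapping.single a q" for q :: rat and a
      by (simp add: map_single)
    then have "lincomb (A_cyc cst) (\<lambda>a. Poly_Mapping.single a 1) c =
        finsum (A_cyc cst) (\<lambda>a. Poly_Mapping.single a (Poly_Mapping.lookup c a)) (Poly_Mapping.keys c)"
      by (simp add: lincomb_def)
    also have "\<dots> = (\<Sum>a\<in>Poly_Mapping.keys c. Poly_Mapping.single a (Poly_Mapping.lookup c a))"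
      by (rule sum) (use that in \<open>auto split: if_splits\<close>)
    also have "\<dots> = c" by (rule poly_mapping_sum_singles)
    finally show ?thesis .
  qed
  have "lin_span (A_cyc cst) (\<lambda>a. Poly_Mapping.single a 1) (perm_classes cst) = carrier (A_cyc cst)"
  proof -
    have "lin_span (A_cyc cst) (\<lambda>a. Poly_Mapping.single a 1) (perm_classes cst) =
        lincomb (A_cyc cst) (\<lambda>a. Poly_Mapping.single a 1) ` carrier (A_cyc cst)"
      unfolding lin_span_def by auto
    also have "\<dots> = id ` carrier (A_cyc cst)" by (rule image_cong) (simp_all add: lc)
    finally show ?thesis by simp
  qed
  then show ?thesis
    unfolding is_basis_def using lc by auto
qed

lemma countable_A_cyc: "countable (carrier (A_cyc cst))"
proof -
  have "countable (perm_classes cst)"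
  proof -
    have "perm_classes cst \<subseteq> (\<lambda>\<pi>. perm_class cst (cyc \<pi>)) ` UNIV"
      unfolding perm_classes_eq by auto
    then show ?thesis by (rule countable_subset) simp
  qed
  then have c: "countable (lists (perm_classes cst \<times> (UNIV :: rat set)))"
    by (intro countable_lists countable_SIGMA) simp_all
  have "carrier (A_cyc cst) \<subseteq> (\<lambda>l. \<Sum>(a, q)\<leftarrow>l. Poly_Mapping.single a q) `
      lists (perm_classes cst \<times> (UNIV :: rat set))"
  proof
    fix f assume f: "f \<in> carrier (A_cyc cst)"
    obtain ks where ks: "set ks = Poly_Mapping.keys f" "distinct ks"
      using finite_distinct_list [of "Poly_Mapping.keys f"] by auto
    let ?l = "map (\<lambda>a. (a, Poly_Mapping.lookup f a)) ks"
    have "(\<Sum>(a, q)\<leftarrow>?l. Poly_Mapping.single a q) =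
        (\<Sum>a\<in>set ks. Poly_Mapping.single a (Poly_Mapping.lookup f a))"
      by (simp add: comp_def sum_list_distinct_conv_sum_set [OF ks(2)])
    also have "\<dots> = f" unfolding ks(1) by (rule poly_mapping_sum_singles)
    finally have "f = (\<Sum>(a, q)\<leftarrow>?l. Poly_Mapping.single a q)" by simp
    moreover have "?l \<in> lists (perm_classes cst \<times> (UNIV :: rat set))"
      using f ks(1) by auto
    ultimately show "f \<in> (\<lambda>l. \<Sum>(a, q)\<leftarrow>l. Poly_Mapping.single a q) `
      lists (perm_classes cst \<times> (UNIV :: rat set))" by (rule image_eqI)
  qed
  then show ?thesis using c by (meson countable_image countable_subset)
qed

text \<open>The algebra \<open>A_cyc\<close>, moved to the type \<open>'v\<close>, with the basis of classes indexed by the corresponding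
  classes of compositions.\<close>

lemma ex_realization:
  assumes cst: "cyclic_descent_statistic cst" and comp: "cyclic_shuffle_compatible cst"
  shows "\<exists>(A :: (rat, 'v::infinite) module) v \<phi>. cQSym_realization cst A v \<phi>"
proof -
  obtain f :: "nat \<Rightarrow> 'v" where f: "inj f"
    using infinite_countable_subset [of "UNIV :: 'v set"] infinite_UNIV by auto
  obtain h :: "_ \<Rightarrow> nat" where h: "inj_on h (carrier (A_cyc cst))"
    using countable_A_cyc by (auto simp: countable_def)
  have g: "inj_on (f \<circ> h) (carrier (A_cyc cst))"
    using f h by (simp add: comp_inj_on inj_on_subset)
  obtain B :: "(rat, 'v) module" where B: "rat_algebra B" "f \<circ> h \<in> alg_iso (A_cyc cst) B"
    and basis: "\<And>(v :: nat list set set \<Rightarrow> _) I. is_basis (A_cyc cst) v I \<Longrightarrow> is_basis B (\<lambda>i. (f \<circ> h) (v i)) I"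
    using transport_algebra [OF rat_algebra_A_cyc [OF cst comp] g] by blast
  obtain \<theta> where \<theta>: "bij_betw \<theta> (perm_classes cst) (comp_classes cst)"
    "\<And>\<pi>. is_perm \<pi> \<Longrightarrow> \<theta> (perm_class cst (cyc \<pi>)) = comp_class cst (cComp_perm \<pi>)"
    using ex_class_bijection [OF cst] by blast
  let ?\<eta> = "the_inv_into (perm_classes cst) \<theta>"
  define v where "v \<alpha> = (f \<circ> h) (Poly_Mapping.single (?\<eta> \<alpha>) 1)" for \<alpha>
  define \<phi> where "\<phi> = (f \<circ> h) \<circ> class_map cst"
  have "is_basis B v (comp_classes cst)"
    unfolding v_def
    by (rule basis_reindex [OF B(1) basis [OF basis_A_cyc [OF cst comp]]]) (rule bij_betw_the_inv_into [OF \<theta>(1)])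
  moreover have "\<phi> \<in> alg_hom cQSym_minus B"
    unfolding \<phi>_def
    by (rule alg_hom_compose [OF class_map_hom [OF cst comp]]) (use B(2) in \<open>simp add: alg_iso_def\<close>)
  moreover have "\<phi> (Fcyc n S) = v \<alpha>"
    if a: "\<alpha> \<in> comp_classes cst" and S: "non_Escher n S" "cyc (cComp n S) \<in> \<alpha>" for \<alpha> n S
  proof -
    obtain \<pi> where p: "is_perm \<pi>" "length \<pi> = n" "cDes \<pi> = S"
      using S(1) by (auto simp: non_Escher_def)
    then have "cComp_perm \<pi> \<in> \<alpha>" using S(2) by (simp add: cComp_perm_def)
    then have "\<alpha> = \<theta> (perm_class cst (cyc \<pi>))"
      using comp_class_unique [OF cst p(1) a] \<theta>(2) [OF p(1)] by simp
    moreover have "perm_class cst (cyc \<pi>) \<in> perm_classes cst" using p(1) unfolding perm_classes_eq by auto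
    ultimately have "?\<eta> \<alpha> = perm_class cst (cyc \<pi>)"
      using \<theta>(1) by (simp add: bij_betw_def the_inv_into_f_f)
    then show ?thesis
      using class_map_Fcyc [OF cst p(1)] p by (simp add: \<phi>_def v_def)
  qed
  ultimately have "cQSym_realization cst B v \<phi>"
    unfolding cQSym_realization_def using B(1) by blast
  then show ?thesis by blast
qed

section \<open>From a homomorphism to shuffle-compatibility\<close>

lemma basis_inj:
  assumes A: "rat_algebra A" and w: "is_basis A w I"
    and k: "Poly_Mapping.keys c \<subseteq> I" "Poly_Mapping.keys d \<subseteq> I"
    and eq: "lincomb A w c = lincomb A w d"
  shows "c = d"
proof -
  let ?d = "Poly_Mapping.map ((*) (- 1)) d"
  interpret ring A using rat_algebraD(1) [OF A] .
  have kd: "Poly_Mapping.keys ?d \<subseteq> I" using keys_scale k(2) by (rule subset_trans)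
  have in_A: "w ` Poly_Mapping.keys e \<subseteq> carrier A" if "Poly_Mapping.keys e \<subseteq> I" for e :: "_ \<Rightarrow>\<^sub>0 rat"
    using that w by (auto simp: is_basis_def)
  have "lincomb A w (c + ?d) = lincomb A w (d + ?d)"
    using lincomb_add [OF A in_A in_A] k kd eq by simp
  also have "d + ?d = 0" by (rule poly_mapping_eqI) (simp add: lookup_add)
  also have "lincomb A w 0 = \<zero>\<^bsub>A\<^esub>" by (rule lincomb_zero [OF A])
  finally have "lincomb A w (c + ?d) = \<zero>\<^bsub>A\<^esub>" .
  moreover have "Poly_Mapping.keys (c + ?d) \<subseteq> I"
    using k kd by (intro subset_trans [OF Poly_Mapping.keys_add]) simp
  ultimately have "c + ?d = 0" using w unfolding is_basis_def by blast
  then have "Poly_Mapping.lookup (c + ?d) i = 0" for i by simp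
  then show ?thesis by (intro poly_mapping_eqI) (simp add: lookup_add)
qed

text \<open>Rephrases a realization by permutation classes: its basis may be indexed by these classes, and by
  the product formula the structure constants are their multiplicities in \<open>cSh\<close>.\<close>

lemma realizationE:
  assumes cst: "cyclic_descent_statistic cst" and r: "cQSym_realization cst A v \<phi>"
  obtains w where "is_basis A w (perm_classes cst)"
    "\<And>\<pi> \<alpha>. is_perm \<pi> \<Longrightarrow> \<alpha> \<in> comp_classes cst \<Longrightarrow> cComp_perm \<pi> \<in> \<alpha> \<Longrightarrow>
      w (perm_class cst (cyc \<pi>)) = v \<alpha>"
    "\<And>\<pi> \<sigma>. is_perm \<pi> \<Longrightarrow> is_perm \<sigma> \<Longrightarrow> perm_disjoint \<pi> \<sigma> \<Longrightarrow>
      lincomb A w (shuffle_classes cst \<pi> \<sigma>) =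
      w (perm_class cst (cyc \<pi>)) \<otimes>\<^bsub>A\<^esub> w (perm_class cst (cyc \<sigma>))"
    "w (perm_class cst (cyc [])) = \<one>\<^bsub>A\<^esub>"
proof -
  have A: "rat_algebra A" and basis: "is_basis A v (comp_classes cst)"
    and hom: "\<phi> \<in> alg_hom cQSym_minus A"
    and \<phi>: "\<And>\<alpha> n S. \<alpha> \<in> comp_classes cst \<Longrightarrow> non_Escher n S \<Longrightarrow> cyc (cComp n S) \<in> \<alpha> \<Longrightarrow>
      \<phi> (Fcyc n S) = v \<alpha>"
    using r unfolding cQSym_realization_def by blast+
  interpret abelian_monoid A using rat_algebraD(4) [OF A] .
  obtain \<theta> where \<theta>: "bij_betw \<theta> (perm_classes cst) (comp_classes cst)"
    "\<And>\<pi>. is_perm \<pi> \<Longrightarrow> \<theta> (perm_class cst (cyc \<pi>)) = comp_class cst (cComp_perm \<pi>)"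
    using ex_class_bijection [OF cst] by blast
  define w where "w = (\<lambda>a. v (\<theta> a))"
  have w: "is_basis A w (perm_classes cst)"
    unfolding w_def by (rule basis_reindex [OF A basis \<theta>(1)])
  have w_eq: "w (perm_class cst (cyc \<pi>)) = v \<alpha>"
    if "is_perm \<pi>" "\<alpha> \<in> comp_classes cst" "cComp_perm \<pi> \<in> \<alpha>" for \<pi> \<alpha>
    using comp_class_unique [OF cst that] \<theta>(2) [OF that(1)] by (simp add: w_def)
  have \<phi>_w: "\<phi> (Fcyc (length \<pi>) (cDes \<pi>)) = w (perm_class cst (cyc \<pi>))" if p: "is_perm \<pi>" for \<pi>
  proof -
    let ?\<alpha> = "comp_class cst (cComp_perm \<pi>)"
    have a: "?\<alpha> \<in> comp_classes cst" using p unfolding comp_classes_eq by auto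
    have m: "cComp_perm \<pi> \<in> ?\<alpha>" using mem_comp_class_iff [OF cst p p] by simp
    have "\<phi> (Fcyc (length \<pi>) (cDes \<pi>)) = v ?\<alpha>"
      using \<phi> [OF a, of "length \<pi>" "cDes \<pi>"] m cDes_in_non_Escher_pairs [OF p]
      by (simp add: cComp_perm_def)
    then show ?thesis using w_eq [OF p a m] by simp
  qed
  have w_in: "w a \<in> carrier A" if "a \<in> perm_classes cst" for a
    using w that by (auto simp: is_basis_def)
  have prod: "lincomb A w (shuffle_classes cst \<pi> \<sigma>) =
      w (perm_class cst (cyc \<pi>)) \<otimes>\<^bsub>A\<^esub> w (perm_class cst (cyc \<sigma>))"
    if ps: "is_perm \<pi>" "is_perm \<sigma>" "perm_disjoint \<pi> \<sigma>" for \<pi> \<sigma>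
  proof -
    let ?E = "shuffle_indices \<pi> \<sigma>"
    note kE = keys_shuffle_indices [OF ps]
    have iE: "i \<in> non_Escher_pairs" if "i \<in> Poly_Mapping.keys ?E" for i using kE that by blast
    have \<phi>_at: "\<phi> (Fcyc_at i) = w (pair_class cst i)" if i: "i \<in> non_Escher_pairs" for i
    proof -
      obtain \<rho> where "is_perm \<rho>" "i = (length \<rho>, cDes \<rho>)" using i by (auto simp: non_Escher_def)
      then show ?thesis using \<phi>_w pair_class_cDes [OF cst] by simp
    qed
    have "lincomb A w (shuffle_classes cst \<pi> \<sigma>) = lincomb A (\<lambda>i. w (pair_class cst i)) ?E"
      unfolding push_shuffle_indices [OF cst ps, symmetric]
      by (rule lincomb_push [OF A]) (use iE w_in pair_class_in_perm_classes [OF cst] in blast)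
    also have "\<dots> = lincomb A (\<lambda>i. \<phi> (Fcyc_at i)) ?E"
      unfolding lincomb_def
    proof (rule finsum_cong' [OF refl])
      show "(\<lambda>i. Poly_Mapping.lookup ?E i \<odot>\<^bsub>A\<^esub> \<phi> (Fcyc_at i)) \<in> Poly_Mapping.keys ?E \<rightarrow> carrier A"
      proof (rule Pi_I)
        fix i assume "i \<in> Poly_Mapping.keys ?E"
        then have "\<phi> (Fcyc_at i) \<in> carrier A"
          using \<phi>_at [OF iE] w_in pair_class_in_perm_classes [OF cst iE] by metis
        then show "Poly_Mapping.lookup ?E i \<odot>\<^bsub>A\<^esub> \<phi> (Fcyc_at i) \<in> carrier A"
          by (rule rat_algebra_smult(1) [OF A])
      qed
    qed (simp only: \<phi>_at [OF iE])
    also have "\<dots> = \<phi> (lincomb cQSym_minus Fcyc_at ?E)"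
      by (rule hom_lincomb [OF rat_algebra_cQSym_minus A hom, symmetric])
        (use iE Fcyc_at_in_span in auto)
    also have "lincomb cQSym_minus Fcyc_at ?E =
        Fcyc (length \<pi>) (cDes \<pi>) \<otimes>\<^bsub>cQSym_minus\<^esub> Fcyc (length \<sigma>) (cDes \<sigma>)"
      using lincomb_cQSym_minus [OF kE] Fcyc_mult_lincomb [OF ps] by simp
    also have "\<phi> \<dots> = w (perm_class cst (cyc \<pi>)) \<otimes>\<^bsub>A\<^esub> w (perm_class cst (cyc \<sigma>))"
    proof -
      have "Fcyc (length \<rho>) (cDes \<rho>) \<in> carrier cQSym_minus" if "is_perm \<rho>" for \<rho>
        using Fcyc_at_in_span [OF cDes_in_non_Escher_pairs [OF that]] by simp
      then show ?thesis using alg_hom_mult [OF hom] \<phi>_w ps by metis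
    qed
    finally show ?thesis .
  qed
  have "w (perm_class cst (cyc [])) = \<phi> \<one>\<^bsub>cQSym_minus\<^esub>"
    using \<phi>_w [of "[]"] by (simp add: is_perm_def cDes_def Fcyc_Nil)
  also have "\<dots> = \<one>\<^bsub>A\<^esub>" by (rule alg_hom_one [OF hom])
  finally have one: "w (perm_class cst (cyc [])) = \<one>\<^bsub>A\<^esub>" .
  show ?thesis by (rule that [OF w w_eq prod one])
qed

text \<open>The product of the basis vectors of two classes does not know the permutations that represent the
  classes, and its coordinates are the multiplicities.\<close>

lemma compatible_if_realization:
  assumes cst: "cyclic_descent_statistic cst" and r: "cQSym_realization cst A v \<phi>"
  shows "cyclic_shuffle_compatible cst"
proof -
  have A: "rat_algebra A" using r by (simp add: cQSym_realization_def)
  obtain w where w: "is_basis A w (perm_classes cst)"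
    and prod: "\<And>\<pi> \<sigma>. is_perm \<pi> \<Longrightarrow> is_perm \<sigma> \<Longrightarrow> perm_disjoint \<pi> \<sigma> \<Longrightarrow>
      lincomb A w (shuffle_classes cst \<pi> \<sigma>) =
      w (perm_class cst (cyc \<pi>)) \<otimes>\<^bsub>A\<^esub> w (perm_class cst (cyc \<sigma>))"
    by (rule realizationE [OF cst r]) blast
  show ?thesis
    unfolding cyclic_shuffle_compatible_iff
  proof (intro allI impI, elim conjE)
    fix \<pi> \<sigma> \<pi>' \<sigma>'
    assume ps: "is_perm \<pi>" "is_perm \<sigma>" "perm_disjoint \<pi> \<sigma>"
      and ps': "is_perm \<pi>'" "is_perm \<sigma>'" "perm_disjoint \<pi>' \<sigma>'"
      and "perm_class cst (cyc \<pi>) = perm_class cst (cyc \<pi>')"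
        "perm_class cst (cyc \<sigma>) = perm_class cst (cyc \<sigma>')"
    then have "lincomb A w (shuffle_classes cst \<pi> \<sigma>) = lincomb A w (shuffle_classes cst \<pi>' \<sigma>')"
      using prod [OF ps] prod [OF ps'] by simp
    then show "shuffle_classes cst \<pi> \<sigma> = shuffle_classes cst \<pi>' \<sigma>'"
      by (rule basis_inj [OF A w keys_shuffle_classes [OF ps] keys_shuffle_classes [OF ps']])
  qed
qed

text \<open>The isomorphism is the linear extension of the bijection between the bases. It is multiplicative
  because both products of basis vectors are given by the same multiplicities.\<close>

lemma ex_iso_of_realization:
  assumes cst: "cyclic_descent_statistic cst" and comp: "cyclic_shuffle_compatible cst"
    and r: "cQSym_realization cst A v \<phi>"
  shows "\<exists>\<psi> \<in> alg_iso (A_cyc cst) A.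
    \<forall>\<pi> \<alpha>. is_perm \<pi> \<and> \<alpha> \<in> comp_classes cst \<and> cComp_perm \<pi> \<in> \<alpha> \<longrightarrow>
      \<psi> (Poly_Mapping.single (perm_class cst (cyc \<pi>)) 1) = v \<alpha>"
proof -
  have A: "rat_algebra A" using r by (simp add: cQSym_realization_def)
  obtain w where w: "is_basis A w (perm_classes cst)"
    and w_eq: "\<And>\<pi> \<alpha>. is_perm \<pi> \<Longrightarrow> \<alpha> \<in> comp_classes cst \<Longrightarrow> cComp_perm \<pi> \<in> \<alpha> \<Longrightarrow>
      w (perm_class cst (cyc \<pi>)) = v \<alpha>"
    and prod: "\<And>\<pi> \<sigma>. is_perm \<pi> \<Longrightarrow> is_perm \<sigma> \<Longrightarrow> perm_disjoint \<pi> \<sigma> \<Longrightarrow>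
      lincomb A w (shuffle_classes cst \<pi> \<sigma>) =
      w (perm_class cst (cyc \<pi>)) \<otimes>\<^bsub>A\<^esub> w (perm_class cst (cyc \<sigma>))"
    and one: "w (perm_class cst (cyc [])) = \<one>\<^bsub>A\<^esub>"
    by (rule realizationE [OF cst r]) blast
  have in_A: "w ` Poly_Mapping.keys f \<subseteq> carrier A" if "f \<in> carrier (A_cyc cst)" for f
    using that w by (auto simp: is_basis_def)
  have single: "lincomb A w (Poly_Mapping.single (perm_class cst (cyc \<pi>)) 1) = w (perm_class cst (cyc \<pi>))"
    if "is_perm \<pi>" for \<pi>
  proof -
    have "w (perm_class cst (cyc \<pi>)) \<in> carrier A"
      using w that unfolding is_basis_def perm_classes_eq by auto
    then show ?thesis
      using lincomb_single [OF A, of w "perm_class cst (cyc \<pi>)" 1] rat_algebra_smult(4) [OF A] by simp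
  qed
  have "lincomb A w \<in> alg_hom (A_cyc cst) A"
  proof (rule alg_homI)
    fix f g assume f: "f \<in> carrier (A_cyc cst)" and g: "g \<in> carrier (A_cyc cst)"
    show "lincomb A w f \<in> carrier A" by (rule lincomb_closed [OF A in_A [OF f]])
    show "lincomb A w (f \<oplus>\<^bsub>A_cyc cst\<^esub> g) = lincomb A w f \<oplus>\<^bsub>A\<^esub> lincomb A w g"
      using lincomb_add [OF A in_A [OF f] in_A [OF g]] by simp
    show "lincomb A w (q \<odot>\<^bsub>A_cyc cst\<^esub> f) = q \<odot>\<^bsub>A\<^esub> lincomb A w f" for q
      using lincomb_scale [OF A in_A [OF f]] by simp
    have "lincomb A w (bilinear_ext (class_mult cst) f g) = lincomb A w f \<otimes>\<^bsub>A\<^esub> lincomb A w g"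
    proof (rule lincomb_bilinear_ext [OF A in_A [OF f] in_A [OF g]])
      fix a b assume "a \<in> Poly_Mapping.keys f" "b \<in> Poly_Mapping.keys g"
      then have "a \<in> perm_classes cst" "b \<in> perm_classes cst" using f g by auto
      then obtain \<pi> \<sigma> where ps: "is_perm \<pi>" "is_perm \<sigma>" "perm_disjoint \<pi> \<sigma>"
        and ab: "a = perm_class cst (cyc \<pi>)" "b = perm_class cst (cyc \<sigma>)"
        by (rule perm_classes_disjointE [OF cst])
      have "class_mult cst a b = shuffle_classes cst \<pi> \<sigma>"
        unfolding ab by (rule class_mult_eq [OF comp ps])
      moreover have "w ` Poly_Mapping.keys (shuffle_classes cst \<pi> \<sigma>) \<subseteq> carrier A"
        by (rule in_A) (simp add: keys_shuffle_classes [OF ps])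
      ultimately show "w ` Poly_Mapping.keys (class_mult cst a b) \<subseteq> carrier A \<and>
          lincomb A w (class_mult cst a b) = w a \<otimes>\<^bsub>A\<^esub> w b"
        using prod [OF ps] ab by simp
    qed
    then show "lincomb A w (f \<otimes>\<^bsub>A_cyc cst\<^esub> g) = lincomb A w f \<otimes>\<^bsub>A\<^esub> lincomb A w g"
      by simp
  next
    show "lincomb A w \<one>\<^bsub>A_cyc cst\<^esub> = \<one>\<^bsub>A\<^esub>"
      using single [of "[]"] one by (simp add: is_perm_def)
  qed
  moreover have "bij_betw (lincomb A w) (carrier (A_cyc cst)) (carrier A)"
  proof (rule bij_betw_imageI)
    show "inj_on (lincomb A w) (carrier (A_cyc cst))"
      by (rule inj_onI) (auto intro: basis_inj [OF A w])
    have "lin_span A w (perm_classes cst) = carrier A" using w by (simp add: is_basis_def)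
    then show "lincomb A w ` carrier (A_cyc cst) = carrier A"
      by (auto simp: lin_span_def)
  qed
  ultimately have "lincomb A w \<in> alg_iso (A_cyc cst) A" by (simp add: alg_iso_def)
  moreover have "lincomb A w (Poly_Mapping.single (perm_class cst (cyc \<pi>)) 1) = v \<alpha>"
    if "is_perm \<pi>" "\<alpha> \<in> comp_classes cst" "cComp_perm \<pi> \<in> \<alpha>" for \<pi> \<alpha>
    using single [OF that(1)] w_eq [OF that] by simp
  ultimately show ?thesis by blast
qed

theorem theorem3p5:
  fixes cst :: "nat list set \<Rightarrow> 'b"
  assumes "cyclic_descent_statistic cst"
  shows "(cyclic_shuffle_compatible cst \<longleftrightarrow>
      (\<exists>(A :: (rat, 'v::infinite) module) v \<phi>. cQSym_realization cst A v \<phi>)) \<and>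
    (\<forall>(A :: (rat, 'v) module) v \<phi>. cyclic_shuffle_compatible cst \<and> cQSym_realization cst A v \<phi> \<longrightarrow>
      (\<exists>\<psi> \<in> alg_iso (A_cyc cst) A.
        \<forall>\<pi> \<alpha>. is_perm \<pi> \<and> \<alpha> \<in> comp_classes cst \<and> cComp_perm \<pi> \<in> \<alpha> \<longrightarrow>
          \<psi> (Poly_Mapping.single (perm_class cst (cyc \<pi>)) 1) = v \<alpha>))"
  using ex_realization [OF assms] compatible_if_realization [OF assms] ex_iso_of_realization [OF assms]
  by blast

end
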